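(* Suppose that every claw-free matroid of dimension at most $8$ is even-plane, or has triangle-free complement, or is a strict PG-sum, or has a decomposer. Then every claw-free matroid (of any dimension) is even-plane, or has triangle-free complement, or is a strict PG-sum, or has a decomposer.
   Context: A matroid is a pair $M=(E,G)$ where $G$ is the set of nonzero vectors of a finite-dimensional $\mathbb F_2$-vector space $V(G)=G\cup\{0\}$ and $E\subseteq G$; its dimension is $\dim V(G)$. A flat of $G$ is a set $F\subseteq G$ with $F\cup\{0\}$ a subspace; triangles and planes are flats of dimension $2$ and $3$. $M|F=(E\cap F,F)$. A claw is $(B,G)$ with $\dim G=3$, $B$ a basis; $M$ is claw-free if no $M|F$ is isomorphic (via a linear isomorphism) to a claw. $M$ is even-plane if $|E\cap P|$ is even for every plane $P$. $M^c=(G\setminus E,G)$; triangle-free means the ground set contains no triangle. $M$ is a strict PG-sum if $E$ spans $V(G)$ and $E$ is the union of two disjoint nonempty flats. A coset of a flat $F$ is $x+(F\cup\{0\})$ with $x\in G\setminus F$; it is mixed if it meets both $E$ and $G\setminus E$; a decomposer is a nonempty flat $F\ne G$ with no mixed cosets. *)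

theory Defs
  imports Complex_Main "HOL-Library.Z2"
begin

text \<open>
  All matroids live in one arbitrary, possibly infinite-dimensional, vector space over the field
  \<^typ>\<open>bit\<close> with two elements; the space \<open>V(G)\<close> of a matroid is a finite-dimensional subspace of it.
  A matroid \<open>(E, G)\<close> is a pair of sets of vectors: \<open>fst\<close> is \<open>E\<close> and \<open>snd\<close> is \<open>G\<close>.
\<close>

type_synonym 'v bmatroid = "'v set \<times> 'v set"

definition restriction :: "'v bmatroid \<Rightarrow> 'v set \<Rightarrow> 'v bmatroid" where
  "restriction M F = (fst M \<inter> F, F)"

definition matroid_complement :: "'v bmatroid \<Rightarrow> 'v bmatroid" where
  "matroid_complement M = (snd M - fst M, snd M)"

definition mixed :: "'v bmatroid \<Rightarrow> 'v set \<Rightarrow> bool" where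
  "mixed M A \<longleftrightarrow> A \<inter> fst M \<noteq> {} \<and> A \<inter> (snd M - fst M) \<noteq> {}"

locale f2_space = vector_space scale
  for scale :: "bit \<Rightarrow> 'v::ab_group_add \<Rightarrow> 'v" (infixr \<open>*s\<close> 75)
begin

abbreviation V :: "'v set \<Rightarrow> 'v set" where
  "V G \<equiv> G \<union> {0}"

text \<open>Finite-dimensionality is stated separately, since \<^const>\<open>dim\<close> is 0 on infinite-dimensional subspaces.\<close>

definition geometry :: "'v set \<Rightarrow> bool" where
  "geometry G \<longleftrightarrow> 0 \<notin> G \<and> subspace (V G) \<and> (\<exists>B. finite B \<and> span B = V G)"

definition matroid :: "'v bmatroid \<Rightarrow> bool" where
  "matroid M \<longleftrightarrow> geometry (snd M) \<and> fst M \<subseteq> snd M"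

definition gdim :: "'v set \<Rightarrow> nat" where
  "gdim G = dim (V G)"

definition flat :: "'v set \<Rightarrow> 'v set \<Rightarrow> bool" where
  "flat G F \<longleftrightarrow> F \<subseteq> G \<and> subspace (V F)"

definition triangle :: "'v set \<Rightarrow> 'v set \<Rightarrow> bool" where
  "triangle G T \<longleftrightarrow> flat G T \<and> gdim T = 2"

definition plane :: "'v set \<Rightarrow> 'v set \<Rightarrow> bool" where
  "plane G P \<longleftrightarrow> flat G P \<and> gdim P = 3"

definition isomorphic :: "'v bmatroid \<Rightarrow> 'v bmatroid \<Rightarrow> bool" where
  "isomorphic M N \<longleftrightarrow>
     (\<exists>f. bij_betw f (V (snd M)) (V (snd N)) \<and>
          (\<forall>x\<in>V (snd M). \<forall>y\<in>V (snd M). f (x + y) = f x + f y) \<and>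
          (\<forall>c. \<forall>x\<in>V (snd M). f (c *s x) = c *s f x) \<and>
          f ` fst M = fst N)"

definition claw :: "'v bmatroid \<Rightarrow> bool" where
  "claw C \<longleftrightarrow> matroid C \<and> gdim (snd C) = 3 \<and> independent (fst C) \<and> span (fst C) = V (snd C)"

definition claw_free :: "'v bmatroid \<Rightarrow> bool" where
  "claw_free M \<longleftrightarrow> \<not> (\<exists>F C. flat (snd M) F \<and> claw C \<and> isomorphic (restriction M F) C)"

definition even_plane :: "'v bmatroid \<Rightarrow> bool" where
  "even_plane M \<longleftrightarrow> (\<forall>P. plane (snd M) P \<longrightarrow> even (card (fst M \<inter> P)))"

definition triangle_free :: "'v bmatroid \<Rightarrow> bool" where
  "triangle_free M \<longleftrightarrow> \<not> (\<exists>T. triangle (snd M) T \<and> T \<subseteq> fst M)"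

definition strict_PG_sum :: "'v bmatroid \<Rightarrow> bool" where
  "strict_PG_sum M \<longleftrightarrow> span (fst M) = V (snd M) \<and>
     (\<exists>F1 F2. flat (snd M) F1 \<and> flat (snd M) F2 \<and> F1 \<noteq> {} \<and> F2 \<noteq> {} \<and>
        F1 \<inter> F2 = {} \<and> fst M = F1 \<union> F2)"

definition flat_coset :: "'v set \<Rightarrow> 'v set \<Rightarrow> 'v set \<Rightarrow> bool" where
  "flat_coset G F A \<longleftrightarrow> (\<exists>x\<in>G - F. A = {x + y | y. y \<in> V F})"

definition decomposer :: "'v bmatroid \<Rightarrow> 'v set \<Rightarrow> bool" where
  "decomposer M F \<longleftrightarrow> flat (snd M) F \<and> F \<noteq> {} \<and> F \<noteq> snd M \<and>
     \<not> (\<exists>A. flat_coset (snd M) F A \<and> mixed M A)"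

end

end

(*
  Call a matroid indecomposable if it has no decomposer. An indecomposable restriction M|F of an
  indecomposable claw-free M extends to an indecomposable M|F' with dim F' - dim F = 1, or with
  dim F' - dim F = 2 and M|F' even-plane or with triangle-free complement (as for induced prime
  subgraphs of prime graphs). Every indecomposable claw-free matroid of dimension at least 2
  restricts to the complement of a claw.

  Let M be a counterexample of least dimension n > 8. It has an indecomposable restriction to a
  hyperplane H, which is a strict PG-sum, even-plane, or has triangle-free complement. A claw-free
  indecomposable one-point extension of a PG-sum is a PG-sum or has triangle-free complement. If M|H
  is even-plane, some four-dimensional indecomposable restriction of M is not, and extending it yields
  an indecomposable hyperplane H' with M|H' not even-plane, so with triangle-free complement; if M|H
  has triangle-free complement one finds in the same way an even-plane M|H'. Either way the
  restriction to H and H' together is even-plane with triangle-free complement, which is impossible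
  in dimension at least 5: the quadratic form vanishes on some line.
*)

theory Submission
  imports Defs
begin

text \<open>\<open>E\<close> is fixed once on the ambient space and every notion is a predicate of a
  subspace \<open>U\<close> containing 0, so restriction is passage to a smaller subspace and
  \<open>card U\<close>, which is 2 to the dimension, replaces the dimension. The obstacle to
  extending an indecomposable \<open>F\<close> by one point \<open>x\<close> is that
  \<open>x + F\<close> may have constant membership in \<open>E\<close>, or repeat \<open>F\<close>
  up to the value at one representative, a clone. If no one-point extension works, all cosets are of
  these kinds. The clones with 0 would form a decomposer if closed under addition; the two ways in
  which closure fails, \<open>x + y + F\<close> constant or with a clone \<open>x + y + d\<close>,
  give the two-dimensional extensions. The passage from \<open>H\<close> to \<open>H'\<close> rests
  on one principle: if no complement of a claw in \<open>H\<close> had an indecomposable extension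
  by a point off \<open>H\<close> showing the defect of \<open>U\<close>, every such extension
  showing the defect would come from a constant coset or a clone, and these local patterns would
  spread to a decomposer of \<open>U\<close>. Claw-freeness is used by exhibiting three explicit
  points of \<open>E\<close> whose four sums avoid \<open>E\<close>.\<close>

context f2_space
begin

section \<open>Vector spaces over the field with two elements\<close>

lemma add_self [simp]: "x + x = (0::'v)"
proof -
  have "x + x = (1 + 1 :: bit) *s x"
    by (metis scale_left_distrib scale_one)
  then show ?thesis by simp
qed

lemma add_self_left [simp]: "x + (x + y) = (y::'v)"
  by (simp add: add.assoc [symmetric])

lemmas f2_simps = add_self add_self_left add.commute add.left_commute add.assoc

lemma sum_zero_iff: "x + y = 0 \<longleftrightarrow> x = (y::'v)"
  by (metis add_self add_left_cancel)

lemma subspace_iff: "subspace S \<longleftrightarrow> 0 \<in> S \<and> (\<forall>x\<in>S. \<forall>y\<in>S. x + y \<in> S)"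
proof
  assume "0 \<in> S \<and> (\<forall>x\<in>S. \<forall>y\<in>S. x + y \<in> S)"
  moreover have "c *s x \<in> S" if "x \<in> S" "0 \<in> S" for c x
    using that by (cases c rule: bit.exhaust) auto
  ultimately show "subspace S" by (auto simp: subspace_def)
qed (auto simp: subspace_def)

lemma subspaceD:
  assumes "subspace S"
  shows "0 \<in> S" "x \<in> S \<Longrightarrow> y \<in> S \<Longrightarrow> x + y \<in> S"
    "x \<in> S \<Longrightarrow> x + y \<in> S \<longleftrightarrow> y \<in> S" "x \<in> S \<Longrightarrow> y + x \<in> S \<longleftrightarrow> y \<in> S"
proof -
  show *: "x + y \<in> S" if "x \<in> S" "y \<in> S" for x y
    using assms that by (auto simp: subspace_iff)
  show "0 \<in> S" using assms by (auto simp: subspace_iff)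
  show "x + y \<in> S \<longleftrightarrow> y \<in> S" if "x \<in> S"
    using * that by (metis add_self_left)
  then show "y + x \<in> S \<longleftrightarrow> y \<in> S" if "x \<in> S"
    using that by (simp add: add.commute)
qed

text \<open>The span of \<open>F\<close> and \<open>x\<close> when \<open>F\<close> is a subspace.
  As a membership condition it lets the simplifier decide whether explicit sums belong to
  it.\<close>

definition adjoin :: "'v \<Rightarrow> 'v set \<Rightarrow> 'v set" where
  "adjoin x F = {y. y \<in> F \<or> x + y \<in> F}"

lemma adjoin_iff: "y \<in> adjoin x F \<longleftrightarrow> y \<in> F \<or> x + y \<in> F"
  by (simp add: adjoin_def)

lemma adjoinE:
  assumes "y \<in> adjoin x F"
  obtains "y \<in> F" | u where "u \<in> F" "y = x + u"
  using assms by (metis adjoin_iff add_self_left)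

lemma subspace_adjoin:
  assumes F: "subspace F"
  shows "subspace (adjoin x F)"
  unfolding subspace_iff
proof (intro conjI ballI)
  show "0 \<in> adjoin x F" using F by (simp add: adjoin_iff subspaceD)
  fix a b assume ab: "a \<in> adjoin x F" "b \<in> adjoin x F"
  show "a + b \<in> adjoin x F"
    using ab(1)
  proof (cases rule: adjoinE)
    case a: 1
    show ?thesis using ab(2)
      by (cases rule: adjoinE) (use F a in \<open>auto simp: adjoin_iff f2_simps subspaceD\<close>)
  next
    case a: (2 u)
    show ?thesis using ab(2)
      by (cases rule: adjoinE) (use F a in \<open>auto simp: adjoin_iff f2_simps subspaceD\<close>)
  qed
qed

lemma adjoin_subset: "subspace U \<Longrightarrow> F \<subseteq> U \<Longrightarrow> x \<in> U \<Longrightarrow> adjoin x F \<subseteq> U"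
  unfolding adjoin_def using subspaceD(3) by blast

lemma subset_adjoin: "F \<subseteq> adjoin x F"
  by (auto simp: adjoin_iff)

lemma mem_adjoin: "subspace F \<Longrightarrow> x \<in> adjoin x F"
  by (simp add: adjoin_iff subspaceD)

lemma finite_adjoin: "finite F \<Longrightarrow> finite (adjoin x F)"
  by (rule finite_subset [of _ "F \<union> (+) x ` F"]) (auto elim: adjoinE)

lemma card_adjoin_le:
  assumes "finite F"
  shows "card (adjoin x F) \<le> 2 * card F"
proof -
  have "adjoin x F \<subseteq> F \<union> (+) x ` F" by (auto elim: adjoinE)
  then have "card (adjoin x F) \<le> card (F \<union> (+) x ` F)"
    using assms by (intro card_mono) auto
  also have "\<dots> \<le> card F + card ((+) x ` F)" by (rule card_Un_le)
  also have "\<dots> \<le> 2 * card F" using card_image_le [OF assms, of "(+) x"] by simp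
  finally show ?thesis .
qed

lemma subspace_pair: "subspace {0, d}"
  by (auto simp: subspace_iff)

text \<open>The translations mapping \<open>S\<close> into itself are closed under addition, which
  over two elements makes them a subspace. In use, \<open>S\<close> is shown to be a union of cosets
  of \<open>span D\<close>; a point \<open>y\<close> of \<open>S\<close> in that span then gives
  \<open>y + y = 0\<close> in \<open>S\<close>, usually a contradiction.\<close>

lemma span_translation_closed:
  assumes "y \<in> span D" "\<And>x d. x \<in> S \<Longrightarrow> d \<in> D \<Longrightarrow> x + d \<in> S" "x \<in> S"
  shows "x + y \<in> S"
proof -
  have "subspace {y. \<forall>x\<in>S. x + y \<in> S}"
    by (auto simp: subspace_iff add.assoc [symmetric])
  moreover have "D \<subseteq> {y. \<forall>x\<in>S. x + y \<in> S}" using assms(2) by auto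
  ultimately have "span D \<subseteq> {y. \<forall>x\<in>S. x + y \<in> S}" by (rule span_minimal [rotated])
  then show ?thesis using assms by auto
qed

end

section \<open>Point sets in a binary space\<close>

locale f2_points = f2_space +
  fixes E :: "'a set"
  assumes zero_notin_E [simp]: "0 \<notin> E"
begin

text \<open>Three distinct points of \<open>E\<close> that violate the conclusion are independent,
  since \<open>r = p + q\<close> would put \<open>p + q\<close> into \<open>E\<close>; so they do
  span a claw.\<close>

definition clawless :: "'a set \<Rightarrow> bool" where
  "clawless U \<longleftrightarrow> (\<forall>p\<in>E \<inter> U. \<forall>q\<in>E \<inter> U. \<forall>r\<in>E \<inter> U. p \<noteq> q \<longrightarrow> p \<noteq> r \<longrightarrow> q \<noteq> r \<longrightarrow>
     p + q \<in> E \<or> p + r \<in> E \<or> q + r \<in> E \<or> p + q + r \<in> E)"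

text \<open>The subspaces \<open>V F\<close> of decomposers \<open>F\<close>.\<close>

definition summand :: "'a set \<Rightarrow> 'a set \<Rightarrow> bool" where
  "summand U D \<longleftrightarrow> subspace D \<and> D \<subseteq> U \<and> D \<noteq> {0} \<and> D \<noteq> U \<and>
     (\<forall>x\<in>U - D. \<forall>y\<in>D. x + y \<in> E \<longleftrightarrow> x \<in> E)"

text \<open>The two distinct nonzero vectors demand dimension at least 2; below that, the absence of
  summands says nothing.\<close>

definition indecomposable :: "'a set \<Rightarrow> bool" where
  "indecomposable U \<longleftrightarrow> subspace U \<and> (\<exists>a\<in>U. \<exists>b\<in>U. a \<noteq> 0 \<and> b \<noteq> 0 \<and> a \<noteq> b) \<and> (\<nexists>D. summand U D)"

definition cotriangle_free :: "'a set \<Rightarrow> bool" where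
  "cotriangle_free U \<longleftrightarrow> (\<forall>a\<in>U. \<forall>b\<in>U. a \<noteq> 0 \<longrightarrow> b \<noteq> 0 \<longrightarrow> a \<noteq> b \<longrightarrow> a \<in> E \<or> b \<in> E \<or> a + b \<in> E)"

text \<open>A matroid is even-plane iff the indicator function of \<open>E\<close> is a quadratic form, that is, iff the
  function \<open>polar\<close> below (with values in \<^typ>\<open>bool\<close> instead of \<^typ>\<open>bit\<close>, so that \<open>\<noteq>\<close> is addition) is
  bilinear.\<close>

definition polar :: "'a \<Rightarrow> 'a \<Rightarrow> bool" where
  "polar a b \<longleftrightarrow> ((a + b \<in> E) \<noteq> ((a \<in> E) \<noteq> (b \<in> E)))"

definition quadratic :: "'a set \<Rightarrow> bool" where
  "quadratic U \<longleftrightarrow> (\<forall>a\<in>U. \<forall>b\<in>U. \<forall>c\<in>U. polar a (b + c) = (polar a b \<noteq> polar a c))"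

definition PG_sum :: "'a set \<Rightarrow> bool" where
  "PG_sum U \<longleftrightarrow> (\<exists>A B. subspace A \<and> subspace B \<and> A \<noteq> {0} \<and> B \<noteq> {0} \<and> A \<inter> B = {0} \<and>
     U = {a + b | a b. a \<in> A \<and> b \<in> B} \<and> E \<inter> U = A \<union> B - {0})"

text \<open>The complement of a claw with basis \<open>a, b, c\<close>. The seven conditions and
  \<open>0 \<notin> E\<close> imply independence: a coincidence such as \<open>a + b = c\<close>
  would place one vector inside and outside \<open>E\<close>.\<close>

definition coclaw :: "'a \<Rightarrow> 'a \<Rightarrow> 'a \<Rightarrow> bool" where
  "coclaw a b c \<longleftrightarrow> a \<notin> E \<and> b \<notin> E \<and> c \<notin> E \<and> a + b \<in> E \<and> a + c \<in> E \<and> b + c \<in> E \<and> a + b + c \<in> E"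

text \<open>The coset \<open>x + F\<close> repeats \<open>E \<inter> F\<close>; whether \<open>x\<close> itself is in \<open>E\<close> is left open.\<close>

definition clone :: "'a set \<Rightarrow> 'a \<Rightarrow> bool" where
  "clone F x \<longleftrightarrow> x \<notin> F \<and> (\<forall>u\<in>F. u \<noteq> 0 \<longrightarrow> (x + u \<in> E \<longleftrightarrow> u \<in> E))"

text \<open>Distinctness of the three points is expressed by their sums being nonzero.\<close>

lemma claw_contra:
  assumes "clawless U" "p \<in> U" "q \<in> U" "r \<in> U" "p \<in> E" "q \<in> E" "r \<in> E"
    "p + q = s" "p + r = t" "q + r = v" "p + q + r = w"
    "s \<notin> E" "t \<notin> E" "v \<notin> E" "w \<notin> E" "s \<noteq> 0" "t \<noteq> 0" "v \<noteq> 0"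
  shows False
  using assms unfolding clawless_def by (metis IntI add_self)

lemma clawless_subset: "clawless U \<Longrightarrow> F \<subseteq> U \<Longrightarrow> clawless F"
  unfolding clawless_def by (meson IntD1 IntD2 IntI subsetD)

lemma indecomposableD:
  assumes "indecomposable F"
  shows "subspace F" "0 \<in> F" "\<not> summand F D"
  using assms by (auto simp: indecomposable_def subspaceD)

section \<open>Witnesses provided by indecomposability\<close>

text \<open>Otherwise \<open>{0, d}\<close> would be a summand. The pair is oriented so that
  \<open>u\<close> is its member in \<open>E\<close>; most claws below are built from such a
  pair.\<close>

lemma exists_mixed_pair:
  assumes F: "indecomposable F" and d: "d \<in> F" "d \<noteq> 0"
  obtains u where "u \<in> F" "u \<noteq> 0" "u \<noteq> d" "u \<in> E" "u + d \<notin> E"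
proof -
  have s: "subspace F" using F by (rule indecomposableD)
  have "F \<noteq> {0, d}" using F by (auto simp: indecomposable_def)
  moreover have "\<not> summand F {0, d}" using F by (rule indecomposableD)
  ultimately obtain x where x: "x \<in> F" "x \<noteq> 0" "x \<noteq> d" "(x + d \<in> E) \<noteq> (x \<in> E)"
    using d s subspace_pair [of d] by (auto simp: summand_def subspaceD)
  show thesis
  proof (cases "x \<in> E")
    case True then show ?thesis using x that by auto
  next
    case False
    have "x + d \<in> F" "x + d \<noteq> 0" "x + d \<noteq> d" "x + d + d = x"
      using x d s by (auto simp: subspaceD sum_zero_iff add.assoc)
    then show ?thesis using x False that [of "x + d"] by (metis)
  qed
qed

lemma exists_mixed_points:
  assumes F: "indecomposable F"
  obtains u v where "u \<in> F" "v \<in> F" "u \<in> E" "v \<notin> E" "v \<noteq> 0"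
proof -
  obtain d where d: "d \<in> F" "d \<noteq> 0" using F by (auto simp: indecomposable_def)
  from exists_mixed_pair [OF F d] obtain u where "u \<in> F" "u \<noteq> 0" "u \<noteq> d" "u \<in> E" "u + d \<notin> E" .
  then show thesis using d F that [of u "u + d"] by (auto simp: sum_zero_iff indecomposableD subspaceD)
qed

text \<open>Otherwise \<open>F - E\<close> would be a subspace, and a summand because every point
  off it lies in \<open>E\<close>.\<close>

lemma exists_coline:
  assumes F: "indecomposable F"
  obtains u v where "u \<in> F" "v \<in> F" "u \<noteq> 0" "v \<noteq> 0" "u \<noteq> v" "u \<notin> E" "v \<notin> E" "u + v \<in> E"
proof -
  have s: "subspace F" using F by (rule indecomposableD)
  obtain p q where pq: "p \<in> F" "q \<in> F" "p \<in> E" "q \<notin> E" "q \<noteq> 0" using exists_mixed_points [OF F] .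
  let ?D = "F - E"
  show thesis
  proof (cases "subspace ?D")
    case True
    have "summand F ?D"
      unfolding summand_def using True pq s by (auto simp: subspaceD) (metis DiffI True subspaceD(4) Diff_iff)
    then show ?thesis using F by (auto simp: indecomposable_def)
  next
    case False
    then obtain u v where "u \<in> F" "v \<in> F" "u \<notin> E" "v \<notin> E" "u + v \<in> E"
      using s by (auto simp: subspace_iff)
    moreover from this have "u \<noteq> 0" "v \<noteq> 0" "u \<noteq> v" by auto
    ultimately show ?thesis using that by blast
  qed
qed

text \<open>Otherwise \<open>F \<inter> E\<close> with 0 would be a subspace, and a summand because
  no point off it lies in \<open>E\<close>.\<close>

lemma exists_line:
  assumes F: "indecomposable F"
  obtains u v where "u \<in> F" "v \<in> F" "u \<noteq> v" "u \<in> E" "v \<in> E" "u + v \<notin> E"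
proof -
  have s: "subspace F" using F by (rule indecomposableD)
  obtain p q where pq: "p \<in> F" "q \<in> F" "p \<in> E" "q \<notin> E" "q \<noteq> 0" using exists_mixed_points [OF F] .
  let ?D = "insert 0 (F \<inter> E)"
  show thesis
  proof (cases "subspace ?D")
    case True
    have "?D \<noteq> {0}" "?D \<noteq> F" using pq by auto
    moreover have "x + y \<in> E \<longleftrightarrow> x \<in> E" if "x \<in> F - ?D" "y \<in> ?D" for x y
      using that subspaceD(4) [OF True, of y x] subspaceD(4) [OF s, of y x] by auto
    ultimately have "summand F ?D"
      unfolding summand_def using True s by (auto simp: subspaceD)
    then show ?thesis using F by (auto simp: indecomposable_def)
  next
    case False
    then obtain u v where "u \<in> ?D" "v \<in> ?D" "u + v \<notin> ?D"
      unfolding subspace_iff by blast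
    then have "u \<in> F" "v \<in> F" "u \<noteq> v" "u \<in> E" "v \<in> E" "u + v \<notin> E"
      using s by (auto simp: subspaceD)
    then show ?thesis by (rule that)
  qed
qed

text \<open>The intersection inherits the coset condition, so it would be a summand of
  \<open>F\<close> if it were nontrivial and proper. This confronts a summand of a large space with
  an indecomposable subspace.\<close>

lemma summand_inter:
  assumes D: "summand U D" and F: "subspace F" "F \<subseteq> U" "\<nexists>D. summand F D"
  shows "D \<inter> F = {0} \<or> F \<subseteq> D"
proof (rule ccontr)
  assume n: "\<not> ?thesis"
  have s: "subspace D" and *: "\<And>x y. x \<in> U \<Longrightarrow> x \<notin> D \<Longrightarrow> y \<in> D \<Longrightarrow> x + y \<in> E \<longleftrightarrow> x \<in> E"
    using D by (auto simp: summand_def)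
  have "subspace (D \<inter> F)" using s F(1) by (rule subspace_inter)
  moreover have "D \<inter> F \<noteq> {0}" "D \<inter> F \<noteq> F" using n by auto
  moreover have "\<forall>x\<in>F - D \<inter> F. \<forall>y\<in>D \<inter> F. x + y \<in> E \<longleftrightarrow> x \<in> E"
    using * F(2) by blast
  ultimately have "summand F (D \<inter> F)" unfolding summand_def by blast
  then show False using F by blast
qed

text \<open>A summand of the extension that contains \<open>F\<close> cannot contain
  \<open>x\<close>, so the coset \<open>x + F\<close> is constant. One that meets \<open>F\<close>
  only in 0 contains some \<open>w\<close> in \<open>x + F\<close>, and translation by
  \<open>w\<close> makes it a clone.\<close>

lemma clone_or_constant:
  assumes F: "indecomposable F" and x: "x \<notin> F" and n: "\<not> indecomposable (adjoin x F)"
  shows "(\<forall>u\<in>F. x + u \<in> E \<longleftrightarrow> x \<in> E) \<or> (\<exists>k\<in>F. clone F (x + k))"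
proof -
  have s: "subspace F" using F by (rule indecomposableD)
  have "\<exists>a\<in>adjoin x F. \<exists>b\<in>adjoin x F. a \<noteq> 0 \<and> b \<noteq> 0 \<and> a \<noteq> b"
    using F subset_adjoin [of F x] unfolding indecomposable_def by blast
  then obtain D where D: "summand (adjoin x F) D"
    using n s by (auto simp: indecomposable_def subspace_adjoin)
  then have "D \<inter> F = {0} \<or> F \<subseteq> D"
    by (rule summand_inter) (use F in \<open>auto simp: s subset_adjoin indecomposable_def\<close>)
  then show ?thesis
  proof
    assume FD: "F \<subseteq> D"
    have "x \<notin> D"
    proof
      assume "x \<in> D"
      then have "adjoin x F \<subseteq> D" using FD D by (intro adjoin_subset) (auto simp: summand_def)
      then show False using D by (auto simp: summand_def)
    qed
    then have "\<forall>u\<in>F. x + u \<in> E \<longleftrightarrow> x \<in> E"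
      using D FD s by (auto simp: summand_def mem_adjoin)
    then show ?thesis ..
  next
    assume DF: "D \<inter> F = {0}"
    have "0 \<in> D" "D \<noteq> {0}" "D \<subseteq> adjoin x F" using D by (auto simp: summand_def subspaceD)
    then obtain w where w: "w \<in> D" "w \<noteq> 0" "w \<in> adjoin x F" by blast
    then have "w \<notin> F" using DF by auto
    with w obtain k where k: "k \<in> F" "w = x + k" by (auto elim: adjoinE)
    have "clone F w"
      unfolding clone_def
    proof (intro conjI ballI impI)
      fix u assume u: "u \<in> F" "u \<noteq> 0"
      then have "u \<in> adjoin x F - D" using DF by (auto simp: adjoin_iff)
      then have "u + w \<in> E \<longleftrightarrow> u \<in> E" using D w by (auto simp: summand_def)
      then show "w + u \<in> E \<longleftrightarrow> u \<in> E" by (simp add: add.commute)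
    qed fact
    then show ?thesis using k by auto
  qed
qed

text \<open>Adding one basis vector to another moves it into \<open>E\<close>, so a summand contains
  all of \<open>a, b, c\<close> or none. If none, it contains no other nonzero vector of
  \<open>K\<close> either, as each of these also moves some basis vector into \<open>E\<close>. The
  hypothesis \<open>min\<close> says that \<open>K\<close> is the span of
  \<open>a, b, c\<close>.\<close>

lemma coclaw_indecomposable:
  assumes K: "subspace K" and abc: "coclaw a b c" "a \<in> K" "b \<in> K" "c \<in> K"
    and min: "\<And>S. subspace S \<Longrightarrow> a \<in> S \<Longrightarrow> b \<in> S \<Longrightarrow> c \<in> S \<Longrightarrow> K \<subseteq> S"
  shows "indecomposable K"
proof -
  have f: "a \<notin> E" "b \<notin> E" "c \<notin> E" "a + b \<in> E" "a + c \<in> E" "b + c \<in> E" "a + (b + c) \<in> E"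
    using abc(1) by (auto simp: coclaw_def add.assoc)
  have "a \<noteq> 0" "b \<noteq> 0" "a \<noteq> b" using f by auto
  moreover have False if D: "summand K D" for D
  proof -
    have s: "subspace D" and DK: "D \<subseteq> K" "D \<noteq> {0}" "D \<noteq> K" using D by (auto simp: summand_def)
    have cl: "x \<in> D" if "x \<in> K" "y \<in> D" "(x + y \<in> E) \<noteq> (x \<in> E)" for x y
      using D that by (auto simp: summand_def)
    obtain e where e: "e \<in> D" "e \<noteq> 0" using DK s subspaceD(1) by fastforce
    have 1: "a \<in> D \<longleftrightarrow> b \<in> D" "a \<in> D \<longleftrightarrow> c \<in> D"
      using cl f abc by (metis add.commute)+
    then have na: "a \<notin> D" using min [OF s] DK by auto
    have 2: "a + b \<notin> D" using cl [OF abc(4), of "a + b"] 1 na f by (auto simp: f2_simps)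
    have 3: "a + c \<notin> D" using cl [OF abc(3), of "a + c"] 1 na f by (auto simp: f2_simps)
    have 4: "b + c \<notin> D" using cl [OF abc(2), of "b + c"] 1 na f by (auto simp: f2_simps)
    have 5: "a + (b + c) \<notin> D" using cl [OF abc(2), of "a + (b + c)"] 1 na f by (auto simp: f2_simps)
    define S where "S = {0, a, b, c, a + b, a + c, b + c, a + (b + c)}"
    have "subspace S" unfolding S_def by (simp add: subspace_iff f2_simps)
    then have "K \<subseteq> S" by (rule min) (auto simp: S_def)
    then have "e \<in> S" using e DK by auto
    then show False using e na 1 2 3 4 5 unfolding S_def by auto
  qed
  ultimately show ?thesis using K abc unfolding indecomposable_def by blast
qed

lemma cloneD: "clone F x \<Longrightarrow> u \<in> F \<Longrightarrow> u \<noteq> 0 \<Longrightarrow> x + u \<in> E \<longleftrightarrow> u \<in> E"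
  by (simp add: clone_def)

lemma indecomposableI:
  assumes "indecomposable F" "F \<subseteq> F'" "subspace F'" "\<And>D. summand F' D \<Longrightarrow> False"
  shows "indecomposable F'"
  using assms unfolding indecomposable_def by (meson subsetD)

lemma mixed_off_point:
  assumes F: "indecomposable F" and v: "v \<in> F"
  shows "\<exists>u\<in>F. u \<noteq> 0 \<and> u \<noteq> v \<and> (u \<in> E \<longleftrightarrow> c)"
proof -
  have s: "subspace F" using F by (rule indecomposableD)
  show ?thesis
  proof (cases "v = 0")
    case True
    then show ?thesis using exists_mixed_points [OF F] by (metis zero_notin_E)
  next
    case False
    then obtain u where u: "u \<in> F" "u \<noteq> 0" "u \<noteq> v" "u \<in> E" "u + v \<notin> E"
      using exists_mixed_pair [OF F v] by blast
    then have "u + v \<in> F" "u + v \<noteq> 0" "u + v \<noteq> v" using v s by (auto simp: subspaceD sum_zero_iff)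
    then show ?thesis using u by (cases c) auto
  qed
qed

section \<open>Indecomposability of extensions by clones\<close>

text \<open>A summand containing \<open>F\<close> contains every clone, because the coset of a clone
  is not constant. A summand meeting \<open>F\<close> trivially meets the coset of a clone at most
  in the clone itself; translation by that clone matches the copies of \<open>F\<close> in two other
  cosets with a shift by \<open>d\<close>, and a pair \<open>u, u + d\<close> split by
  \<open>E\<close> contradicts this. All three nontrivial cosets contain a clone, so the cases are
  permutations of one.\<close>

lemma indecomposable_three_clones:
  assumes F: "indecomposable F" and x: "clone F x" and xy: "x + y \<notin> F"
    and d: "d \<in> F" "d \<noteq> 0" and y: "clone F y" and z: "clone F (x + y + d)"
  shows "indecomposable (adjoin y (adjoin x F))" (is "indecomposable ?W")
proof (rule indecomposableI [OF F])
  have s: "subspace F" using F by (rule indecomposableD)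
  have [simp]: "0 \<in> F" using s by (rule subspaceD)
  show "F \<subseteq> ?W" by (auto simp: adjoin_iff)
  show W: "subspace ?W" by (intro subspace_adjoin s)
  have mem: "v \<in> ?W \<longleftrightarrow> v \<in> F \<or> x + v \<in> F \<or> y + v \<in> F \<or> x + y + v \<in> F" for v
    by (auto simp: adjoin_iff f2_simps)
  have xF: "x \<notin> F" using x by (simp add: clone_def)
  fix D assume D: "summand ?W D"
  then have sD: "subspace D" and DW: "D \<subseteq> ?W" "D \<noteq> {0}" "D \<noteq> ?W"
    and un: "\<And>v w. v \<in> ?W \<Longrightarrow> v \<notin> D \<Longrightarrow> w \<in> D \<Longrightarrow> v + w \<in> E \<longleftrightarrow> v \<in> E"
    by (auto simp: summand_def)
  have "D \<inter> F = {0} \<or> F \<subseteq> D"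
    by (rule summand_inter [OF D]) (use F in \<open>auto simp: s mem indecomposable_def\<close>)
  then show False
  proof
    assume FD: "F \<subseteq> D"
    have const: "w \<in> D" if w: "clone F w" "w \<in> ?W" for w
    proof (rule ccontr)
      assume "w \<notin> D"
      then have "u \<in> E \<longleftrightarrow> w \<in> E" if "u \<in> F" "u \<noteq> 0" for u
        using un [of w u] that w FD by (auto simp: clone_def)
      then show False using exists_mixed_points [OF F] by (metis zero_notin_E)
    qed
    have "x \<in> D" "y \<in> D" using const x y by (auto simp: mem)
    then have "?W \<subseteq> D" using FD sD by (intro adjoin_subset)
    then show False using DW by auto
  next
    assume DF: "D \<inter> F = {0}"
    have only: "w = x" if x: "clone F x" and w: "w \<in> D" "x + w \<in> F" for x w
    proof (rule ccontr)
      assume "w \<noteq> x"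
      then have nz: "x + w \<noteq> 0" by (auto simp: sum_zero_iff)
      obtain u where u: "u \<in> F" "u \<noteq> 0" "u \<noteq> x + w" "u \<in> E" "u + (x + w) \<notin> E"
        using exists_mixed_pair [OF F w(2) nz] by blast
      then have "u \<notin> D" using DF by auto
      then have "u + w \<in> E" using un u w by (auto simp: mem)
      moreover have "u + w = x + (u + (x + w))" by (simp add: f2_simps)
      moreover have "u + (x + w) \<in> F" "u + (x + w) \<noteq> 0" using u w s by (auto simp: subspaceD sum_zero_iff)
      ultimately show False using cloneD [OF x] u by simp
    qed
    have no: False if x: "clone F x" and y: "clone F y" and z: "clone F (x + y + d)"
      and xy: "x \<in> D" "y \<in> ?W" "x + y \<notin> F" for x y
    proof -
      obtain u where u: "u \<in> F" "u \<noteq> 0" "u \<noteq> d" "u \<in> E" "u + d \<notin> E"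
        using exists_mixed_pair [OF F d] .
      have "y + u \<notin> D"
      proof
        assume "y + u \<in> D"
        then have "y + u = y" using only [OF y, of "y + u"] u by (simp add: f2_simps)
        then show False using u by simp
      qed
      moreover have "y + u \<in> ?W" using W u xy by (meson subspaceD(2) subsetD [OF \<open>F \<subseteq> ?W\<close>])
      ultimately have "y + u + x \<in> E \<longleftrightarrow> y + u \<in> E" using un xy by blast
      moreover have "y + u + x = x + y + d + (u + d)" by (simp add: f2_simps)
      moreover have "u + d \<in> F" "u + d \<noteq> 0" using u d s by (auto simp: subspaceD sum_zero_iff)
      ultimately show False using u cloneD [OF y] cloneD [OF z] by simp
    qed
    have "0 \<in> D" using sD by (rule subspaceD)
    then obtain w where w: "w \<in> D" "w \<noteq> 0" "w \<in> ?W" using DW by blast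
    then have "w \<notin> F" using DF by auto
    then consider "x + w \<in> F" | "y + w \<in> F" | "x + y + w \<in> F" using w mem by blast
    then show False
    proof cases
      case 1
      then have "x \<in> D" using only [OF x w(1)] w by simp
      then show ?thesis by (rule no [OF x y z]) (auto simp: mem xy)
    next
      case 2
      then have yD: "y \<in> D" using only [OF y w(1)] w by simp
      show ?thesis
        by (rule no [OF y x]) (use yD z xy in \<open>auto simp: mem add.commute\<close>)
    next
      case 3
      then have "x + y + d + w \<in> F" using d s by (metis add.commute add.left_commute subspaceD(2))
      then have "x + y + d \<in> D" using only [OF z w(1)] w by simp
      moreover have "x + y + d + x + d = y" by (simp add: f2_simps)
      then have "clone F (x + y + d + x + d)" using y by (simp only:)
      moreover have "x + y + d + x = y + d" by (simp add: f2_simps)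
      then have "x + y + d + x \<notin> F"
        using y d s by (metis clone_def subspaceD(4))
      ultimately show ?thesis by (intro no [OF z x]) (auto simp: mem)
    qed
  qed
qed

text \<open>As for three clones, but a summand \<open>D\<close> trivial on \<open>F\<close> now
  identifies the constant coset with a copy of \<open>F\<close>, or \<open>F\<close> itself, which
  takes both values. A coset of \<open>F\<close> contains at most one point of \<open>D\<close>,
  hence the need for witnesses off a prescribed point.\<close>

lemma indecomposable_two_clones:
  assumes F: "indecomposable F" and x: "clone F x" and y: "clone F y"
    and c: "\<And>u. u \<in> F \<Longrightarrow> x + y + u \<in> E \<longleftrightarrow> c"
  shows "indecomposable (adjoin y (adjoin x F))" (is "indecomposable ?W")
proof (rule indecomposableI [OF F])
  have s: "subspace F" using F by (rule indecomposableD)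
  have [simp]: "0 \<in> F" using s by (rule subspaceD)
  show "F \<subseteq> ?W" by (auto simp: adjoin_iff)
  show W: "subspace ?W" by (intro subspace_adjoin s)
  have mem: "v \<in> ?W \<longleftrightarrow> v \<in> F \<or> x + v \<in> F \<or> y + v \<in> F \<or> x + y + v \<in> F" for v
    by (auto simp: adjoin_iff f2_simps)
  fix D assume D: "summand ?W D"
  then have sD: "subspace D" and DW: "D \<subseteq> ?W" "D \<noteq> {0}" "D \<noteq> ?W"
    and un: "\<And>v w. v \<in> ?W \<Longrightarrow> v \<notin> D \<Longrightarrow> w \<in> D \<Longrightarrow> v + w \<in> E \<longleftrightarrow> v \<in> E"
    by (auto simp: summand_def)
  have "D \<inter> F = {0} \<or> F \<subseteq> D"
    by (rule summand_inter [OF D]) (use F in \<open>auto simp: s mem indecomposable_def\<close>)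
  then show False
  proof
    assume FD: "F \<subseteq> D"
    have const: "w \<in> D" if w: "clone F w" "w \<in> ?W" for w
    proof (rule ccontr)
      assume "w \<notin> D"
      then have "u \<in> E \<longleftrightarrow> w \<in> E" if "u \<in> F" "u \<noteq> 0" for u
        using un [of w u] that w FD by (auto simp: clone_def)
      then show False using exists_mixed_points [OF F] by (metis zero_notin_E)
    qed
    have "x \<in> D" "y \<in> D" using const x y by (auto simp: mem)
    then have "?W \<subseteq> D" using FD sD by (intro adjoin_subset)
    then show False using DW by auto
  next
    assume DF: "D \<inter> F = {0}"
    have no: False if x: "clone F x" and y: "clone F y" "y \<in> ?W" and c: "\<And>u. u \<in> F \<Longrightarrow> x + y + u \<in> E \<longleftrightarrow> c"
      and w: "w \<in> D" "x + w \<in> F" for x y w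
    proof -
      obtain v where v: "v \<in> F" "\<And>u. u \<in> F \<Longrightarrow> y + u \<in> D \<Longrightarrow> u = v"
      proof (cases "\<exists>v\<in>F. y + v \<in> D")
        case True
        then obtain v where v: "v \<in> F" "y + v \<in> D" by blast
        have "u = v" if "u \<in> F" "y + u \<in> D" for u
        proof -
          have "(y + u) + (y + v) = u + v" by (simp add: f2_simps)
          then have "u + v \<in> D \<inter> F" using that v sD s by (metis IntI subspaceD(2))
          then show ?thesis using DF by (auto simp: sum_zero_iff)
        qed
        then show thesis using v that by blast
      next
        case False then show thesis using that by (metis \<open>0 \<in> F\<close>)
      qed
      obtain u where u: "u \<in> F" "u \<noteq> 0" "u \<noteq> v" "u \<in> E \<longleftrightarrow> \<not> c"
        using mixed_off_point [OF F v(1)] by blast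
      then have "y + u \<notin> D" using v by blast
      moreover have "y + u \<in> ?W" using W u y by (meson subspaceD(2) subsetD [OF \<open>F \<subseteq> ?W\<close>])
      ultimately have "y + u + w \<in> E \<longleftrightarrow> y + u \<in> E" using un w by blast
      moreover have "y + u + w = x + y + (u + (x + w))" by (simp add: f2_simps)
      moreover have "u + (x + w) \<in> F" using u w s by (auto simp: subspaceD)
      ultimately show False using u cloneD [OF y(1)] c by metis
    qed
    have "0 \<in> D" using sD by (rule subspaceD)
    then obtain w where w: "w \<in> D" "w \<noteq> 0" "w \<in> ?W" using DW by blast
    then have "w \<notin> F" using DF by auto
    then consider "x + w \<in> F" | "y + w \<in> F" | "x + y + w \<in> F" using w mem by blast
    then show False
    proof cases
      case 1 show ?thesis by (rule no [OF x y _ c w(1) 1]) (auto simp: mem)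
    next
      case 2 show ?thesis
        by (rule no [OF y x _ _ w(1) 2]) (use c in \<open>auto simp: mem add.commute\<close>)
    next
      case 3
      obtain u where u: "u \<in> F" "u \<noteq> 0" "u \<in> E \<longleftrightarrow> \<not> c"
        using mixed_off_point [OF F \<open>0 \<in> F\<close>] by blast
      then have "u \<notin> D" using DF by auto
      then have "u + w \<in> E \<longleftrightarrow> u \<in> E" using un w u by (auto simp: mem)
      moreover have "u + w = x + y + (u + (x + y + w))" by (simp add: f2_simps)
      moreover have "u + (x + y + w) \<in> F" using u 3 s by (auto simp: subspaceD)
      ultimately show ?thesis using u c by metis
    qed
  qed
qed

end

section \<open>Two-dimensional extensions\<close>

text \<open>Each nontrivial coset of \<open>F\<close> in the extension has a clone, and the nonzero
  \<open>d = x + y + z\<close> measures the failure of the clones to be closed under addition. The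
  data are symmetric in \<open>x, y, z\<close>; the two swap lemmas generate all
  permutations.\<close>

locale clone_triple = f2_points +
  fixes U F :: "'a set" and x y z d :: 'a
  assumes U: "subspace U" "clawless U" and F: "indecomposable F" "F \<subseteq> U"
    and xyU: "x \<in> U" "y \<in> U"
    and clones: "clone F x" "clone F y" "clone F z"
    and z_eq: "z = x + y + d" and d: "d \<in> F" "d \<noteq> 0"
begin

lemma swap_xy: "clone_triple scale E U F y x z d"
  using U F xyU clones d by unfold_locales (simp_all add: z_eq f2_simps)

lemma zU: "z \<in> U"
  using U F xyU d by (auto simp: z_eq subspaceD)

lemma swap_yz: "clone_triple scale E U F x z y d"
  using U F xyU clones d zU by unfold_locales (simp_all add: z_eq f2_simps)

lemma F_sub: "subspace F"
  using F(1) by (rule indecomposableD)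

lemma F_closed [simp]: "0 \<in> F" "u \<in> F \<Longrightarrow> v \<in> F \<Longrightarrow> u + v \<in> F" "d \<in> F"
  using F_sub d by (auto simp: subspaceD)

lemma not_in_F: "x \<notin> F" "y \<notin> F" "z \<notin> F"
  using clones by (auto simp: clone_def)

lemma clone_points:
  assumes "u \<in> F" "u \<noteq> 0"
  shows "x + u \<in> E \<longleftrightarrow> u \<in> E" "y + u \<in> E \<longleftrightarrow> u \<in> E" "z + u \<in> E \<longleftrightarrow> u \<in> E"
  using assms clones by (simp_all add: cloneD)

lemma in_U: "u \<in> F \<Longrightarrow> u \<in> U" "u \<in> F \<Longrightarrow> x + u \<in> U" "u \<in> F \<Longrightarrow> y + u \<in> U" "u \<in> F \<Longrightarrow> z + u \<in> U"
  using F(2) U(1) xyU zU by (auto simp: subspaceD)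

lemma coset_nonzero: "u \<in> F \<Longrightarrow> x + u \<noteq> 0" "u \<in> F \<Longrightarrow> y + u \<noteq> 0" "u \<in> F \<Longrightarrow> z + u \<noteq> 0"
  using not_in_F by (auto simp: sum_zero_iff)

text \<open>If \<open>d\<close> were outside \<open>E\<close>, a split pair \<open>u, u + d\<close>
  would give the claw \<open>x + u\<close>, \<open>y + u\<close>, \<open>z + u\<close>: its pairwise
  sums are the copies \<open>z + d\<close>, \<open>y + d\<close>, \<open>x + d\<close> of
  \<open>d\<close>, and its total is \<open>u + d\<close>.\<close>

lemma d_in_E: "d \<in> E"
proof (rule ccontr)
  assume dE: "d \<notin> E"
  obtain u where u: "u \<in> F" "u \<noteq> 0" "u \<noteq> d" "u \<in> E" "u + d \<notin> E"
    using exists_mixed_pair [OF F(1) d] .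
  show False
    by (rule claw_contra [OF U(2), of "x + u" "y + u" "z + u" "z + d" "y + d" "x + d" "u + d"])
      (use u d dE in \<open>simp_all add: clone_points in_U coset_nonzero\<close>, simp_all add: z_eq f2_simps)
qed

lemma claw_value0:
  assumes "z \<notin> E" "u \<in> F" "v \<in> F" "u \<in> E" "v \<in> E" "u + d \<in> E" "v + d \<notin> E" "v \<noteq> d"
  shows "u + v \<in> E"
proof (rule ccontr)
  assume n: "u + v \<notin> E"
  have nz: "u \<noteq> v" "u + v \<noteq> 0" "v + d \<noteq> 0" "u + d \<noteq> 0" "u \<noteq> 0" "v \<noteq> 0"
    using assms by (auto simp: sum_zero_iff)
  have "z \<noteq> 0" using not_in_F by auto
  show False
    by (rule claw_contra [OF U(2), of "x + u" "x + v" "y + (u + d)" "u + v" z "z + (u + v)" "y + (v + d)"])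
      (use assms n nz not_in_F \<open>z \<noteq> 0\<close> in \<open>simp_all add: clone_points in_U coset_nonzero\<close>,
        simp_all add: z_eq f2_simps)
qed

lemma claw_value1:
  assumes "y \<in> E" "u \<in> F" "v \<in> F" "u \<in> E" "v \<in> E" "u \<noteq> v" "u + d \<notin> E" "v + d \<notin> E" "u \<noteq> d" "v \<noteq> d"
  shows "u + v \<in> E" "u + v + d \<in> E"
proof -
  have nz: "u + v \<noteq> 0" "u + d \<noteq> 0" "v + d \<noteq> 0" "u \<noteq> 0" "v \<noteq> 0"
    using assms by (auto simp: sum_zero_iff)
  show "u + v \<in> E"
  proof (rule ccontr)
    assume n: "u + v \<notin> E"
    show False
      by (rule claw_contra [OF U(2), of y "x + u" "x + v" "z + (u + d)" "z + (v + d)" "u + v" "y + (u + v)"])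
        (use assms n nz xyU in \<open>simp_all add: clone_points in_U coset_nonzero\<close>,
        simp_all add: z_eq f2_simps)
  qed
  show "u + v + d \<in> E"
  proof (rule ccontr)
    assume n: "u + v + d \<notin> E"
    have nz': "u + v + d \<noteq> 0" using assms by (metis add.assoc sum_zero_iff)
    show False
      by (rule claw_contra [OF U(2), of y "x + u" "z + v" "z + (u + d)" "x + (v + d)" "y + (u + v + d)" "u + v + d"])
        (use assms n nz nz' xyU in \<open>simp_all add: clone_points in_U coset_nonzero\<close>,
        simp_all add: z_eq f2_simps)
  qed
qed

text \<open>The claw has one point in each nontrivial coset. Because \<open>a + b + c\<close> and
  \<open>x + y + z\<close> are both \<open>d\<close>, its total falls back to
  \<open>t\<close>.\<close>

lemma claw_three_sum:
  assumes "a \<in> F" "b \<in> F" "c \<in> F" "t \<in> F" "a \<noteq> 0" "b \<noteq> 0" "c \<noteq> 0" "t \<notin> E" "a \<notin> E" "b \<notin> E" "c \<notin> E"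
    and "a + b + c = d" "t + a \<in> E" "t + b \<in> E" "t + c \<in> E"
  shows False
proof -
  have nz: "t + a \<noteq> 0" "t + b \<noteq> 0" "t + c \<noteq> 0" using assms by auto
  show False
    by (rule claw_contra [OF U(2), of "x + (t + c)" "y + (t + b)" "z + (t + a)" "z + a" "y + b" "x + c" t])
      (use assms nz in \<open>simp_all add: clone_points in_U coset_nonzero\<close>,
        simp_all add: z_eq f2_simps flip: assms(12))
qed

text \<open>By \<open>claw_value0\<close> the set \<open>A\<close> of \<open>u\<close> with
  \<open>u, u + d \<in> E\<close> is invariant under translation by \<open>d\<close> and by the
  members \<open>N\<close> of the split pairs. All points of \<open>E\<close> off the span of these
  lie in \<open>A\<close>, so the span would be a summand if \<open>A\<close> had an element. With
  \<open>A\<close> empty, the pairs meeting \<open>E\<close> form a subspace \<open>W\<close>; no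
  point off \<open>W\<close> lies in \<open>E\<close>, so indecomposability gives
  \<open>W = F\<close>.\<close>

lemma complementary_if_value0:
  assumes z: "z \<notin> E" and u: "u \<in> F"
  shows "u + d \<in> E \<longleftrightarrow> u \<notin> E"
proof -
  define A where "A = {u \<in> F. u \<in> E \<and> u + d \<in> E}"
  define N where "N = {u \<in> F. u \<in> E \<and> u \<noteq> d \<and> u + d \<notin> E}"
  have AN: "a + w \<in> A" if "a \<in> A" "w \<in> insert d N" for a w
  proof (cases "w = d")
    case True then show ?thesis using that by (auto simp: A_def add.assoc)
  next
    case False
    then have w: "w \<in> F" "w \<in> E" "w + d \<notin> E" "w \<noteq> d" using that by (auto simp: N_def)
    have a: "a \<in> F" "a \<in> E" "a + d \<in> E" using that by (auto simp: A_def)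
    have "a + w \<in> E" using claw_value0 [OF z] a w by blast
    moreover have "a + d + w \<in> E"
      by (rule claw_value0 [OF z]) (use a w in \<open>auto simp: add.assoc\<close>)
    ultimately show ?thesis using a w by (auto simp: A_def f2_simps)
  qed
  have "A = {}"
  proof (rule ccontr)
    assume "A \<noteq> {}"
    then obtain a where a: "a \<in> A" by blast
    let ?W = "span (insert d N)"
    have WF: "?W \<subseteq> F" by (rule span_minimal) (auto simp: N_def F_sub)
    have AW: "a + w \<in> A" if "a \<in> A" "w \<in> ?W" for a w
      using span_translation_closed [OF that(2) AN that(1)] .
    have "d \<in> ?W" by (simp add: span_base)
    moreover have "a \<notin> ?W" using AW [OF a, of a] by (auto simp: A_def)
    moreover have "v + w \<in> E \<longleftrightarrow> v \<in> E" if v: "v \<in> F - ?W" and w: "w \<in> ?W" for v w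
    proof -
      have *: "v \<in> A" if "v \<in> F" "v \<notin> ?W" "v \<in> E" for v
        using that by (auto simp: A_def N_def intro: span_base)
      have "v + w \<in> F" "v + w \<notin> ?W"
        using v w WF subspaceD(4) [OF subspace_span, of w _ v] by auto
      moreover have "v + w + w = v" by (simp add: add.assoc)
      moreover have "A \<subseteq> E" by (auto simp: A_def)
      ultimately show ?thesis using * AW v w by (metis DiffD1 DiffD2 subsetD)
    qed
    ultimately have "summand F ?W"
      using WF a d unfolding summand_def by (auto simp: A_def)
    then show False using F(1) by (auto simp: indecomposable_def)
  qed
  then have A0: "v + d \<notin> E" if "v \<in> F" "v \<in> E" for v using that by (auto simp: A_def)
  define W where "W = {0, d} \<union> N \<union> {u. u + d \<in> N}"
  have Fd: "w \<in> F" if "w + d \<in> F" for w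
    using that subspaceD(4) [OF F_sub d(1)] by blast
  have W_iff: "w \<in> W \<longleftrightarrow> w \<in> F \<and> (w \<in> E \<or> w + d \<in> E \<or> w = 0)" for w
    using A0 [of w] d_in_E Fd [of w]
    by (auto simp: W_def N_def add.assoc sum_zero_iff)
  have Wd: "w + d \<in> W" if "w \<in> W" for w
    using that by (auto simp: W_iff add.assoc d_in_E)
  have NW: "n + m \<in> W" if n: "n \<in> N" and m: "m \<in> N" for n m
  proof (cases "n = m")
    case True then show ?thesis by (simp add: W_def)
  next
    case False
    have nm: "n \<in> F" "m \<in> F" "n \<in> E" "m \<in> E" "n + d \<notin> E" "m + d \<notin> E" "n \<noteq> d" "m \<noteq> d"
      using n m by (auto simp: N_def)
    have "n + m \<in> E \<or> n + m + d \<in> E"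
    proof (rule ccontr)
      assume c: "\<not> ?thesis"
      show False
        by (rule claw_contra [OF U(2), of n m d "n + m" "n + d" "m + d" "n + m + d"])
          (use nm c False d_in_E in \<open>auto simp: in_U sum_zero_iff\<close>)
    qed
    then show ?thesis using nm by (auto simp: W_iff)
  qed
  have W: "subspace W"
    unfolding subspace_iff
  proof (intro conjI ballI)
    show "0 \<in> W" by (simp add: W_def)
    have shift: "w \<in> {0, d} \<or> (\<exists>n\<in>N. w = n \<or> w = n + d)" if "w \<in> W" for w
      using that by (auto simp: W_def add.assoc) (metis add_self_left add.commute add.assoc)
    fix v w assume vw: "v \<in> W" "w \<in> W"
    show "v + w \<in> W"
      using shift [OF vw(1)] shift [OF vw(2)] vw NW Wd
      by (auto simp: f2_simps) (metis Wd NW add.assoc add.commute add.left_commute add_self_left)+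
  qed
  have "W = F"
  proof (rule ccontr)
    assume "W \<noteq> F"
    moreover have "v + w \<in> E \<longleftrightarrow> v \<in> E" if v: "v \<in> F - W" "w \<in> W" for v w
      using v W_iff [of v] W_iff [of "v + w"] subspaceD(4) [OF W, of w v] by (auto simp: W_iff)
    ultimately have "summand F W"
      unfolding summand_def using W W_iff d by (auto simp: W_def) 
    then show False using F(1) by (auto simp: indecomposable_def)
  qed
  then show ?thesis using u A0 [of u] W_iff [of u] d_in_E by (cases "u = 0") auto
qed

end

section \<open>Points paired by translation\<close>

context f2_points
begin

lemma sum_eq_iff: "x + y = z \<longleftrightarrow> x = (y + z :: 'a)"
  by (metis add.commute add_self_left)

text \<open>The points \<open>u\<close> with \<open>u\<close> and \<open>u + d\<close> both outside \<open>E\<close> split into two classes \<open>Z0\<close> and \<open>Z1\<close>; everything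
  except \<open>Z0\<close> and the points \<open>u\<close> with \<open>u, u + d \<in> E\<close> spans a summand unless \<open>Z0\<close> is empty.\<close>

lemma cotriangle_free_if_mixed_sums:
  assumes F: "indecomposable F" "clawless F" and d: "d \<in> F" "d \<in> E"
    and N: "\<And>u v. \<lbrakk>u \<in> F; v \<in> F; u \<in> E; v \<in> E; u \<noteq> v; u \<noteq> d; v \<noteq> d; u + d \<notin> E; v + d \<notin> E\<rbrakk>
      \<Longrightarrow> u + v \<in> E \<and> u + v + d \<in> E"
  shows "cotriangle_free F"
proof -
  have s: "subspace F" using F(1) by (rule indecomposableD)
  have cl [simp]: "u + v \<in> F" if "u \<in> F" "v \<in> F" for u v using s that by (rule subspaceD)
  \<comment> \<open>Apart from \<open>{0, d}\<close>, a pair \<open>{u, u + d}\<close> lies inside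
    \<open>E\<close> (\<open>A\<close>), avoids \<open>E\<close> (\<open>Q\<close>) or is split,
    \<open>P\<close> naming its member in \<open>E\<close>.\<close>
  define P where "P n \<longleftrightarrow> n \<in> F \<and> n \<in> E \<and> n \<noteq> d \<and> n + d \<notin> E" for n
  define Q where "Q n \<longleftrightarrow> n \<in> F \<and> n \<noteq> 0 \<and> n \<notin> E \<and> n + d \<notin> E" for n
  define A where "A n \<longleftrightarrow> n \<in> F \<and> n \<in> E \<and> n + d \<in> E" for n
  have d0: "d \<noteq> 0" using d by auto
  obtain n where n: "P n" using exists_mixed_pair [OF F(1) d(1) d0] unfolding P_def by metis
  have NN: "A (u + v)" if "P u" "P v" "u \<noteq> v" for u v
    using N [of u v] that by (auto simp: P_def A_def)
  have Qd: "Q (u + d)" if "Q u" for u using that d by (auto simp: Q_def add.assoc sum_zero_iff)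
  have Ad: "A (u + d)" if "A u" for u using that d by (auto simp: A_def add.assoc)
  have QP: "A (u + v) \<or> Q (u + v)" if u: "Q u" and v: "P v" for u v
  proof (rule ccontr)
    assume c: "\<not> ?thesis"
    have uv: "u \<noteq> v" "u \<noteq> v + d" "u \<noteq> d" "u \<noteq> 0" using u v d by (auto simp: P_def Q_def add.assoc)
    have "u + v \<in> F" "u + v \<noteq> 0" using u v uv by (auto simp: P_def Q_def sum_zero_iff)
    then consider "u + v \<in> E" "u + v + d \<notin> E" | "u + v \<notin> E" "u + v + d \<in> E"
      using c by (auto simp: A_def Q_def)
    then show False
    proof cases
      case 1
      have "u + v \<noteq> d" using uv by (metis add.commute add_self_left)
      then have "P (u + v)" using 1 u v by (auto simp: P_def Q_def)
      then have "A (v + (u + v))" using NN [OF v] uv by (metis add_cancel_left_left)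
      then have "A u" by (simp add: f2_simps)
      then show False using u by (auto simp: A_def Q_def)
    next
      case 2
      have "P (u + v + d)" using 2 u v uv d by (auto simp: P_def Q_def add.assoc sum_zero_iff)
      moreover have "v \<noteq> u + v + d" using uv by (metis add.assoc add.commute add_cancel_left_left sum_zero_iff)
      ultimately have "A (v + (u + v + d))" using NN [OF v] by blast
      then have "A (u + d)" by (simp add: f2_simps)
      then show False using u by (auto simp: A_def Q_def)
    qed
  qed
  have E3: "u + v + w + d \<in> E" if u: "Q u" and v: "P v" and w: "P w" and a: "A (u + v)" and q: "Q (u + w)" for u v w
  proof (rule ccontr)
    assume c: "\<not> ?thesis"
    have vw: "v \<noteq> w" using a q by (auto simp: A_def Q_def)
    then have "A (v + w)" using NN v w by blast
    moreover have "u + w + d \<noteq> 0" using u w d by (auto simp: Q_def P_def sum_zero_iff add.assoc)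
    ultimately show False
      using u v w a q c d
      by (intro claw_contra [OF F(2), of v "v + w + d" "u + v" "w + d" "u" "u + w + d" "u + v + w + d"])
        (auto simp: A_def Q_def P_def sum_zero_iff, (auto simp: f2_simps)?)
  qed
  have chi: False if u: "Q u" and v: "P v" and w: "P w" and a: "A (u + v)" and q: "Q (u + w)" for u v w
  proof -
    have vw: "v \<noteq> w" using a q by (auto simp: A_def Q_def)
    then have A: "A (v + w)" using NN v w by blast
    have "u + d + v = u + v + d" "u + d + w = u + w + d" by (simp_all add: f2_simps)
    then have "u + d + v + w + d \<in> E" using E3 [OF Qd [OF u] v w] Ad [OF a] Qd [OF q] by metis
    moreover have "u + d + v + w + d = u + v + w" by (simp add: f2_simps)
    ultimately have "u + v + w \<in> E" by simp
    moreover have "u + w + d \<noteq> 0" using u w d by (auto simp: Q_def P_def sum_zero_iff add.assoc)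
    ultimately show False
      using u v w a q d A
      by (intro claw_contra [OF F(2), of "v + w" "u + v + d" "u + v + w" "u + w + d" "u" "w + d" "v + d"])
        (auto simp: A_def Q_def P_def sum_zero_iff, (auto simp: f2_simps)?)
  qed
  \<comment> \<open>By \<open>chi\<close> the choice of the split point is immaterial, so the fixed
    \<open>n\<close> classifies the empty pairs: translation by split points leaves those in
    \<open>Z0\<close> empty and makes those in \<open>Z1\<close> full.\<close>
  define Z0 where "Z0 u \<longleftrightarrow> Q u \<and> Q (u + n)" for u
  define Z1 where "Z1 u \<longleftrightarrow> Q u \<and> A (u + n)" for u
  have Z: "Q u \<Longrightarrow> Z0 u \<or> Z1 u" "\<not> (Z0 u \<and> Z1 u)" for u
    using QP n by (auto simp: Z0_def Z1_def A_def Q_def)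
  have Z1A: "A (u + v)" if "Z1 u" "P v" for u v
    using that QP chi n unfolding Z1_def by blast
  have Z0Q: "Q (u + v)" if "Z0 u" "P v" for u v
    using that QP chi n unfolding Z0_def by blast
  have Z0P: "Z0 (u + v)" if "Z0 u" "P v" for u v
  proof -
    have "\<not> Z1 (u + v)"
    proof
      assume "Z1 (u + v)"
      then have "A (u + v + v)" using that Z1A by blast
      then have "A u" by (simp add: add.assoc)
      then show False using that by (auto simp: A_def Z0_def Q_def)
    qed
    then show ?thesis using that Z0Q Z by blast
  qed
  have Z0d: "Z0 (u + d)" if "Z0 u" for u
    using that Qd [of u] Qd [of "u + n"] by (auto simp: Z0_def f2_simps)
  have Z1d: "Z1 (u + d)" if "Z1 u" for u
    using that Qd [of u] Ad [of "u + n"] by (auto simp: Z1_def f2_simps)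
  have Z01: "Z0 (z + u)" if z: "Z0 z" and u: "Z1 u" for z u
  proof -
    have eq: "z + u \<in> E \<longleftrightarrow> z + u + n \<in> E" if z: "Z0 z" for z
    proof -
      have nz: "z \<noteq> u" "z \<noteq> u + n" using z u Z by (auto simp: A_def Z1_def Z0_def Q_def)
      have nz': "z + u \<noteq> 0" "z + u + n \<noteq> 0" "z + n \<noteq> 0"
        using nz z n by (auto simp: sum_zero_iff add.assoc Z0_def Q_def P_def)
      have False if "z + u \<in> E" "z + u + n \<notin> E"
        using that z u n nz'
        by (intro claw_contra [OF F(2), of n "u + n" "z + u" u "z + u + n" "z + n" z])
          (auto simp: A_def Q_def P_def Z0_def Z1_def, (auto simp: f2_simps)?)
      moreover have False if "z + u \<notin> E" "z + u + n \<in> E"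
        using that z u n nz'
        by (intro claw_contra [OF F(2), of n "u + n" "z + u + n" u "z + u" "z" "z + n"])
          (auto simp: A_def Q_def P_def Z0_def Z1_def, (auto simp: f2_simps)?)
      ultimately show ?thesis by blast
    qed
    have "z \<noteq> u" "z \<noteq> u + d" using z u Z(2) [of u] Z(2) [of "u + d"] Z1d [OF u] by auto
    moreover have "z \<notin> E" "z + d \<notin> E" using z by (auto simp: Z0_def Q_def)
    moreover have "u + n \<in> E" "n \<in> E" "n + d + d \<in> E"
      using u n by (auto simp: Z1_def A_def P_def add.assoc)
    ultimately have nz: "z \<noteq> u" "z \<noteq> u + d" "z \<noteq> u + n" "z \<noteq> n + d" "z \<noteq> n" by auto
    have nz': "z + u \<noteq> 0" "z + u + n \<noteq> 0" "z + u \<noteq> d" "z + u + d \<noteq> d" "z + n + d \<noteq> 0" "n + d \<noteq> 0"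
      using nz n unfolding sum_eq_iff by (simp_all add: P_def add.assoc)
    have e1: "z + u + d \<in> E \<longleftrightarrow> z + u + n + d \<in> E"
      using eq [OF Z0d [OF z]] by (simp add: f2_simps)
    have nP: "\<not> P (z + u)" "\<not> P (z + u + d)"
    proof -
      have e: "u + (z + u) = z" "u + (z + u + d) = z + d" by (simp_all add: f2_simps)
      have "\<not> A z" "\<not> A (z + d)" using z by (auto simp: A_def Z0_def Q_def)
      then show "\<not> P (z + u)" "\<not> P (z + u + d)"
        using Z1A [OF u, of "z + u"] Z1A [OF u, of "z + u + d"] unfolding e by blast+
    qed
    have zF: "z \<in> F" "u \<in> F" "n \<in> F" using z u n by (auto simp: Z0_def Z1_def Q_def P_def)
    have e2: "z + u + d + d = z + u" by (simp add: add.assoc)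
    have same: "z + u \<in> E \<longleftrightarrow> z + u + d \<in> E" using nP nz' zF d unfolding P_def e2 by auto
    have "z + u \<notin> E"
    proof
      assume 1: "z + u \<in> E"
      then have "z + u + n + d \<in> E" using same e1 by simp
      then show False
        using 1 z u n nz' d
        by (intro claw_contra [OF F(2), of "u + n + d" "z + u" "z + u + n + d" "z + n + d" "z" "n + d" u])
          (auto simp: A_def Q_def P_def Z0_def Z1_def, (auto simp: f2_simps)?)
    qed
    then show ?thesis using same e1 eq [OF z] zF nz' by (auto simp: Z0_def Q_def)
  qed
  have noZ0: False if z: "Z0 z" for z
  proof -
    let ?G = "{d} \<union> Collect P \<union> Collect Z1"
    let ?D = "span ?G"
    have DF: "?D \<subseteq> F"
      by (rule span_minimal) (auto simp: s d P_def Z1_def Q_def)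
    have step: "v + g \<in> Collect Z0" if "v \<in> Collect Z0" "g \<in> ?G" for v g
      using that Z0P Z0d Z01 by auto
    have tr: "Z0 (v + w)" if "Z0 v" "w \<in> ?D" for v w
      using span_translation_closed [OF that(2) step, of v] that(1) by auto
    have "z \<notin> ?D" using tr [OF z, of z] by (auto simp: Z0_def Q_def)
    have "z \<in> F" using z by (auto simp: Z0_def Q_def)
    have base: "g \<in> ?D" if "g \<in> ?G" for g using that by (rule span_base)
    have cls: "A v \<or> Z0 v" if v: "v \<in> F" "v \<notin> ?D" for v
    proof -
      have "d \<in> ?D" by (rule base) simp
      then have "v + d \<notin> ?D" using v subspaceD(4) [OF subspace_span, of d ?G v] by blast
      then have "\<not> P v" "\<not> P (v + d)" "\<not> Z1 v" "v \<noteq> 0" "v \<noteq> d" "v + d \<noteq> d"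
        using v base [of v] base [of "v + d"] \<open>d \<in> ?D\<close> by (auto simp: span_zero)
      moreover have "v + d + d = v" by (simp add: add.assoc)
      ultimately show ?thesis using v d Z(1) [of v] by (auto simp: P_def A_def Q_def)
    qed
    have "v + w \<in> E \<longleftrightarrow> v \<in> E" if v: "v \<in> F - ?D" and w: "w \<in> ?D" for v w
    proof -
      have "v + w \<in> F" "v + w \<notin> ?D"
        using v w DF subspaceD(4) [OF subspace_span, of w ?G v] by auto
      moreover have e: "v + w + w = v" by (simp add: add.assoc)
      have "Z0 (v + w) \<longleftrightarrow> Z0 v"
        using tr [of "v + w" w] tr [of v w] w unfolding e by blast
      ultimately show ?thesis using cls [of v] cls [of "v + w"] v
        by (auto simp: A_def Z0_def Q_def)
    qed
    moreover have "?D \<noteq> {0}" using base [of d] d0 by auto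
    ultimately have "summand F ?D"
      unfolding summand_def using DF \<open>z \<in> F\<close> \<open>z \<notin> ?D\<close> by auto
    then show False using F(1) by (auto simp: indecomposable_def)
  qed
  have cls: "P (u + d) \<or> Z1 u" if "u \<in> F" "u \<noteq> 0" "u \<notin> E" for u
    using that noZ0 [of u] Z(1) [of u] d by (auto simp: P_def Q_def add.assoc)
  have sumPZ: "u + v \<in> E" if "P (u + d)" "Z1 v" for u v
  proof -
    have "A (v + (u + d))" using Z1A that by blast
    moreover have "v + (u + d) + d = u + v" by (simp add: f2_simps)
    ultimately show ?thesis by (simp add: A_def)
  qed
  show ?thesis
    unfolding cotriangle_free_def
  proof (intro ballI impI)
    fix u v assume u: "u \<in> F" "u \<noteq> 0" and v: "v \<in> F" "v \<noteq> 0" and uv: "u \<noteq> v"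
    show "u \<in> E \<or> v \<in> E \<or> u + v \<in> E"
    proof (rule ccontr)
      assume c: "\<not> ?thesis"
      then have uvE: "u \<notin> E" "v \<notin> E" "u + v \<notin> E" by auto
      have uv0: "u + v \<noteq> 0" "u + v \<in> F" using uv u v by (auto simp: sum_zero_iff)
      consider "P (u + d)" "P (v + d)" | "P (u + d)" "Z1 v" | "P (v + d)" "Z1 u"
        | "Z1 u" "P (u + v + d)" | "Z1 u" "Z1 v" "Z1 (u + v)"
        using cls [of u] cls [of v] cls [of "u + v"] uvE u v uv0 by blast
      then show False
      proof cases
        case 1
        then have "A (u + d + (v + d))" using NN uv by simp
        moreover have "u + d + (v + d) = u + v" by (simp add: f2_simps)
        ultimately show False using uvE by (simp add: A_def)
      next
        case 2 then show False using sumPZ [of u v] uvE by auto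
      next
        case 3 then show False using sumPZ [of v u] uvE by (auto simp: add.commute)
      next
        case 4
        have e: "u + v + u = v" by (simp add: f2_simps)
        show False using sumPZ [of "u + v" u] 4 uvE unfolding e by auto
      next
        \<comment> \<open>The other cases involve a split pair and follow from \<open>NN\<close> and
          \<open>sumPZ\<close>. Three points of \<open>Z1\<close> need a claw, formed by their
          translates by \<open>n + d\<close>.\<close>
        case 5
        then have "A (u + n)" "A (v + n)" "A (u + v + n)" by (auto simp: Z1_def)
        then show False using n u v uv uv0 uvE d
          by (intro claw_contra [OF F(2), of "u + n + d" "v + n + d" "u + v + n + d" "u + v" v u "n + d"])
            (auto simp: A_def P_def, (auto simp: f2_simps)?)
      qed
    qed
  qed
qed

text \<open>Translation by \<open>d\<close> complements \<open>E\<close>, so adding \<open>d\<close>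
  to an argument leaves \<open>polar\<close> unchanged and bilinearity need only be tested on
  \<open>a, b, c\<close> outside \<open>E\<close>. There it says that an even number of
  \<open>a + b\<close>, \<open>a + c\<close>, \<open>b + c\<close>, \<open>a + b + c\<close> lie in
  \<open>E\<close>. Two of the pairwise sums agree, which sorts the odd patterns into
  \<open>odd\<close> and \<open>odd3\<close>; all give a claw in \<open>F\<close> except the one
  that the hypothesis \<open>three\<close> excludes.\<close>

lemma quadraticI_complementary:
  assumes s: "subspace F" "clawless F" and d: "d \<in> F" and comp: "\<And>u. u \<in> F \<Longrightarrow> u + d \<in> E \<longleftrightarrow> u \<notin> E"
    and three: "\<And>a b t. \<lbrakk>a \<in> F; b \<in> F; t \<in> F; a \<notin> E; b \<notin> E; t \<notin> E; a + b \<in> E; t + a \<in> E; t + b \<in> E;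
      t + a + b \<notin> E\<rbrakk> \<Longrightarrow> False"
  shows "quadratic F"
proof -
  have cl: "u + v \<in> F" if "u \<in> F" "v \<in> F" for u v using s(1) that by (rule subspaceD)
  have polar_shift: "polar (a + d) b \<longleftrightarrow> polar a b" "polar a (b + d) \<longleftrightarrow> polar a b" if "a \<in> F" "b \<in> F" for a b
  proof -
    have e: "a + d + b = a + b + d" "a + (b + d) = a + b + d" by (simp_all add: f2_simps)
    show "polar (a + d) b \<longleftrightarrow> polar a b" "polar a (b + d) \<longleftrightarrow> polar a b"
      unfolding polar_def e using comp [OF cl [OF that]] comp [OF that(1)] comp [OF that(2)] by auto
  qed
  have claw: False if "a \<in> F" "b \<in> F" "c \<in> F" "p + q = a" "p + r = b" "q + r = a + b" "p + q + r = c"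
    "p \<in> F" "q \<in> F" "r \<in> F" "p \<in> E" "q \<in> E" "r \<in> E" "a \<notin> E" "b \<notin> E" "a + b \<notin> E" "c \<notin> E"
    "a \<noteq> 0" "b \<noteq> 0" "a \<noteq> b" for a b c p q r
    using claw_contra [OF s(2), of p q r a b "a + b" c] that by (auto simp: sum_zero_iff)
  have odd: False if F: "a \<in> F" "b \<in> F" "c \<in> F" and o: "a \<notin> E" "b \<notin> E" "c \<notin> E"
    and p: "a + b \<notin> E" "a + c \<notin> E" "(a + b + c \<in> E) \<noteq> (b + c \<in> E)" for a b c
  proof (cases "b + c \<in> E")
    case True
    have *: "b + d \<in> E" "a + b + d \<in> E" "a + b + c + d \<in> E" "b + c + d \<notin> E"
      using comp [of b] comp [of "a + b"] comp [of "a + b + c"] comp [of "b + c"] F o p True cl by auto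
    have n: "a \<noteq> 0" "c \<noteq> 0" "a \<noteq> c" using o p True by (auto simp: add.commute)
    show False
      by (rule claw [of a c "b + c + d" "a + b + d" "b + d" "a + b + c + d"])
        (use F o p n d cl * in \<open>simp_all add: f2_simps\<close>)
  next
    case False
    have *: "a + d \<in> E" "a + b + d \<in> E" "a + c + d \<in> E" "a + b + c + d \<notin> E"
      using comp [of a] comp [of "a + b"] comp [of "a + b + c"] comp [of "a + c"] F o p False cl by auto
    have n: "b \<noteq> 0" "c \<noteq> 0" "b \<noteq> c" using o p False by (auto simp: add.assoc)
    show False
      by (rule claw [of b c "a + b + c + d" "a + d" "a + b + d" "a + c + d"])
        (use F o p n d cl False * in \<open>simp_all add: f2_simps\<close>)
  qed
  have odd3: False if F: "a \<in> F" "b \<in> F" "c \<in> F" and o: "a \<notin> E" "b \<notin> E" "c \<notin> E"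
    and p: "a + b \<in> E" "a + c \<in> E" "(a + b + c \<in> E) \<longleftrightarrow> b + c \<notin> E" for a b c
  proof (cases "b + c \<in> E")
    case True
    then show False using three [of b c a] F o p by (simp add: f2_simps)
  next
    case False
    have n: "b \<noteq> 0" "c \<noteq> 0" "b \<noteq> c" using o p False by (auto simp: add.assoc)
    show False
      by (rule claw [of c b a "a + b + c" "a + b" "a + c"])
        (use F o p n d cl False in \<open>simp_all add: f2_simps\<close>)
  qed
  have normal: "polar a (b + c) = (polar a b \<noteq> polar a c)"
    if F: "a \<in> F" "b \<in> F" "c \<in> F" and o: "a \<notin> E" "b \<notin> E" "c \<notin> E" for a b c
  proof -
    have e: "b + a = a + b" "c + a = a + c" "c + b = b + c" "b + a + c = a + b + c" "a + c + b = a + b + c"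
      "a + (b + c) = a + b + c"
      by (simp_all add: f2_simps)
    show ?thesis
      using odd [OF F o] odd [of b a c] odd [of c a b] odd3 [OF F o] odd3 [of b a c] odd3 [of c a b] F o
      unfolding polar_def e by auto
  qed
  have rep: "\<exists>a'\<in>F. a' \<notin> E \<and> (a' = a \<or> a' = a + d)" if "a \<in> F" for a
    using that comp [OF that] cl d by (cases "a \<in> E") auto
  show ?thesis
    unfolding quadratic_def
  proof (intro ballI)
    fix a b c assume F: "a \<in> F" "b \<in> F" "c \<in> F"
    obtain a' b' c' where F': "a' \<in> F" "b' \<in> F" "c' \<in> F" and o: "a' \<notin> E" "b' \<notin> E" "c' \<notin> E"
      and r: "a' = a \<or> a' = a + d" "b' = b \<or> b' = b + d" "c' = c \<or> c' = c + d"
      using rep F by metis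
    have "b' + c' = b + c \<or> b' + c' = b + c + d"
      using r(2,3) by (auto simp: f2_simps)
    then have "polar a' (b' + c') = polar a (b + c)" "polar a' b' = polar a b" "polar a' c' = polar a c"
      using r F F' cl d polar_shift by (metis)+
    then show "polar a (b + c) = (polar a b \<noteq> polar a c)" using normal [OF F' o] by simp
  qed
qed

end

context clone_triple
begin

lemma clawless_F: "clawless F"
  using U(2) F(2) by (rule clawless_subset)

text \<open>If \<open>y \<in> E\<close>, then for distinct points \<open>u, v\<close> of
  \<open>E \<inter> F\<close> other than \<open>d\<close>, \<open>claw_value1\<close> puts both
  \<open>u + v\<close> and \<open>u + v + d\<close> into \<open>E\<close>, against complementarity.
  So \<open>E \<inter> F\<close> has at most one point besides \<open>d\<close>, too few for the
  split pairs of an indecomposable space.\<close>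

lemma value0_transfer: assumes "z \<notin> E" shows "y \<notin> E"
proof
  assume y: "y \<in> E"
  note comp = complementary_if_value0 [OF assms]
  have no: False if "u \<in> F" "v \<in> F" "u \<in> E" "v \<in> E" "u \<noteq> v" "u \<noteq> d" "v \<noteq> d" for u v
    using claw_value1 [OF y that(1-5)] comp [of u] comp [of v] comp [of "u + v"] that by auto
  obtain n where n: "n \<in> F" "n \<in> E" "n \<noteq> d" "n + d \<notin> E" using exists_mixed_pair [OF F(1) d] by metis
  have "n + d \<in> F" "n + d \<noteq> 0" using n by (auto simp: sum_zero_iff)
  then obtain u where u: "u \<in> F" "u \<in> E" "u + (n + d) \<notin> E"
    using exists_mixed_pair [OF F(1)] by metis
  then have "u = d \<or> u = n" using no [of u n] n by blast
  moreover have "d + (n + d) = n" "n + (n + d) = d" by (simp_all add: f2_simps)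
  ultimately show False using u n d_in_E by metis
qed

text \<open>For the pattern left open by \<open>quadraticI_complementary\<close>, the third vector
  \<open>a + b + d\<close> completes \<open>a, b\<close> to the sum \<open>d\<close>, and
  complementarity supplies its values for \<open>claw_three_sum\<close>.\<close>

lemma quadratic_F:
  assumes z: "z \<notin> E"
  shows "quadratic F"
proof (rule quadraticI_complementary [OF F_sub clawless_F d(1)])
  note comp = complementary_if_value0 [OF z]
  show "u + d \<in> E \<longleftrightarrow> u \<notin> E" if "u \<in> F" for u using comp that .
  fix a b t
  assume F: "a \<in> F" "b \<in> F" "t \<in> F" and o: "a \<notin> E" "b \<notin> E" "t \<notin> E"
    and ab: "a + b \<in> E" "t + a \<in> E" "t + b \<in> E" "t + a + b \<notin> E"
  have ne: "a \<noteq> 0" "b \<noteq> 0" using o ab by auto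
  have 1: "a + b + d \<notin> E" using comp [of "a + b"] F ab by simp
  have 2: "t + (a + b + d) \<in> E" using comp [of "t + a + b"] F ab by (simp add: add.assoc)
  have 3: "a + b + d \<noteq> 0"
  proof
    assume "a + b + d = 0"
    then have "b = a + d" by (metis add.assoc add.commute sum_zero_iff)
    then show False using comp [of a] F o by simp
  qed
  have "a + b + (a + b + d) = d" by (simp add: f2_simps)
  then show False
    using claw_three_sum [of a b "a + b + d" t] F o ab ne 1 2 3 by simp
qed

lemma mem_extension: "w \<in> adjoin y (adjoin x F) \<longleftrightarrow> (\<exists>u\<in>F. w = u \<or> w = x + u \<or> w = y + u \<or> w = z + u)"
proof -
  have "w \<in> adjoin y (adjoin x F) \<longleftrightarrow> w \<in> F \<or> x + w \<in> F \<or> y + w \<in> F \<or> x + y + w \<in> F"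
    by (auto simp: adjoin_iff f2_simps)
  moreover have "x + y + w \<in> F \<longleftrightarrow> z + w \<in> F"
    using subspaceD(3) [OF F_sub d(1), of "x + y + w"] by (simp add: z_eq f2_simps)
  ultimately show ?thesis by (metis add_self_left)
qed

text \<open>On \<open>i x + j y + u\<close> the indicator of \<open>E\<close> is that of
  \<open>u\<close> plus \<open>i j\<close>: the extension is the orthogonal sum of the form on
  \<open>F\<close> and a hyperbolic plane. The product arises because
  \<open>x + y + u = z + (u + d)\<close> copies \<open>u + d\<close>, whose membership is opposite
  to that of \<open>u\<close>.\<close>

lemma extension_quadratic:
  assumes z: "z \<notin> E"
  shows "quadratic (adjoin y (adjoin x F))"
proof -
  interpret s: clone_triple scale E U F y x z d by (rule swap_xy)
  have yE: "y \<notin> E" and xE: "x \<notin> E"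
    using value0_transfer z s.value0_transfer by auto
  note comp = complementary_if_value0 [OF z]
  define r where "r i j u = (if i then x else 0) + ((if j then y else 0) + u)" for i j :: bool and u
  have rE: "r i j u \<in> E \<longleftrightarrow> (u \<in> E) \<noteq> (i \<and> j)" if u: "u \<in> F" for i j u
  proof -
    have "x + u \<in> E \<longleftrightarrow> u \<in> E" "y + u \<in> E \<longleftrightarrow> u \<in> E"
      using clone_points [OF u] xE yE by (cases "u = 0"; simp)+
    moreover have "x + (y + u) \<in> E \<longleftrightarrow> u \<notin> E"
    proof -
      have "z + (u + d) \<in> E \<longleftrightarrow> u + d \<in> E"
        using clone_points(3) [of "u + d"] u z by (cases "u + d = 0") auto
      moreover have "z + (u + d) = x + (y + u)" by (simp add: z_eq f2_simps)
      ultimately show ?thesis using comp [OF u] by simp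
    qed
    ultimately show ?thesis by (auto simp: r_def)
  qed
  have sum: "r i j u + r k l v = r (i \<noteq> k) (j \<noteq> l) (u + v)" for i j k l u v
    by (cases i; cases j; cases k; cases l; simp add: r_def f2_simps)
  have pol: "polar (r i j u) (r k l v) \<longleftrightarrow> polar u v \<noteq> ((i \<and> l) \<noteq> (k \<and> j))" if "u \<in> F" "v \<in> F" for i j k l u v
    using that by (auto simp: polar_def sum rE)
  have rep: "\<exists>i j. \<exists>u\<in>F. w = r i j u" if "w \<in> adjoin y (adjoin x F)" for w
  proof -
    from that have "\<exists>u\<in>F. w = u \<or> w = x + u \<or> w = y + u \<or> w = z + u"
      by (simp only: mem_extension)
    then show ?thesis
    proof (elim bexE)
      fix u assume u: "u \<in> F" "w = u \<or> w = x + u \<or> w = y + u \<or> w = z + u"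
      moreover have "z + u = r True True (d + u)" by (simp add: r_def z_eq f2_simps)
      moreover have "u = r False False u" "x + u = r True False u" "y + u = r False True u"
        by (simp_all add: r_def)
      ultimately show ?thesis by (metis F_closed(2,3))
    qed
  qed
  show ?thesis
    unfolding quadratic_def
  proof (intro ballI)
    fix a b c assume "a \<in> adjoin y (adjoin x F)" "b \<in> adjoin y (adjoin x F)" "c \<in> adjoin y (adjoin x F)"
    then obtain i j u k l v m n w where F: "u \<in> F" "v \<in> F" "w \<in> F"
      and abc: "a = r i j u" "b = r k l v" "c = r m n w" using rep by metis
    have "polar u (v + w) = (polar u v \<noteq> polar u w)"
      using quadratic_F [OF z] F by (simp add: quadratic_def)
    then show "polar a (b + c) = (polar a b \<noteq> polar a c)"
      unfolding abc sum using F by (auto simp: pol)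
  qed
qed

text \<open>As the clones lie in \<open>E\<close>, a nonzero point outside \<open>E\<close> is a
  copy, in some coset, of a nonzero point of \<open>F\<close> outside \<open>E\<close>. Copies of
  \<open>u\<close> and \<open>v\<close> add up to a copy of \<open>u + v\<close> or of
  \<open>u + v + d\<close>; the fact \<open>three\<close> handles the second kind.\<close>

lemma extension_cotriangle_free:
  assumes E: "x \<in> E" "y \<in> E" "z \<in> E"
  shows "cotriangle_free (adjoin y (adjoin x F))"
proof -
  have T: "cotriangle_free F"
    by (rule cotriangle_free_if_mixed_sums [OF F(1) clawless_F d(1) d_in_E])
      (use claw_value1 [OF E(2)] in blast)
  then have T: "u + v \<in> E" if "u \<in> F" "v \<in> F" "u \<noteq> 0" "v \<noteq> 0" "u \<notin> E" "v \<notin> E" "u \<noteq> v" for u v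
    using that unfolding cotriangle_free_def by blast
  have three: "u + v + d = 0 \<or> u + v + d \<in> E"
    if uv: "u \<in> F" "v \<in> F" "u \<noteq> 0" "v \<noteq> 0" "u \<notin> E" "v \<notin> E" for u v
  proof (rule ccontr)
    assume c: "\<not> ?thesis"
    let ?w = "u + v + d"
    have ne: "u \<noteq> v" "?w \<noteq> u" "?w \<noteq> v"
      using c uv d_in_E by (auto simp: f2_simps) (metis add.commute add_self_left add_cancel_left_right)+
    have "?w \<in> F" using uv by simp
    then have "u + v \<in> E" "u + ?w \<in> E" using T [of u v] T [of u ?w] uv ne c by auto
    moreover have "u + v \<noteq> 0" "u + ?w \<noteq> 0" using ne by (metis sum_zero_iff)+
    ultimately show False using uv c ne E
      by (intro claw_contra [OF U(2), of x "y + (u + v)" "z + (u + ?w)" "z + ?w" "y + v" "x + u" u])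
        (simp_all add: clone_points in_U xyU coset_nonzero, (simp_all add: z_eq f2_simps)?)
  qed
  have obt: "\<exists>u\<in>F. u \<noteq> 0 \<and> u \<notin> E \<and> (w = u \<or> w = x + u \<or> w = y + u \<or> w = z + u)"
    if "w \<in> adjoin y (adjoin x F)" "w \<noteq> 0" "w \<notin> E" for w
    using that E clone_points mem_extension [of w] by (metis add.right_neutral)
  show ?thesis
    unfolding cotriangle_free_def
  proof (intro ballI impI, rule ccontr)
    fix a b assume ab: "a \<in> adjoin y (adjoin x F)" "b \<in> adjoin y (adjoin x F)" "a \<noteq> 0" "b \<noteq> 0" "a \<noteq> b"
      and c: "\<not> (a \<in> E \<or> b \<in> E \<or> a + b \<in> E)"
    obtain u where u: "u \<in> F" "u \<noteq> 0" "u \<notin> E" and a: "a = u \<or> a = x + u \<or> a = y + u \<or> a = z + u"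
      using obt [of a] ab c by blast
    obtain v where v: "v \<in> F" "v \<noteq> 0" "v \<notin> E" and b: "b = v \<or> b = x + v \<or> b = y + v \<or> b = z + v"
      using obt [of b] ab c by blast
    have 1: "u \<noteq> v \<Longrightarrow> u + v \<in> E" using T u v by blast
    have 2: "x + (u + v) \<in> E" "y + (u + v) \<in> E" "z + (u + v) \<in> E"
      using 1 u v E clone_points [of "u + v"] by (cases "u = v"; simp add: sum_zero_iff)+
    have 3: "x + (u + v + d) \<in> E" "y + (u + v + d) \<in> E" "z + (u + v + d) \<in> E"
      using three [of u v] u v E clone_points [of "u + v + d"] by (cases "u + v + d = 0"; simp)+
    have "a + b \<in> E"
      using a b 1 2 3 ab(5) by (elim disjE) (auto simp: z_eq f2_simps)
    then show False using c by simp
  qed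
qed

text \<open>By \<open>value0_transfer\<close> and the symmetries, the values at
  \<open>x, y, z\<close> agree, so either all clones lie in \<open>E\<close> or none does.\<close>

lemma extension:
  shows "indecomposable (adjoin y (adjoin x F))"
    "cotriangle_free (adjoin y (adjoin x F)) \<or> quadratic (adjoin y (adjoin x F))"
proof -
  have "x + y + d \<notin> F" using not_in_F by (simp add: z_eq)
  then have "x + y \<notin> F" using F_closed by blast
  then show "indecomposable (adjoin y (adjoin x F))"
    using clones d by (intro indecomposable_three_clones [OF F(1)]) (auto simp: z_eq)
  interpret s: clone_triple scale E U F y x z d by (rule swap_xy)
  interpret t: clone_triple scale E U F x z y d by (rule swap_yz)
  show "cotriangle_free (adjoin y (adjoin x F)) \<or> quadratic (adjoin y (adjoin x F))"
  proof (cases "x \<in> E \<and> y \<in> E \<and> z \<in> E")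
    case True then show ?thesis using extension_cotriangle_free by blast
  next
    case False
    interpret w: clone_triple scale E U F y z x d by (rule s.swap_yz)
    have "z \<notin> E" using False t.value0_transfer w.value0_transfer by blast
    then show ?thesis using extension_quadratic by blast
  qed
qed

end

section \<open>Extending an indecomposable subspace\<close>

context f2_points
begin

text \<open>If the third coset avoided \<open>E\<close>, points \<open>u, v\<close> of
  \<open>E\<close> with \<open>u + v\<close> outside would give the claw \<open>x + u\<close>,
  \<open>y + u\<close>, \<open>v\<close>. Once it lies in \<open>E\<close>, further claws show that
  \<open>F\<close> is cotriangle-free and \<open>x, y \<in> E\<close>. Nonzero points outside
  \<open>E\<close> are then copies, in \<open>F\<close>, \<open>x + F\<close> or
  \<open>y + F\<close>, of such points of \<open>F\<close>, and the sum of two lands in the third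
  coset or is a copy of a sum in \<open>F\<close>.\<close>

lemma clones_constant_cotriangle_free:
  assumes U: "subspace U" "clawless U" and F: "indecomposable F" "F \<subseteq> U" and xyU: "x \<in> U" "y \<in> U"
    and xy: "clone F x" "clone F y" "x + y \<notin> F" and c: "\<And>u. u \<in> F \<Longrightarrow> x + y + u \<in> E \<longleftrightarrow> c"
  shows "cotriangle_free (adjoin y (adjoin x F))"
proof -
  have s: "subspace F" using F(1) by (rule indecomposableD)
  have cl [simp]: "0 \<in> F" "u \<in> F \<Longrightarrow> v \<in> F \<Longrightarrow> u + v \<in> F" for u v
    using s by (auto simp: subspaceD)
  have notF: "x \<notin> F" "y \<notin> F" using xy by (auto simp: clone_def)
  have inU: "u \<in> U" "x + u \<in> U" "y + u \<in> U" "x + y + u \<in> U" if "u \<in> F" for u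
    using that F(2) xyU U(1) by (auto simp: subspaceD)
  have nz: "x + u \<noteq> 0" "y + u \<noteq> 0" "x + y + u \<noteq> 0" if "u \<in> F" for u
    using that notF xy(3) by (auto simp: sum_zero_iff)
  have pts: "x + u \<in> E \<longleftrightarrow> u \<in> E" "y + u \<in> E \<longleftrightarrow> u \<in> E" if "u \<in> F" "u \<noteq> 0" for u
    using that xy cloneD by auto
  have c: "x + y + w \<in> E" if w: "w \<in> F" for w
  proof (rule ccontr)
    assume n: "x + y + w \<notin> E"
    have c: "x + y + u \<notin> E" if "u \<in> F" for u using c [OF that] c [OF w] n by blast
    obtain u v where uv: "u \<in> F" "v \<in> F" "u \<noteq> v" "u \<in> E" "v \<in> E" "u + v \<notin> E" using exists_line [OF F(1)] .
    have "u \<noteq> 0" "v \<noteq> 0" "u + v \<noteq> 0" using uv by (auto simp: sum_zero_iff)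
    then show False using uv c [of 0] c [of v] nz [of 0] nz inU pts
      by (intro claw_contra [OF U(2), of "x + u" "y + u" v "x + y" "x + (u + v)" "y + (u + v)" "x + y + v"])
        (simp_all, (simp_all add: f2_simps)?)
  qed
  have T: "cotriangle_free F"
    unfolding cotriangle_free_def
  proof (intro ballI impI, rule ccontr)
    fix a b assume ab: "a \<in> F" "b \<in> F" "a \<noteq> 0" "b \<noteq> 0" "a \<noteq> b" and n: "\<not> (a \<in> E \<or> b \<in> E \<or> a + b \<in> E)"
    obtain u where u: "u \<in> F" "u \<noteq> 0" "u \<noteq> a + b" "u \<in> E" "u + (a + b) \<notin> E"
      by (rule exists_mixed_pair [OF F(1), of "a + b"]) (use ab in \<open>auto simp: sum_zero_iff\<close>)
    have "u + (a + b) \<noteq> 0" "a + b \<noteq> 0" using u ab by (auto simp: sum_zero_iff)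
    then show False using u ab n c nz inU pts
      by (intro claw_contra [OF U(2), of "x + y + (u + a)" "x + u" "x + y + (u + b)" "y + a" "a + b" "y + b" "x + (u + (a + b))"])
        (simp_all, (simp_all add: f2_simps)?)
  qed
  then have T: "u + v \<in> E" if "u \<in> F" "v \<in> F" "u \<noteq> 0" "v \<noteq> 0" "u \<notin> E" "v \<notin> E" "u \<noteq> v" for u v
    using that unfolding cotriangle_free_def by blast
  obtain t v where tv: "t \<in> F" "v \<in> F" "t \<noteq> 0" "v \<noteq> 0" "t \<noteq> v" "t \<notin> E" "v \<notin> E" "t + v \<in> E"
    using exists_coline [OF F(1)] .
  have tv0: "t + v \<noteq> 0" using tv by auto
  have xE: "x \<in> E"
  proof (rule ccontr)
    assume "x \<notin> E"
    then show False using tv tv0 c nz [of 0] nz inU pts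
      by (intro claw_contra [OF U(2), of "x + y + (t + v)" "y + (t + v)" "x + y + v" x t "x + t" "y + v"])
        (simp_all, (simp_all add: f2_simps)?)
  qed
  have yE: "y \<in> E"
  proof (rule ccontr)
    assume "y \<notin> E"
    then show False using tv tv0 c nz [of 0] nz inU pts
      by (intro claw_contra [OF U(2), of "x + y + (t + v)" "x + (t + v)" "x + y + v" y t "y + t" "x + v"])
        (simp_all, (simp_all add: f2_simps)?)
  qed
  have mem: "w \<in> adjoin y (adjoin x F) \<longleftrightarrow> (\<exists>u\<in>F. w = u \<or> w = x + u \<or> w = y + u \<or> w = x + y + u)" for w
  proof -
    have "w \<in> adjoin y (adjoin x F) \<longleftrightarrow> w \<in> F \<or> x + w \<in> F \<or> y + w \<in> F \<or> x + y + w \<in> F"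
      by (auto simp: adjoin_iff f2_simps)
    then show ?thesis by (metis add_self_left)
  qed
  have obt: "\<exists>u\<in>F. u \<noteq> 0 \<and> u \<notin> E \<and> (w = u \<or> w = x + u \<or> w = y + u)"
    if "w \<in> adjoin y (adjoin x F)" "w \<noteq> 0" "w \<notin> E" for w
    using that xE yE c pts mem [of w] by (metis add.right_neutral)
  show ?thesis
    unfolding cotriangle_free_def
  proof (intro ballI impI, rule ccontr)
    fix a b assume ab: "a \<in> adjoin y (adjoin x F)" "b \<in> adjoin y (adjoin x F)" "a \<noteq> 0" "b \<noteq> 0" "a \<noteq> b"
      and n: "\<not> (a \<in> E \<or> b \<in> E \<or> a + b \<in> E)"
    obtain u where u: "u \<in> F" "u \<noteq> 0" "u \<notin> E" and a: "a = u \<or> a = x + u \<or> a = y + u"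
      using obt [of a] ab n by blast
    obtain v where v: "v \<in> F" "v \<noteq> 0" "v \<notin> E" and b: "b = v \<or> b = x + v \<or> b = y + v"
      using obt [of b] ab n by blast
    have 1: "u \<noteq> v \<Longrightarrow> u + v \<in> E" using T u v by blast
    have 2: "x + (u + v) \<in> E" "y + (u + v) \<in> E"
      using 1 u v xE yE pts [of "u + v"] by (cases "u = v"; simp add: sum_zero_iff)+
    have 3: "x + y + (u + v) \<in> E" using c u v by simp
    have "a + b \<in> E"
      using a b 1 2 3 ab(5) by (elim disjE) (auto simp: f2_simps)
    then show False using n by simp
  qed
qed

text \<open>If no extension of \<open>F\<close> by a single point is indecomposable, every coset of \<open>F\<close> is constant or a
  clone. The clones together with \<open>0\<close> are then a summand of \<open>U\<close>, unless two of them span an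
  indecomposable extension of \<open>F\<close>.\<close>

lemma indecomposable_extension:
  assumes U: "indecomposable U" "clawless U" and F: "indecomposable F" "F \<subset> U"
  shows "\<exists>W. F \<subset> W \<and> W \<subseteq> U \<and> indecomposable W \<and>
    ((\<exists>x\<in>U - F. W = adjoin x F) \<or> cotriangle_free W \<or> quadratic W)"
proof (rule ccontr)
  assume no: "\<not> ?thesis"
  have s: "subspace F" and sU: "subspace U" using U F indecomposableD by auto
  have FU: "F \<subseteq> U" using F by auto
  have cl: "0 \<in> F" "\<And>u v. u \<in> F \<Longrightarrow> v \<in> F \<Longrightarrow> u + v \<in> F" "\<And>u v. u \<in> U \<Longrightarrow> v \<in> U \<Longrightarrow> u + v \<in> U"
    using s sU by (auto simp: subspaceD)
  have dich: "(\<forall>u\<in>F. a + u \<in> E \<longleftrightarrow> a \<in> E) \<or> (\<exists>k\<in>F. clone F (a + k))" if a: "a \<in> U" "a \<notin> F" for a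
  proof (rule clone_or_constant [OF F(1) a(2)])
    have "F \<subset> adjoin a F" using subset_adjoin mem_adjoin [OF s] a by blast
    moreover have "adjoin a F \<subseteq> U" using adjoin_subset [OF sU FU] a by blast
    ultimately show "\<not> indecomposable (adjoin a F)" using no a by blast
  qed
  have W: "F \<subset> adjoin y (adjoin x F)" "adjoin y (adjoin x F) \<subseteq> U"
    if "x \<in> U" "y \<in> U" "clone F x" for x y
  proof -
    have "x \<notin> F" using that by (simp add: clone_def)
    then show "F \<subset> adjoin y (adjoin x F)"
      using subset_adjoin mem_adjoin [OF s, of x] by blast
    show "adjoin y (adjoin x F) \<subseteq> U" by (intro adjoin_subset sU FU that)
  qed
  \<comment> \<open>Two clones never share a coset. In the coset of \<open>x + y\<close>, a constant
    value, or a clone other than \<open>x + y\<close>, would give one of the two-dimensional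
    extensions that \<open>no\<close> forbids.\<close>
  have C_add: "clone F (x + y)" if x: "x \<in> U" "clone F x" and y: "y \<in> U" "clone F y" and xy: "x \<noteq> y" for x y
  proof -
    have nF: "x + y \<notin> F"
    proof
      assume d: "x + y \<in> F"
      have "x + y \<noteq> 0" using xy by (simp add: sum_zero_iff)
      then obtain u where u: "u \<in> F" "u \<noteq> 0" "u \<noteq> x + y" "u \<in> E" "u + (x + y) \<notin> E"
        using exists_mixed_pair [OF F(1) d] by blast
      then have "u + (x + y) \<in> F" "u + (x + y) \<noteq> 0" using d cl by (auto simp: sum_zero_iff)
      then have "x + (u + (x + y)) \<notin> E" using cloneD [OF x(2)] u by blast
      moreover have "x + (u + (x + y)) = y + u" by (simp add: f2_simps)
      ultimately show False using cloneD [OF y(2)] u by metis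
    qed
    from dich [OF cl(3) [OF x(1) y(1)] nF] show ?thesis
    proof
      assume c: "\<forall>u\<in>F. x + y + u \<in> E \<longleftrightarrow> x + y \<in> E"
      have "cotriangle_free (adjoin y (adjoin x F))"
        by (rule clones_constant_cotriangle_free [OF sU U(2) F(1) FU x(1) y(1) x(2) y(2) nF]) (use c in blast)
      moreover have "indecomposable (adjoin y (adjoin x F))"
        by (rule indecomposable_two_clones [OF F(1) x(2) y(2)]) (use c in blast)
      ultimately show ?thesis using no W [OF x(1) y(1) x(2)] by blast
    next
      assume "\<exists>k\<in>F. clone F (x + y + k)"
      then obtain k where k: "k \<in> F" "clone F (x + y + k)" by blast
      show ?thesis
      proof (cases "k = 0")
        case False
        interpret clone_triple scale E U F x y "x + y + k" k
          by unfold_locales (use U F FU sU x y k False in auto)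
        show ?thesis using extension no W [OF x(1) y(1) x(2)] by blast
      qed (use k in simp)
    qed
  qed
  have const_clone: False if "x \<in> U" "clone F x" "a + x \<in> F" "\<forall>u\<in>F. a + u \<in> E \<longleftrightarrow> a \<in> E" for x a
  proof -
    obtain u where u: "u \<in> F" "u \<noteq> 0" "u \<in> E \<longleftrightarrow> a \<notin> E" using mixed_off_point [OF F(1) cl(1)] by blast
    have "a + (a + x + u) \<in> E \<longleftrightarrow> a \<in> E" using that u cl by blast
    moreover have "a + (a + x + u) = x + u" by (simp add: add.assoc)
    ultimately show False using cloneD [OF that(2)] u by metis
  qed
  \<comment> \<open>A clone cannot carry a constant coset to one containing a clone, as by
    \<open>C_add\<close> the constant coset would contain a clone too. If both are constant with
    different values, the member \<open>b\<close> of \<open>{a, x + a}\<close> in \<open>E\<close>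
    leads to a claw.\<close>
  have const_shift: "x + a \<in> E \<longleftrightarrow> a \<in> E"
    if x: "x \<in> U" "clone F x" and a: "a \<in> U" "a \<notin> F" "\<forall>u\<in>F. a + u \<in> E \<longleftrightarrow> a \<in> E" for x a
  proof -
    have nF: "x + a \<notin> F" using const_clone [OF x] a by (metis add.commute)
    have c: "\<forall>u\<in>F. x + a + u \<in> E \<longleftrightarrow> x + a \<in> E"
    proof (rule ccontr)
      assume "\<not> ?thesis"
      then obtain k where k: "k \<in> F" "clone F (x + a + k)" using dich [OF cl(3) [OF x(1) a(1)] nF] by blast
      have "a + k \<notin> F" using a k s by (simp add: subspaceD)
      then have "x \<noteq> x + a + k" using cl(1) by (metis add.assoc add_cancel_left_right)
      moreover have "x + a + k \<in> U" using x a k FU by (meson cl(3) subsetD)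
      ultimately have "clone F (x + (x + a + k))" using C_add [OF x _ k(2)] by blast
      then have "clone F (a + k)" by (simp add: add.assoc)
      moreover have "a + k \<in> U" "a + (a + k) \<in> F" using a k FU cl(3) by auto
      ultimately show False using const_clone a by blast
    qed
    show ?thesis
    proof (rule ccontr)
      assume ne: "\<not> ?thesis"
      define b where "b = (if a \<in> E then a else x + a)"
      have bE: "\<And>u. u \<in> F \<Longrightarrow> b + u \<in> E" "\<And>u. u \<in> F \<Longrightarrow> x + b + u \<notin> E"
        using ne a(3) c by (auto simp: b_def)
      have bU: "b \<in> U" "x + b \<notin> F" "b \<notin> F" using a x nF cl by (auto simp: b_def)
      obtain u v where uv: "u \<in> F" "v \<in> F" "u \<noteq> 0" "v \<noteq> 0" "u \<noteq> v" "u \<notin> E" "v \<notin> E" "u + v \<in> E"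
        using exists_coline [OF F(1)] .
      have xF: "x \<notin> F" using x by (simp add: clone_def)
      have uvU: "u \<in> U" "v \<in> U" using uv FU by auto
      have "b + u \<in> U" "x + (u + v) \<in> U" "x + b + v \<noteq> 0" "x + b + (u + v) \<noteq> 0" "u + v \<noteq> 0"
        using bU x uv uvU cl by (auto simp: sum_zero_iff)
      then show False using bU uv bE(1) [of 0] bE x cl cloneD [OF x(2)]
        by (intro claw_contra [OF U(2), of b "b + u" "x + (u + v)" u "x + b + (u + v)" "x + b + v" "x + v"])
          (simp_all, (simp_all add: f2_simps)?)
    qed
  qed
  define D where "D = insert 0 {x \<in> U. clone F x}"
  show False
  proof (cases "\<exists>x\<in>U. clone F x")
    \<comment> \<open>Without clones every coset is constant and \<open>F\<close> itself is a
      summand.\<close>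
    case False
    have "v + w \<in> E \<longleftrightarrow> v \<in> E" if "v \<in> U - F" "w \<in> F" for v w
    proof -
      have "v + k \<in> U" if "k \<in> F" for k using that \<open>v \<in> U - F\<close> FU cl by blast
      then show ?thesis using dich [of v] that False by blast
    qed
    moreover have "F \<noteq> {0}" using F(1) by (auto simp: indecomposable_def)
    ultimately have "summand U F" using F s by (auto simp: summand_def)
    then show False using U(1) indecomposableD by blast
  next
    case True
    have sD: "subspace D"
      unfolding subspace_iff
    proof (intro conjI ballI)
      fix x y assume "x \<in> D" "y \<in> D"
      then show "x + y \<in> D"
        using C_add [of x y] cl(3) [of x y] by (cases "x = y") (auto simp: D_def)
    qed (simp add: D_def)
    have "v + w \<in> E \<longleftrightarrow> v \<in> E" if v: "v \<in> U - D" and w: "w \<in> D" for v w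
    proof (cases "w = 0")
      case False
      then have w: "w \<in> U" "clone F w" using w by (auto simp: D_def)
      have v: "v \<in> U" "v \<noteq> 0" "\<not> clone F v" using v by (auto simp: D_def)
      show ?thesis
      proof (cases "v \<in> F")
        case True then show ?thesis using cloneD [OF w(2)] v by (metis add.commute)
      next
        case vF: False
        from dich [OF v(1) vF] show ?thesis
        proof
          assume "\<forall>u\<in>F. v + u \<in> E \<longleftrightarrow> v \<in> E"
          then show ?thesis using const_shift [OF w v(1) vF] by (simp add: add.commute)
        next
          assume "\<exists>k\<in>F. clone F (v + k)"
          then obtain k where k: "k \<in> F" "clone F (v + k)" by blast
          have k0: "k \<noteq> 0" using k v by auto
          have "v + k + k = v" by (simp add: add.assoc)
          then have 1: "v \<in> E \<longleftrightarrow> k \<in> E" using cloneD [OF k(2) k(1) k0] by metis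
          show ?thesis
          proof (cases "w = v + k")
            case True then show ?thesis using 1 by simp
          next
            case False
            moreover have "v + k \<in> U" using k v FU cl(3) by auto
            ultimately have "clone F (w + (v + k))" using C_add [OF w _ k(2)] by blast
            then have "w + (v + k) + k \<in> E \<longleftrightarrow> k \<in> E" using k k0 by (intro cloneD)
            moreover have "w + (v + k) + k = v + w" by (simp add: f2_simps)
            ultimately show ?thesis using 1 by metis
          qed
        qed
      qed
    qed simp
    moreover have "D \<noteq> {0}" using True cl by (auto simp: D_def clone_def)
    moreover have "D \<noteq> U"
    proof -
      obtain a where "a \<in> F" "a \<noteq> 0" using F(1) by (auto simp: indecomposable_def)
      then show ?thesis using FU by (auto simp: D_def clone_def)
    qed
    moreover have "D \<subseteq> U" using sU by (auto simp: D_def subspaceD)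
    ultimately have "summand U D" using sD unfolding summand_def by blast
    then show False using U(1) indecomposableD by blast
  qed
qed

text \<open>A maximal proper indecomposable \<open>H\<close> above \<open>K\<close> can only extend
  to \<open>U\<close> itself, and since \<open>U\<close> is neither cotriangle-free nor quadratic,
  this extension is by a single point.\<close>

lemma exists_indecomposable_hyperplane:
  assumes U: "indecomposable U" "clawless U" "finite U" "\<not> cotriangle_free U" "\<not> quadratic U"
    and K: "indecomposable K" "K \<subset> U"
  obtains H x where "K \<subseteq> H" "indecomposable H" "x \<in> U" "x \<notin> H" "U = adjoin x H"
proof -
  define S where "S = {H. K \<subseteq> H \<and> H \<subset> U \<and> indecomposable H}"
  have "S \<subseteq> Pow U" by (auto simp: S_def)
  then have fin: "finite S" using U(3) by (simp add: finite_subset)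
  have "K \<in> S" using K by (simp add: S_def)
  from finite_has_maximal2 [OF fin this] obtain H
    where "H \<in> S" and max: "\<forall>H'\<in>S. H \<subseteq> H' \<longrightarrow> H = H'" by blast
  then have H: "K \<subseteq> H" "H \<subset> U" "indecomposable H" by (auto simp: S_def)
  obtain W where W: "H \<subset> W" "W \<subseteq> U" "indecomposable W"
    "(\<exists>x\<in>U - H. W = adjoin x H) \<or> cotriangle_free W \<or> quadratic W"
    using indecomposable_extension [OF U(1,2) H(3,2)] by blast
  have "W = U"
  proof (rule ccontr)
    assume "W \<noteq> U"
    then have "W \<in> S" using W H by (auto simp: S_def)
    then show False using max W(1) by blast
  qed
  then show thesis using W(4) U(4,5) H that by blast
qed

section \<open>Existence of a complement of a claw\<close>

lemma span_insert_adjoin: "span (insert b B) = adjoin b (span B)"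
proof
  have "b \<in> adjoin b (span B)" by (rule mem_adjoin) simp
  moreover have "B \<subseteq> adjoin b (span B)" using span_superset subset_adjoin by blast
  ultimately show "span (insert b B) \<subseteq> adjoin b (span B)"
    by (intro span_minimal subspace_adjoin) auto
  show "adjoin b (span B) \<subseteq> span (insert b B)"
    by (intro adjoin_subset span_mono) (auto intro: span_base)
qed

text \<open>The analogue for geometries of the fact that a graph on at least two vertices without induced
  four-vertex path is disconnected or has a disconnected complement.\<close>

lemma coclaw_if_both_span:
  assumes "finite B" "B \<inter> E = {}" "span B \<noteq> {0}" "clawless (span B)"
    "\<And>a b c. \<lbrakk>a \<in> span B; b \<in> span B; c \<in> span B\<rbrakk> \<Longrightarrow> \<not> coclaw a b c"
  shows "\<exists>W. subspace W \<and> W \<subset> span B \<and> E \<inter> span B \<subseteq> W"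
  using assms
proof (induction B rule: finite_induct)
  case empty
  then show ?case by simp
next
  case (insert b B)
  define H where "H = span B"
  have U: "span (insert b B) = adjoin b H" by (simp add: H_def span_insert_adjoin)
  have sH: "subspace H" by (simp add: H_def)
  have sU: "subspace (adjoin b H)" using sH by (rule subspace_adjoin)
  have HU: "H \<subseteq> adjoin b H" by (rule subset_adjoin)
  have clH: "u + v \<in> H" if "u \<in> H" "v \<in> H" for u v using sH that by (rule subspaceD)
  have clU: "u + v \<in> adjoin b H" if "u \<in> adjoin b H" "v \<in> adjoin b H" for u v using sU that by (rule subspaceD)
  have noclaw: "clawless (adjoin b H)" and nococlaw: "\<And>a c d. \<lbrakk>a \<in> adjoin b H; c \<in> adjoin b H; d \<in> adjoin b H\<rbrakk> \<Longrightarrow> \<not> coclaw a c d"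
    using insert.prems unfolding U by auto
  have bE: "b \<notin> E" "B \<inter> E = {}" using insert.prems by auto
  have IH: "\<exists>W. subspace W \<and> W \<subset> H \<and> E \<inter> H \<subseteq> W" if "H \<noteq> {0}"
    unfolding H_def
  proof (rule insert.IH)
    show "clawless (span B)" using noclaw HU unfolding H_def by (rule clawless_subset)
    show "\<not> coclaw a c d" if "a \<in> span B" "c \<in> span B" "d \<in> span B" for a c d
      using that nococlaw HU unfolding H_def by blast
  qed (use bE that in \<open>auto simp: H_def\<close>)
  consider "b \<in> H" | "b \<notin> H" "H = {0}" | "b \<notin> H" "H \<noteq> {0}" by blast
  then show ?case
  proof cases
    case 1
    then have e: "adjoin b H = H" using adjoin_subset [OF sH order_refl] HU by blast
    then have "H \<noteq> {0}" using insert.prems unfolding U by simp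
    then show ?thesis using IH unfolding U e by blast
  next
    case 2
    then have "E \<inter> adjoin b H \<subseteq> {0}" using bE by (auto simp: adjoin_iff sum_zero_iff)
    moreover have "{0} \<subset> adjoin b H" using 2 HU mem_adjoin [OF sH, of b] by auto
    ultimately show ?thesis unfolding U by (metis subspace_single_0)
  next
    case 3
    from IH [OF this(2)] obtain W0 where W0: "subspace W0" "W0 \<subset> H" "E \<inter> H \<subseteq> W0" by blast
    \<comment> \<open>The induction hypothesis makes \<open>J\<close> proper in \<open>H\<close>.
      Below, \<open>S\<close> collects the points of \<open>E\<close> off \<open>H\<close>; the new
      generator \<open>b\<close> is not among them.\<close>
    define J where "J = span (E \<inter> H)"
    have J: "subspace J" "J \<subset> H" "E \<inter> H \<subseteq> J"
      using W0 span_minimal [OF W0(3,1)] by (auto simp: J_def intro: span_base)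
    have out: "k \<notin> E" "k \<noteq> 0" if "k \<in> H" "k \<notin> J" for k
      using that J subspaceD(1) [OF J(1)] by auto
    define S where "S = {w \<in> adjoin b H. w \<in> E \<and> w \<notin> H}"
    have bS: "b \<notin> S" using bE by (simp add: S_def)
    have SH: "w + v \<in> H" if "w \<in> S" "v \<in> S" for w v
    proof -
      have "b + w \<in> H" "b + v \<in> H" using that by (auto simp: S_def adjoin_iff)
      then have "b + w + (b + v) \<in> H" by (rule clH)
      then show ?thesis by (simp add: f2_simps)
    qed
    have SU: "w + k \<in> adjoin b H" "w + k \<notin> H" if "w \<in> S" "k \<in> H" for w k
      using that HU clU subspaceD(4) [OF sH that(2)] by (auto simp: S_def)
    have SI: "w + k \<in> S \<longleftrightarrow> w + k \<in> E" if "w \<in> S" "k \<in> H" for w k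
      using SU [OF that] by (auto simp: S_def)
    show ?thesis
    proof (cases "\<exists>u\<in>S. \<exists>h\<in>H - J. u + h \<in> S")
      \<comment> \<open>All of \<open>S\<close> lies in one coset of \<open>J\<close>, so adjoining
        a point of \<open>S\<close> to \<open>J\<close> captures \<open>E\<close> in a proper
        subspace.\<close>
      case False
      have *: "w + v \<in> J" if "w \<in> S" "v \<in> S" for w v
      proof (rule ccontr)
        assume "w + v \<notin> J"
        moreover have "w + (w + v) = v" by simp
        ultimately show False using False that SH [OF that] by (metis DiffI)
      qed
      show ?thesis
      proof (cases "S = {}")
        case True
        then have "E \<inter> adjoin b H \<subseteq> H" by (auto simp: S_def)
        moreover have "H \<subset> adjoin b H" using HU 3 mem_adjoin [OF sH, of b] by blast
        ultimately show ?thesis unfolding U using sH by blast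
      next
        case False
        then obtain u where u: "u \<in> S" by blast
        have "E \<inter> adjoin b H \<subseteq> adjoin u J"
        proof
          fix w assume w: "w \<in> E \<inter> adjoin b H"
          then have "w \<in> S \<or> w \<in> J" using J(3) by (auto simp: S_def)
          then show "w \<in> adjoin u J" using * [OF u] by (auto simp: adjoin_iff)
        qed
        moreover have "adjoin u J \<subseteq> adjoin b H"
          using u J HU by (intro adjoin_subset [OF sU]) (auto simp: S_def)
        moreover have "adjoin u J \<noteq> adjoin b H"
        proof -
          obtain h where h: "h \<in> H" "h \<notin> J" using J by blast
          then have "u + h \<notin> H" using SU u by blast
          then have "h \<notin> adjoin u J" using h J by (auto simp: adjoin_iff)
          then show ?thesis using h HU by blast
        qed
        ultimately show ?thesis unfolding U using subspace_adjoin [OF J(1)] by blast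
      qed
    next
      \<comment> \<open>Now \<open>S\<close> turns out to be invariant under \<open>J\<close> and
        closed under sums of three, so \<open>S\<close> and its pairwise sums form a subspace
        \<open>W\<close>. Invariance puts \<open>E \<inter> H\<close> into \<open>W\<close>, while
        \<open>b\<close> stays out because it is not in \<open>S\<close> and the pairwise sums lie
        in \<open>H\<close>.\<close>
      case True
      then obtain u h where uh: "u \<in> S" "h \<in> H" "h \<notin> J" "u + h \<in> S" by blast
      have pair: "w + j \<in> S \<and> w + j + k \<in> S"
        if w: "w \<in> S" "w + k \<in> S" and k: "k \<in> H" "k \<notin> J" and j: "j \<in> E" "j \<in> H" for w k j
      proof -
        have kj: "k + j \<in> H" "k + j \<notin> J" using k j clH J subspaceD(4) [OF J(1), of j k] by auto
        have E: "w \<in> E" "w + k \<in> E" "k \<notin> E" "k + j \<notin> E" "k \<noteq> 0" "k + j \<noteq> 0" "j \<noteq> 0"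
          using w k j kj out [of k] out [of "k + j"] by (auto simp: S_def)
        have jk: "j + k \<in> H" using j k clH by blast
        have mem: "w \<in> adjoin b H" "k \<in> adjoin b H" "j \<in> adjoin b H" using w k j HU by (auto simp: S_def)
        have nH: "w + j \<noteq> 0" "w + (j + k) \<noteq> 0" using SU(2) [OF w(1) j(2)] SU(2) [OF w(1) jk] sH
          by (auto simp: subspaceD)
        have "w + j \<in> E \<and> w + (j + k) \<in> E"
        proof (rule ccontr)
          assume "\<not> ?thesis"
          then consider "w + j \<in> E" "w + (j + k) \<notin> E" | "w + j \<notin> E" "w + (j + k) \<in> E"
            | "w + j \<notin> E" "w + (j + k) \<notin> E" by blast
          then show False
          proof cases
            case 1
            then have "coclaw k (k + j) (w + (j + k))"
              using E j unfolding coclaw_def by (simp add: f2_simps)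
            then show False using nococlaw [of k "k + j" "w + (j + k)"] mem clU by simp
          next
            case 2
            then have "coclaw k (k + j) (w + j)"
              using E j unfolding coclaw_def by (simp add: f2_simps)
            then show False using nococlaw [of k "k + j" "w + j"] mem clU by simp
          next
            case c: 3
            show False
              by (rule claw_contra [OF noclaw, of j w "w + k" "w + j" "w + (j + k)" k "k + j"])
                (use c E j nH mem clU in \<open>simp_all add: f2_simps\<close>)
          qed
        qed
        then show ?thesis using SI [OF w(1) j(2)] SI [OF w(1) jk] by (simp add: add.assoc)
      qed
      have pairJ: "w + j \<in> S \<and> w + j + k \<in> S"
        if w: "w \<in> S" "w + k \<in> S" and k: "k \<in> H" "k \<notin> J" and j: "j \<in> J" for w k j
      proof -
        have "w + j \<in> {v \<in> S. v + k \<in> S}"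
          using j unfolding J_def by (rule span_translation_closed) (use w k pair in auto)
        then show ?thesis by auto
      qed
      have SJ: "w + j \<in> S" if w: "w \<in> S" and j: "j \<in> J" for w j
      proof (cases "w + u \<in> J")
        case True
        have "u + (w + u) + h \<in> S" using pairJ [OF uh(1,4,2,3) True] by blast
        moreover have "u + (w + u) + h = w + h" by (simp add: f2_simps)
        ultimately have "w + h \<in> S" by metis
        then show ?thesis using pairJ [OF w _ uh(2,3) j] by blast
      next
        case False
        have "w + (w + u) = u" by simp
        then have "w + (w + u) \<in> S" using uh by simp
        then show ?thesis using pairJ [OF w _ SH [OF w uh(1)] False j] by blast
      qed
      have S3: "p + q + r \<in> S" if p: "p \<in> S" and q: "q \<in> S" and r: "r \<in> S" for p q r
      proof (cases "p + q \<in> J \<or> p + r \<in> J \<or> q + r \<in> J")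
        case True
        then have "r + (p + q) \<in> S \<or> q + (p + r) \<in> S \<or> p + (q + r) \<in> S" using SJ p q r by blast
        then show ?thesis by (simp add: f2_simps)
      next
        case False
        have "p + q + r \<in> E"
        proof (rule ccontr)
          assume n: "p + q + r \<notin> E"
          show False
            by (rule claw_contra [OF noclaw, of p q r "p + q" "p + r" "q + r" "p + q + r"])
              (use p q r n False out SH in \<open>auto simp: S_def\<close>)
        qed
        then show ?thesis using SI [OF p SH [OF q r]] by (simp add: add.assoc)
      qed
      define W where "W = S \<union> {p + q | p q. p \<in> S \<and> q \<in> S}"
      have W_iff: "w \<in> W \<longleftrightarrow> w \<in> S \<or> u + w \<in> S" for w
      proof
        assume "w \<in> W"
        then consider "w \<in> S" | p q where "p \<in> S" "q \<in> S" "w = p + q" by (auto simp: W_def)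
        then show "w \<in> S \<or> u + w \<in> S"
        proof cases
          case 2 then show ?thesis using S3 [OF uh(1) 2(1,2)] by (simp add: add.assoc)
        qed simp
      next
        assume "w \<in> S \<or> u + w \<in> S"
        moreover have "w = u + (u + w)" by simp
        ultimately show "w \<in> W" using uh(1) unfolding W_def by blast
      qed
      have sW: "subspace W"
        unfolding subspace_iff
      proof (intro conjI ballI)
        show "0 \<in> W" using uh by (simp add: W_iff)
        fix v w assume "v \<in> W" "w \<in> W"
        then consider "v \<in> S" "w \<in> S" | "v \<in> S" "u + w \<in> S" | "u + v \<in> S" "w \<in> S" | "u + v \<in> S" "u + w \<in> S"
          by (auto simp: W_iff)
        then show "v + w \<in> W"
        proof cases
          case 1 then show ?thesis by (auto simp: W_def)
        next
          case 2 then show ?thesis using S3 [OF uh(1) 2] by (simp add: W_iff f2_simps)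
        next
          case 3 then show ?thesis using S3 [OF uh(1) 3] by (simp add: W_iff f2_simps)
        next
          case 4
          have "u + v + (u + w) = v + w" by (simp add: f2_simps)
          then show ?thesis using 4 unfolding W_def by (metis (mono_tags, lifting) UnI2 mem_Collect_eq)
        qed
      qed
      have "E \<inter> adjoin b H \<subseteq> W"
      proof
        fix w assume w: "w \<in> E \<inter> adjoin b H"
        show "w \<in> W"
        proof (cases "w \<in> H")
          case True
          then have "u + w \<in> S" using w J SJ uh by blast
          then show ?thesis by (simp add: W_iff)
        qed (use w in \<open>auto simp: W_def S_def\<close>)
      qed
      moreover have "W \<subseteq> adjoin b H" using SH HU by (auto simp: W_def S_def)
      moreover have "b \<notin> W" using bS 3 SH by (auto simp: W_def)
      then have "W \<noteq> adjoin b H" using mem_adjoin [OF sH, of b] by auto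
      ultimately show ?thesis using sW unfolding U by blast
    qed
  qed
qed

text \<open>Membership in \<open>E\<close> cannot be constant off a proper subspace, as that
  subspace would be a summand (\<open>full\<close>). So the points of \<open>E\<close> and the
  points outside \<open>E\<close> both span \<open>U\<close>, which
  \<open>coclaw_if_both_span\<close> rules out when there is no complement of a claw.\<close>

lemma exists_coclaw:
  assumes U: "indecomposable U" "clawless U" "finite U"
  shows "\<exists>a\<in>U. \<exists>b\<in>U. \<exists>c\<in>U. coclaw a b c"
proof -
  have s: "subspace U" using U(1) by (rule indecomposableD)
  have full: "W = U" if W: "subspace W" "W \<subseteq> U" "\<And>x. x \<in> U \<Longrightarrow> x \<notin> W \<Longrightarrow> x \<in> E \<longleftrightarrow> c" for W c
  proof (rule ccontr)
    assume n: "W \<noteq> U"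
    obtain p q where pq: "p \<in> U" "q \<in> U" "p \<in> E" "q \<notin> E" "q \<noteq> 0" using exists_mixed_points [OF U(1)] .
    have "p \<noteq> 0" using pq by auto
    then have "W \<noteq> {0}" using W(3) [of p] W(3) [of q] pq by auto
    moreover have "x + y \<in> E \<longleftrightarrow> x \<in> E" if "x \<in> U - W" "y \<in> W" for x y
    proof -
      have "x + y \<in> U" "x + y \<notin> W" using that W(2) s subspaceD(4) [OF W(1), of y x] by (auto simp: subspaceD)
      then show ?thesis using W(3) that by blast
    qed
    ultimately have "summand U W" using W n unfolding summand_def by blast
    then show False using U(1) indecomposableD by blast
  qed
  let ?B = "U - E"
  have span: "span ?B = U"
  proof (rule full)
    show "span ?B \<subseteq> U" by (rule span_minimal) (use s in auto)
    show "x \<in> E \<longleftrightarrow> True" if "x \<in> U" "x \<notin> span ?B" for x using that by (auto intro: span_base)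
  qed simp
  show ?thesis
  proof (rule ccontr)
    assume n: "\<not> ?thesis"
    have "\<exists>W. subspace W \<and> W \<subset> span ?B \<and> E \<inter> span ?B \<subseteq> W"
    proof (rule coclaw_if_both_span)
      show "span ?B \<noteq> {0}" using U(1) unfolding span by (auto simp: indecomposable_def)
      show "\<not> coclaw a b c" if "a \<in> span ?B" "b \<in> span ?B" "c \<in> span ?B" for a b c
        using that n unfolding span by blast
    qed (use U span in auto)
    then obtain W where "subspace W" "W \<subset> U" "E \<inter> U \<subseteq> W" unfolding span by blast
    then show False using full [of W False] by blast
  qed
qed

section \<open>Spans of three vectors\<close>

definition hull3 :: "'a \<Rightarrow> 'a \<Rightarrow> 'a \<Rightarrow> 'a set" where
  "hull3 a b c = adjoin c (adjoin b {0, a})"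

lemma hull3_iff: "v \<in> hull3 a b c \<longleftrightarrow> v \<in> {0, a, b, c, a + b, a + c, b + c, a + b + c}"
proof -
  have e: "b + v = 0 \<longleftrightarrow> v = b" "b + v = a \<longleftrightarrow> v = a + b" "c + v = 0 \<longleftrightarrow> v = c" "c + v = a \<longleftrightarrow> v = a + c"
    "b + (c + v) = 0 \<longleftrightarrow> v = b + c" "b + (c + v) = a \<longleftrightarrow> v = a + b + c" for v
    by (metis add.commute add.left_commute add_self_left add.right_neutral)+
  show ?thesis
    unfolding hull3_def adjoin_iff using e by auto
qed

lemma hull3_props:
  "subspace (hull3 a b c)" "a \<in> hull3 a b c" "b \<in> hull3 a b c" "c \<in> hull3 a b c" "0 \<in> hull3 a b c"
  by (auto simp: hull3_iff) (simp add: hull3_def subspace_adjoin subspace_pair)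

lemma hull3_least:
  assumes "subspace S" "a \<in> S" "b \<in> S" "c \<in> S"
  shows "hull3 a b c \<subseteq> S"
proof -
  have "{0, a} \<subseteq> S" using assms by (auto simp: subspaceD)
  then show ?thesis unfolding hull3_def by (intro adjoin_subset assms)
qed

lemma coclaw_hull3: "coclaw a b c \<Longrightarrow> indecomposable (hull3 a b c)"
  by (rule coclaw_indecomposable [of _ a b c]) (simp_all add: hull3_props hull3_least)

lemma card_hull3: "finite (hull3 a b c)" "card (hull3 a b c) \<le> 8"
proof -
  have f: "finite (adjoin b {0, a})" by (intro finite_adjoin) simp
  then show "finite (hull3 a b c)" unfolding hull3_def by (rule finite_adjoin)
  have "card {0, a} \<le> 2" by (simp add: card_insert_if)
  then have "card (adjoin b {0, a}) \<le> 4" using card_adjoin_le [of "{0, a}" b] by simp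
  then show "card (hull3 a b c) \<le> 8" unfolding hull3_def using card_adjoin_le [OF f, of c] by simp
qed

section \<open>Extensions without triangle-free complement\<close>

text \<open>If there were no such witness, then by \<open>star\<close> a point \<open>w\<close> off
  \<open>H\<close> with \<open>w, w + a\<close> outside \<open>E\<close> would see each complement
  of a claw through \<open>a\<close> in one of two ways: its coset avoids \<open>E\<close> or is a
  copy of it. These local alternatives are made uniform: either \<open>w + H\<close> avoids
  \<open>E\<close>, and \<open>H\<close> is a summand, or \<open>w + H\<close> copies
  \<open>H\<close>, and \<open>{0, w}\<close> is one.\<close>

lemma cotriangle_free_hyperplane_exit:
  assumes U: "clawless U" "indecomposable U" "\<not> cotriangle_free U"
    and H: "indecomposable H" "cotriangle_free H" and x: "x \<notin> H" "U = adjoin x H"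
  shows "\<exists>a\<in>H. \<exists>b\<in>H. \<exists>c\<in>H. \<exists>w\<in>U - H. coclaw a b c \<and> indecomposable (adjoin w (hull3 a b c)) \<and>
    \<not> cotriangle_free (adjoin w (hull3 a b c))"
proof (rule ccontr)
  assume no: "\<not> ?thesis"
  have sH: "subspace H" and sU: "subspace U" using U H indecomposableD by auto
  have HU: "H \<subseteq> U" unfolding x by (rule subset_adjoin)
  have h0: "0 \<in> H" using sH by (rule subspaceD)
  have clH: "u + v \<in> H" if "u \<in> H" "v \<in> H" for u v using sH that by (rule subspaceD)
  have clU: "u + v \<in> U" if "u \<in> U" "v \<in> U" for u v using sU that by (rule subspaceD)
  have two: "u + v \<in> H" if "u \<in> U" "v \<in> U" "u \<notin> H" "v \<notin> H" for u v
  proof -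
    have "x + u \<in> H" "x + v \<in> H" using that x by (auto simp: adjoin_iff)
    then have "x + u + (x + v) \<in> H" by (rule clH)
    then show ?thesis by (simp add: f2_simps)
  qed
  have shift: "w + u \<in> U" "w + u \<notin> H" if "w \<in> U" "w \<notin> H" "u \<in> H" for w u
    using that HU clU subspaceD(4) [OF sH that(3)] by auto
  have T: "u + v \<in> E" if "u \<in> H" "v \<in> H" "u \<noteq> 0" "v \<noteq> 0" "u \<notin> E" "v \<notin> E" "u \<noteq> v" for u v
    using H(2) that unfolding cotriangle_free_def by blast
  define Q where "Q a \<longleftrightarrow> a \<in> H \<and> a \<noteq> 0 \<and> a \<notin> E" for a
  have TQ: "u + v \<in> E" if "Q u" "Q v" "u \<noteq> v" for u v using T that by (simp add: Q_def)
  obtain a y where a: "Q a" and y: "y \<in> U" "y \<notin> H" "y \<notin> E" "y + a \<notin> E"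
  proof -
    obtain p q where pq: "p \<in> U" "q \<in> U" "p \<noteq> 0" "q \<noteq> 0" "p \<noteq> q" "p \<notin> E" "q \<notin> E" "p + q \<notin> E"
      using U(3) unfolding cotriangle_free_def by blast
    have ne: "p + q \<noteq> 0" using pq by (simp add: sum_zero_iff)
    have nH: "p \<notin> H \<or> q \<notin> H" using T [of p q] pq by blast
    consider "p \<in> H" "q \<notin> H" | "p \<notin> H" "q \<in> H" | "p \<notin> H" "q \<notin> H" using nH by blast
    then show thesis
    proof cases
      case 1 then show ?thesis using pq that [of p q] by (simp add: Q_def add.commute)
    next
      case 2 then show ?thesis using pq that [of q p] by (simp add: Q_def)
    next
      case 3 then show ?thesis using pq ne two [of p q] that [of "p + q" p] by (simp add: Q_def)
    qed
  qed
  have edge: "w + b \<notin> E \<or> w + a + b \<notin> E"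
    if w: "w \<in> U" "w \<notin> H" "w \<notin> E" "w + a \<notin> E" and a: "Q a" and b: "Q b" and ab: "a \<noteq> b" for w a b
  proof (rule ccontr)
    assume c: "\<not> ?thesis"
    have abE: "a + b \<in> E" using TQ a b ab by blast
    have mem: "a \<in> U" "b \<in> U" "a + b \<in> U" using a b HU clU by (auto simp: Q_def)
    have nz: "w + a \<noteq> 0" "w \<noteq> 0" using w a h0 by (auto simp: Q_def sum_zero_iff)
    show False
      by (rule claw_contra [OF U(1), of "a + b" "w + b" "w + a + b" "w + a" w a b])
        (use c abE mem nz w a b clU in \<open>simp_all add: Q_def\<close>, (simp_all add: f2_simps)?)
  qed
  have parallel: "w + s \<in> E \<longleftrightarrow> w + s + b \<in> E"
    if w: "w \<in> U" "w \<notin> H" "w \<notin> E" "w + b \<notin> E" and b: "Q b" and s: "s \<in> H" "s \<in> E" "s + b \<in> E" for w b s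
  proof -
    have mem: "b \<in> U" "s \<in> U" using b s HU by (auto simp: Q_def)
    have nz: "w + b \<noteq> 0" "w \<noteq> 0" "b \<noteq> 0" using w b h0 by (auto simp: Q_def sum_zero_iff)
    have False if "w + s \<in> E" "w + s + b \<notin> E"
      by (rule claw_contra [OF U(1), of s "s + b" "w + s" b w "w + b" "w + s + b"])
        (use that mem nz w b s clU in \<open>simp_all add: Q_def\<close>, (simp_all add: f2_simps)?)
    moreover have False if "w + s \<notin> E" "w + s + b \<in> E"
      by (rule claw_contra [OF U(1), of s "s + b" "w + s + b" b "w + b" w "w + s"])
        (use that mem nz w b s clU in \<open>simp_all add: Q_def\<close>, (simp_all add: f2_simps)?)
    ultimately show ?thesis by blast
  qed
  have coclawQ: "coclaw a b c" if "Q a" "Q b" "Q c" "a \<noteq> b" "a \<noteq> c" "b \<noteq> c" "a + b + c \<in> E" for a b c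
    using that TQ [of a b] TQ [of a c] TQ [of b c] by (auto simp: coclaw_def Q_def)
  have star: "(\<forall>v\<in>hull3 a b c. w + v \<notin> E) \<or> (\<forall>v\<in>hull3 a b c. w + v \<in> E \<longleftrightarrow> v \<in> E) \<or>
      (\<forall>v\<in>hull3 a b c. w + a + v \<in> E \<longleftrightarrow> v \<in> E)"
    if w: "w \<in> U" "w \<notin> H" "w \<notin> E" "w + a \<notin> E" and abc: "Q a" "Q b" "Q c" "a \<noteq> b" "a \<noteq> c" "b \<noteq> c"
      and s: "a + b + c \<in> E" for w a b c
  proof -
    let ?K = "hull3 a b c"
    have cc: "coclaw a b c" using coclawQ abc s by blast
    have K: "indecomposable ?K" using cc by (rule coclaw_hull3)
    have KH: "?K \<subseteq> H" using abc sH by (intro hull3_least) (auto simp: Q_def)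
    have sK: "subspace ?K" and aK: "a \<in> ?K" by (auto simp: hull3_props)
    have "\<not> cotriangle_free (adjoin w ?K)"
    proof -
      have "w \<in> adjoin w ?K" using sK by (rule mem_adjoin)
      moreover have "a \<in> adjoin w ?K" using aK subset_adjoin by blast
      moreover have "w \<noteq> 0" "w \<noteq> a" using w abc sH by (auto simp: Q_def subspaceD)
      ultimately show ?thesis using w abc unfolding cotriangle_free_def Q_def by blast
    qed
    then have "\<not> indecomposable (adjoin w ?K)" using no cc w abc by (auto simp: Q_def)
    then have "(\<forall>u\<in>?K. w + u \<in> E \<longleftrightarrow> w \<in> E) \<or> (\<exists>k\<in>?K. clone ?K (w + k))"
      using w KH by (intro clone_or_constant [OF K]) auto
    then show ?thesis
    proof
      assume "\<exists>k\<in>?K. clone ?K (w + k)"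
      then obtain k where k: "k \<in> ?K" "clone ?K (w + k)" by blast
      have val: "w + k + v \<in> E \<longleftrightarrow> v \<in> E" if "v \<in> ?K" "v \<noteq> 0" for v using cloneD [OF k(2) that] .
      have kE: "k \<notin> E" using val [OF k(1)] w by (cases "k = 0") (auto simp: add.assoc)
      have kaE: "k + a \<notin> E"
      proof (cases "k + a = 0")
        case False
        have "k + a \<in> ?K" using k aK sK by (auto simp: subspaceD)
        moreover have "w + k + (k + a) = w + a" by (simp add: f2_simps)
        ultimately show ?thesis using val False w by metis
      qed simp
      have "k \<in> {0, a}" using k(1) kE kaE cc by (auto simp: hull3_iff coclaw_def f2_simps)
      moreover have "w + k \<notin> E" using w \<open>k \<in> {0, a}\<close> by auto
      then have "w + k + v \<in> E \<longleftrightarrow> v \<in> E" if "v \<in> ?K" for v using val that by (cases "v = 0") auto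
      ultimately show ?thesis by auto
    qed (use w in auto)
  qed
  have label: False if w: "w \<in> U" "w \<notin> H" "w \<notin> E" "w + a \<notin> E" and abc: "Q a" "Q b" "Q c" "a \<noteq> b" "a \<noteq> c"
      and l: "w + b \<notin> E" "w + a + b \<in> E" "w + c \<in> E" "w + a + c \<notin> E" for w a b c
  proof -
    have bc: "b \<noteq> c" using l by auto
    have abE: "a + b \<in> E" using TQ abc by blast
    have cE: "a + b \<noteq> c" using abE abc by (auto simp: Q_def)
    show False
    proof (cases "a + b + c \<in> E")
      case True
      then show False using star [OF w abc bc] l abE TQ [OF abc(1,3,5)] abc
        by (auto simp: hull3_iff Q_def)
    next
      case False
      define d where "d = a + b + c"
      have d: "Q d" using False cE abc clH by (auto simp: d_def Q_def sum_zero_iff)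
      have dn: "d \<noteq> a" "d \<noteq> b" "d \<noteq> c" using bc abc(4,5) by (auto simp: d_def add.assoc sum_zero_iff)
      have 1: "w + d \<in> E"
        using edge [OF w(1-3) _ d abc(3)] dn l by (auto simp: d_def f2_simps)
      have wa: "w + a \<in> U" "w + a \<notin> H" using shift w abc by (auto simp: Q_def)
      have 2: "w + b + c \<in> E"
        using edge [OF wa w(4) _ d abc(2)] dn l by (auto simp: d_def f2_simps)
      show False using edge [OF w(1-3) l(1) abc(2,3) bc] l 2 by auto
    qed
  qed
  \<comment> \<open>By \<open>edge\<close> at most one of \<open>y + b\<close>,
    \<open>y + a + b\<close> lies in \<open>E\<close>, for \<open>b \<noteq> a\<close>; by
    \<open>label\<close> the exceptions all occur on the same side. So \<open>y\<close> or
    \<open>y + a\<close> serves as \<open>w\<close>.\<close>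
  obtain w where w: "w \<in> U" "w \<notin> H" "w \<notin> E" and wQ: "\<And>b. Q b \<Longrightarrow> w + b \<notin> E"
  proof (cases "\<forall>b. Q b \<longrightarrow> y + b \<notin> E")
    case True then show ?thesis using y that by blast
  next
    case False
    then obtain c where c: "Q c" "y + c \<in> E" by blast
    have ac: "a \<noteq> c" using c y by auto
    have c2: "y + a + c \<notin> E" using edge [OF y a c(1) ac] c by blast
    have "y + a + b \<notin> E" if b: "Q b" for b
    proof (cases "b = a")
      case True then show ?thesis using y by (simp add: add.assoc)
    next
      case False then show ?thesis using label [OF y a b c(1) _ ac _ _ c(2) c2] edge [OF y a b] by blast
    qed
    moreover have "y + a \<in> U" "y + a \<notin> H" using y a shift by (auto simp: Q_def)
    ultimately show ?thesis using that y by blast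
  qed
  text \<open>Colour a pair \<open>b, c\<close> of points of \<open>H\<close> outside \<open>E\<close> by whether \<open>w + b + c \<in> E\<close>. A graph or its
    complement is connected, so some colour class connects all these points.\<close>
  have same: "w + a + b \<in> E \<longleftrightarrow> w + b + c \<in> E"
    if abc: "Q a" "Q b" "Q c" "a \<noteq> b" "a \<noteq> c" "b \<noteq> c" and s: "a + b + c \<in> E" for a b c
  proof -
    have bc: "b + c \<in> E" "a + b \<in> E" using TQ abc by auto
    have "a + b \<in> hull3 a b c" "w + a + (a + b) = w + b" by (auto simp: hull3_iff f2_simps)
    then have n: "\<not> (\<forall>v\<in>hull3 a b c. w + a + v \<in> E \<longleftrightarrow> v \<in> E)"
      using bc(2) wQ [OF abc(2)] by metis
    have m: "a + b \<in> hull3 a b c" "b + c \<in> hull3 a b c" by (auto simp: hull3_iff)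
    from star [OF w wQ [OF abc(1)] abc s] n
    consider "\<forall>v\<in>hull3 a b c. w + v \<notin> E" | "\<forall>v\<in>hull3 a b c. w + v \<in> E \<longleftrightarrow> v \<in> E" by argo
    then have "w + (a + b) \<in> E \<longleftrightarrow> w + (b + c) \<in> E"
      by cases (use m bc in \<open>metis\<close>)+
    then show ?thesis by (simp only: add.assoc)
  qed
  have colour: "s + b \<in> E \<longleftrightarrow> s + c \<in> E"
    if s: "s \<in> H" "s \<in> E" "w + s \<in> E \<longleftrightarrow> p" and bc: "Q b" "Q c" "b \<noteq> c" "w + b + c \<in> E \<longleftrightarrow> \<not> p" for s b c p
  proof -
    have *: "s + c \<in> E" if bc: "Q b" "Q c" "b \<noteq> c" "w + b + c \<in> E \<longleftrightarrow> \<not> p" and sb: "s + b \<in> E" for b c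
    proof (rule ccontr)
      assume n: "s + c \<notin> E"
      define d where "d = s + c"
      have sd: "s = c + d" by (simp add: d_def f2_simps)
      have "s \<noteq> c" using s bc by (auto simp: Q_def)
      then have d: "Q d" using n s bc clH by (auto simp: d_def Q_def sum_zero_iff)
      have ne: "b \<noteq> d" "c \<noteq> d"
        using s bc unfolding sd by (auto simp: f2_simps)
      have e: "b + c + d = s + b" by (simp add: d_def f2_simps)
      have "w + b + c \<in> E \<longleftrightarrow> w + c + d \<in> E"
        by (rule same [OF bc(1,2) d bc(3) ne]) (simp only: e sb)
      then show False using bc s(3) unfolding sd by (simp add: add.assoc)
    qed
    show ?thesis using * [OF bc] * [OF bc(2,1) bc(3) [symmetric]] bc(4) by (auto simp: f2_simps)
  qed
  have period: False if s: "s \<in> H" "s \<noteq> 0" and p: "\<And>b. Q b \<Longrightarrow> s + b \<notin> E" for s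
  proof -
    obtain u where u: "u \<in> H" "u \<noteq> 0" "u \<noteq> s" "u \<in> E" "u + s \<notin> E" using exists_mixed_pair [OF H(1) s] .
    then have "Q (u + s)" using s clH by (auto simp: Q_def sum_zero_iff)
    then have "s + (u + s) \<notin> E" by (rule p)
    then show False using u by (simp add: f2_simps)
  qed
  have spanQ: "span (Collect Q) = H"
  proof (rule ccontr)
    assume n: "span (Collect Q) \<noteq> H"
    have sub: "span (Collect Q) \<subseteq> H" by (rule span_minimal) (auto simp: Q_def sH)
    have aQ: "a \<in> span (Collect Q)" using a by (simp add: span_base)
    have *: "u \<in> E" if "u \<in> H" "u \<notin> span (Collect Q)" for u
      using that span_base [of u "Collect Q"] span_zero by (auto simp: Q_def)
    have "u + v \<in> E \<longleftrightarrow> u \<in> E" if "u \<in> H - span (Collect Q)" "v \<in> span (Collect Q)" for u v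
      using * [of u] * [of "u + v"] that sub clH subspaceD(4) [OF subspace_span that(2), of u] by auto
    moreover have "span (Collect Q) \<noteq> {0}" using aQ a by (auto simp: Q_def)
    ultimately have "summand H (span (Collect Q))" unfolding summand_def using n sub by auto
    then show False using H(1) indecomposableD by blast
  qed
  \<comment> \<open>If membership of \<open>s + b\<close> does not depend on \<open>b\<close>, then
    \<open>period\<close> puts all \<open>s + b\<close> into \<open>E\<close>. The points of colour
    \<open>p\<close> become invariant under \<open>span (Collect Q) = H\<close>, and
    \<open>s + s = 0\<close> would be one of them.\<close>
  have empty: "\<not> (s \<in> H \<and> s \<in> E \<and> (w + s \<in> E \<longleftrightarrow> p))"
    if all: "\<And>s b c. \<lbrakk>s \<in> H; s \<in> E; w + s \<in> E \<longleftrightarrow> p; Q b; Q c\<rbrakk> \<Longrightarrow> s + b \<in> E \<longleftrightarrow> s + c \<in> E" for s p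
  proof
    assume s: "s \<in> H \<and> s \<in> E \<and> (w + s \<in> E \<longleftrightarrow> p)"
    let ?S = "{s. s \<in> H \<and> s \<in> E \<and> (w + s \<in> E \<longleftrightarrow> p)}"
    have step: "v + b \<in> ?S" if v: "v \<in> ?S" and b: "b \<in> Collect Q" for v b
    proof -
      have "v \<noteq> 0" using v by auto
      then have "v + b \<in> E" using period [of v] all [of v] v b by blast
      moreover have "w + v \<in> E \<longleftrightarrow> w + v + b \<in> E"
        using v b calculation by (intro parallel w wQ) auto
      ultimately show ?thesis using v b clH by (auto simp: Q_def add.assoc)
    qed
    have "s \<in> span (Collect Q)" using s spanQ by simp
    then have "s + s \<in> ?S" by (rule span_translation_closed [OF _ step]) (use s in auto)
    then show False by simp
  qed
  have "(\<forall>s b c. s \<in> H \<longrightarrow> s \<in> E \<longrightarrow> w + s \<in> E \<longrightarrow> Q b \<longrightarrow> Q c \<longrightarrow> (s + b \<in> E \<longleftrightarrow> s + c \<in> E)) \<or>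
     (\<forall>s b c. s \<in> H \<longrightarrow> s \<in> E \<longrightarrow> w + s \<notin> E \<longrightarrow> Q b \<longrightarrow> Q c \<longrightarrow> (s + b \<in> E \<longleftrightarrow> s + c \<in> E))"
  proof (rule ccontr)
    assume "\<not> ?thesis"
    then obtain s b c s' b' c' where s: "s \<in> H" "s \<in> E" "w + s \<in> E" "Q b" "Q c" "s + b \<in> E" "s + c \<notin> E"
      and s': "s' \<in> H" "s' \<in> E" "w + s' \<notin> E" "Q b'" "Q c'" "s' + b' \<in> E" "s' + c' \<notin> E"
      by (smt (verit))
    \<comment> \<open>All pairs across the cut that \<open>s\<close> makes in the points of
      \<open>Q\<close> have the colour of \<open>s\<close>. They connect all these points, so
      \<open>s'\<close>, of the other colour, cannot distinguish any two of them.\<close>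
    have cross: "w + p + q \<in> E" if "Q p" "Q q" "s + p \<in> E" "s + q \<notin> E" for p q
      using colour [of s True p q] s that by (cases "p = q") auto
    have eq: "s' + p \<in> E \<longleftrightarrow> s' + q \<in> E" if "Q p" "Q q" "s + p \<in> E" "s + q \<notin> E" for p q
      using colour [of s' False p q] s' that cross [OF that] by (cases "p = q") auto
    have "s' + p \<in> E \<longleftrightarrow> s' + b \<in> E" if "Q p" for p
      using eq [of b c] eq [of p c] eq [of b p] s that by (cases "s + p \<in> E") auto
    then show False using s' by blast
  qed
  then show False
  proof
    assume "\<forall>s b c. s \<in> H \<longrightarrow> s \<in> E \<longrightarrow> w + s \<in> E \<longrightarrow> Q b \<longrightarrow> Q c \<longrightarrow> (s + b \<in> E \<longleftrightarrow> s + c \<in> E)"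
    then have *: "w + s \<notin> E" if "s \<in> H" "s \<in> E" for s using empty [of True s] that by blast
    have zero: "w + u \<notin> E" if "u \<in> H" for u
      using * [OF that] wQ [of u] w that by (cases "u = 0") (auto simp: Q_def)
    have out: "v \<notin> E" if v: "v \<in> U" "v \<notin> H" for v
      using zero [OF two [OF w(1) v(1) w(2) v(2)]] by simp
    have "v + u \<in> E \<longleftrightarrow> v \<in> E" if "v \<in> U - H" "u \<in> H" for v u
      using out [of v] out [of "v + u"] shift [of v u] that by auto
    moreover have "H \<noteq> {0}" "H \<noteq> U" using H(1) w by (auto simp: indecomposable_def)
    ultimately have "summand U H" unfolding summand_def using sH HU by blast
    then show False using U(2) indecomposableD by blast
  next
    assume "\<forall>s b c. s \<in> H \<longrightarrow> s \<in> E \<longrightarrow> w + s \<notin> E \<longrightarrow> Q b \<longrightarrow> Q c \<longrightarrow> (s + b \<in> E \<longleftrightarrow> s + c \<in> E)"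
    then have *: "w + s \<in> E" if "s \<in> H" "s \<in> E" for s using empty [of False s] that by blast
    have val: "w + u \<in> E \<longleftrightarrow> u \<in> E" if "u \<in> H" for u
      using * [OF that] wQ [of u] w that by (cases "u = 0") (auto simp: Q_def)
    have "v + u \<in> E \<longleftrightarrow> v \<in> E" if v: "v \<in> U - {0, w}" and u: "u \<in> {0, w}" for v u
    proof (cases "v \<in> H")
      case True then show ?thesis using val u by (auto simp: add.commute)
    next
      case False
      then have "w + v \<in> H" using two w v by blast
      from val [OF this] have "v + w \<in> E \<longleftrightarrow> v \<in> E" by (simp add: add.commute [of v])
      then show ?thesis using u by auto
    qed
    moreover have "w \<noteq> 0" using w sH by (auto simp: subspaceD)
    moreover have "{0, w} \<noteq> U" using U(2) by (auto simp: indecomposable_def)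
    ultimately have "summand U {0, w}" unfolding summand_def using w sU subspace_pair by (auto simp: subspaceD)
    then show False using U(2) indecomposableD by blast
  qed
qed

section \<open>Extensions of even-plane matroids\<close>

lemma polar_sym: "polar a b \<longleftrightarrow> polar b a"
  unfolding polar_def by (simp add: add.commute) blast

lemma polar_self [simp]: "\<not> polar a a" "\<not> polar a 0" "\<not> polar 0 a"
  by (simp_all add: polar_def)

lemma E_sum: "a + b \<in> E \<longleftrightarrow> (polar a b \<noteq> ((a \<in> E) \<noteq> (b \<in> E)))"
  unfolding polar_def by blast

text \<open>The seven nonzero points of the span of \<open>w, a, b\<close> contain an odd number of points of \<open>E\<close>
  (for independent \<open>w, a, b\<close>).\<close>

definition odd_coset :: "'a \<Rightarrow> 'a \<Rightarrow> 'a \<Rightarrow> bool" where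
  "odd_coset w a b \<longleftrightarrow> (polar a b \<noteq> ((w \<in> E) \<noteq> ((w + a \<in> E) \<noteq> ((w + b \<in> E) \<noteq> (w + a + b \<in> E)))))"

text \<open>The right side is the defect of additivity of \<open>polar w\<close>, so
  \<open>quadratic\<close> means that \<open>odd_coset\<close> never holds. Expanded, it is a parity
  over the seven sums, whence its symmetry.\<close>

lemma odd_coset_iff: "odd_coset w a b \<longleftrightarrow> (polar w (a + b) \<noteq> (polar w a \<noteq> polar w b))"
  unfolding odd_coset_def polar_def by (simp add: add.assoc) blast

lemma odd_coset_perm: "odd_coset w a b \<longleftrightarrow> odd_coset w b a" "odd_coset w a b \<longleftrightarrow> odd_coset a w b"
  "odd_coset w a b \<longleftrightarrow> odd_coset w (w + a) b"
proof -
  have e: "b + a = a + b" "w + b + a = w + a + b" "a + w = w + a" "w + (w + a) = a" "a + b + w = w + a + b"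
    "w + (w + a) + b = a + b" "w + a + b + w = a + b" "a + w + b = w + a + b" "b + w = w + b"
    by (simp_all add: f2_simps)
  show "odd_coset w a b \<longleftrightarrow> odd_coset w b a" "odd_coset w a b \<longleftrightarrow> odd_coset a w b"
    "odd_coset w a b \<longleftrightarrow> odd_coset w (w + a) b"
    unfolding odd_coset_def polar_def e by auto
qed

text \<open>Membership depends only on the component in \<open>K\<close>; the case
  \<open>u = 0\<close> says that \<open>p\<close> itself is outside \<open>E\<close>.\<close>

lemma quadratic_adjoin_clone:
  assumes K: "subspace K" "quadratic K" and p: "\<And>u. u \<in> K \<Longrightarrow> p + u \<in> E \<longleftrightarrow> u \<in> E"
  shows "quadratic (adjoin p K)"
proof -
  define r where "r i u = (if i then p + u else u)" for i :: bool and u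
  have rE: "r i u \<in> E \<longleftrightarrow> u \<in> E" if "u \<in> K" for i u using p that by (simp add: r_def)
  have sum: "r i u + r j v = r (i \<noteq> j) (u + v)" for i j u v
    by (cases i; cases j; simp add: r_def f2_simps)
  have cl: "u + v \<in> K" if "u \<in> K" "v \<in> K" for u v using K(1) that by (rule subspaceD)
  have pol: "polar (r i u) (r j v) \<longleftrightarrow> polar u v" if "u \<in> K" "v \<in> K" for i j u v
    using that cl by (simp add: polar_def sum rE)
  have rep: "\<exists>i. \<exists>u\<in>K. v = r i u" if "v \<in> adjoin p K" for v
    using that by (cases rule: adjoinE) (auto simp: r_def)
  show ?thesis
    unfolding quadratic_def
  proof (intro ballI)
    fix a b c assume "a \<in> adjoin p K" "b \<in> adjoin p K" "c \<in> adjoin p K"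
    then obtain i u j v k w where "u \<in> K" "v \<in> K" "w \<in> K" and abc: "a = r i u" "b = r j v" "c = r k w"
      using rep by metis
    then show "polar a (b + c) = (polar a b \<noteq> polar a c)"
      unfolding abc sum using K(2) cl by (simp add: pol quadratic_def)
  qed
qed

lemma adjoin_translate: "subspace K \<Longrightarrow> k \<in> K \<Longrightarrow> adjoin (w + k) K = adjoin w K"
  by (auto simp: adjoin_iff) (metis add.commute add.left_commute subspaceD(4))+

lemma quadratic_subset: "quadratic U \<Longrightarrow> K \<subseteq> U \<Longrightarrow> quadratic K"
  unfolding quadratic_def by (meson subsetD)

end

text \<open>On \<open>H\<close> the indicator of \<open>E\<close> is a quadratic form with polar
  form \<open>polar\<close>, so perpendicularity, radicals and projections are available there. The
  assumption \<open>no_exit\<close> denies the four-dimensional witness that is sought.\<close>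

locale quadratic_hyperplane = f2_points +
  fixes U H :: "'a set" and x :: 'a
  assumes U: "subspace U" and H: "indecomposable H" "quadratic H" "finite H" "8 < card H"
    and x: "x \<notin> H" "U = adjoin x H"
    and no_exit: "\<And>a b c w. \<lbrakk>a \<in> H; b \<in> H; c \<in> H; w \<in> U; w \<notin> H; coclaw a b c;
      indecomposable (adjoin w (hull3 a b c))\<rbrakk> \<Longrightarrow> quadratic (adjoin w (hull3 a b c))"
begin

lemma sH: "subspace H"
  using H(1) by (rule indecomposableD)

lemma H_closed [simp]: "0 \<in> H" "u \<in> H \<Longrightarrow> v \<in> H \<Longrightarrow> u + v \<in> H"
  using sH by (auto simp: subspaceD)

lemma H_subset: "H \<subseteq> U"
  unfolding x by (rule subset_adjoin)

lemma outside_sum: "u \<in> U \<Longrightarrow> v \<in> U \<Longrightarrow> u \<notin> H \<Longrightarrow> v \<notin> H \<Longrightarrow> u + v \<in> H"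
proof -
  assume "u \<in> U" "v \<in> U" "u \<notin> H" "v \<notin> H"
  then have "x + u \<in> H" "x + v \<in> H" using x by (auto simp: adjoin_iff)
  then have "x + u + (x + v) \<in> H" by (rule H_closed)
  then show ?thesis by (simp add: f2_simps)
qed

lemma outside_shift: assumes "w \<in> U" "w \<notin> H" "u \<in> H" shows "w + u \<in> U" "w + u \<notin> H"
  using assms H_subset U subspaceD(4) [OF sH assms(3)] by (auto simp: subspaceD)

lemma polar_add:
  assumes "a \<in> H" "b \<in> H" "c \<in> H"
  shows "polar a (b + c) \<longleftrightarrow> polar a b \<noteq> polar a c" "polar (b + c) a \<longleftrightarrow> polar b a \<noteq> polar c a"
proof -
  show *: "polar a (b + c) \<longleftrightarrow> polar a b \<noteq> polar a c" using H(2) assms by (simp add: quadratic_def)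
  then show "polar (b + c) a \<longleftrightarrow> polar b a \<noteq> polar c a" by (metis polar_sym)
qed

definition radical :: "'a \<Rightarrow> bool" where
  "radical v \<longleftrightarrow> (\<forall>t\<in>H. \<not> polar v t)"

text \<open>Translation by a radical vector outside \<open>E\<close> would preserve membership, so
  \<open>{0, v}\<close> would be a summand.\<close>

lemma radical_in_E: assumes "v \<in> H" "v \<noteq> 0" "radical v" shows "v \<in> E"
proof (rule ccontr)
  assume "v \<notin> E"
  obtain u where "u \<in> H" "u \<in> E" "u + v \<notin> E" using exists_mixed_pair [OF H(1) assms(1,2)] by metis
  then have "polar v u" using \<open>v \<notin> E\<close> by (simp add: polar_def add.commute)
  then show False using assms \<open>u \<in> H\<close> by (simp add: radical_def)
qed

text \<open>The form is additive on the radical, so two distinct nonzero radical vectors, both in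
  \<open>E\<close>, would have a nonzero radical sum outside \<open>E\<close>.\<close>

lemma radical_unique: assumes "u \<in> H" "v \<in> H" "u \<noteq> 0" "v \<noteq> 0" "radical u" "radical v" shows "u = v"
proof (rule ccontr)
  assume "u \<noteq> v"
  then have "u + v \<noteq> 0" by (simp add: sum_zero_iff)
  moreover have "radical (u + v)" using assms by (simp add: radical_def polar_add)
  ultimately have "u + v \<in> E" using assms by (intro radical_in_E) auto
  then show False using assms radical_in_E [of u] radical_in_E [of v] by (simp add: E_sum radical_def)
qed

text \<open>For \<open>polar a b\<close> this is the orthogonal projection onto the vectors
  perpendicular to \<open>a\<close> and \<open>b\<close>.\<close>

definition proj :: "'a \<Rightarrow> 'a \<Rightarrow> 'a \<Rightarrow> 'a" where
  "proj a b h = h + ((if polar h b then a else 0) + (if polar h a then b else 0))"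

lemma proj:
  assumes "a \<in> H" "b \<in> H" "h \<in> H" "polar a b"
  shows "proj a b h \<in> H" "\<not> polar a (proj a b h)" "\<not> polar b (proj a b h)"
    "h + proj a b h \<in> {0, a, b, a + b}"
  using assms polar_sym [of h] polar_sym [of b a] by (auto simp: proj_def polar_add)

text \<open>Being outside \<open>E\<close>, \<open>m\<close> is not radical, so some
  \<open>t\<close> is not perpendicular to it. Projecting \<open>t\<close> preserves this, and
  adding \<open>m\<close> corrects the value if necessary.\<close>

lemma exists_E_perp:
  assumes a: "a \<in> H" "b \<in> H" "polar a b" and m: "m \<in> H" "m \<notin> E" "m \<noteq> 0" "\<not> polar a m" "\<not> polar b m"
  obtains r where "r \<in> H" "\<not> polar a r" "\<not> polar b r" "r \<in> E" "polar m r"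
proof -
  obtain t where t: "t \<in> H" "polar m t" using radical_in_E m by (auto simp: radical_def)
  have P: "proj a b t \<in> H" "\<not> polar a (proj a b t)" "\<not> polar b (proj a b t)" using proj a t by auto
  have mp: "polar m (proj a b t)"
    using t a m polar_sym [of m] by (auto simp: proj_def polar_add)
  show thesis
  proof (cases "proj a b t \<in> E")
    case True then show ?thesis using P mp that by blast
  next
    case False
    have "proj a b t + m \<in> E" using False m mp by (simp add: E_sum polar_sym [of _ m])
    then show ?thesis using that [of "proj a b t + m"] P m a mp by (auto simp: polar_add)
  qed
qed

lemma exists_outside_hull3:
  obtains h where "h \<in> H" "h \<notin> hull3 a b c"
proof -
  have "\<not> H \<subseteq> hull3 a b c"
    using H(4) card_mono [OF card_hull3(1), of H a b c] card_hull3(2) [of a b c] by linarith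
  then show thesis using that by blast
qed

text \<open>More than eight points leave some \<open>h\<close> outside \<open>hull3 a b v\<close>.
  Its projection differs from \<open>h\<close> by a combination of \<open>a\<close> and
  \<open>b\<close>, so it is neither 0 nor \<open>v\<close>.\<close>

lemma exists_perp_avoiding:
  assumes a: "a \<in> H" "b \<in> H" "polar a b"
  obtains m where "m \<in> H" "\<not> polar a m" "\<not> polar b m" "m \<noteq> 0" "m \<noteq> v"
proof -
  obtain h where h: "h \<in> H" "h \<notin> hull3 a b v" by (rule exists_outside_hull3)
  define q where "q = h + proj a b h"
  have hq: "h = proj a b h + q" by (simp add: q_def f2_simps)
  have q: "q \<in> {0, a, b, a + b}" using proj(4) [OF a(1,2) h(1) a(3)] by (simp add: q_def)
  have "proj a b h \<noteq> 0"
  proof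
    assume "proj a b h = 0"
    then have "h = q" using hq by simp
    then show False using q h(2) by (auto simp: hull3_iff)
  qed
  moreover have "proj a b h \<noteq> v"
  proof
    assume "proj a b h = v"
    then have "h = v + q" using hq by simp
    then show False using q h(2) by (auto simp: hull3_iff f2_simps)
  qed
  ultimately have "proj a b h \<noteq> 0" "proj a b h \<noteq> v" by auto
  then show thesis using that proj [OF a(1,2) h(1) a(3)] by blast
qed

lemma exists_E_perp_pair: 
  assumes a: "a \<in> H" "b \<in> H" "polar a b"
  obtains r where "r \<in> H" "\<not> polar a r" "\<not> polar b r" "r \<in> E"
proof -
  obtain m where m: "m \<in> H" "\<not> polar a m" "\<not> polar b m" "m \<noteq> 0" using exists_perp_avoiding [OF a] by metis
  show thesis
  proof (cases "m \<in> E")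
    case True then show ?thesis using m that by blast
  next
    case False then show ?thesis using exists_E_perp [OF a m(1) False m(4,2,3)] that by blast
  qed
qed

lemma hull3_subset: "a \<in> H \<Longrightarrow> b \<in> H \<Longrightarrow> c \<in> H \<Longrightarrow> hull3 a b c \<subseteq> H"
  by (intro hull3_least sH)

lemma hull3_eqI:
  assumes "a' \<in> hull3 a b c" "b' \<in> hull3 a b c" "c' \<in> hull3 a b c"
    "a \<in> hull3 a' b' c'" "b \<in> hull3 a' b' c'" "c \<in> hull3 a' b' c'"
  shows "hull3 a' b' c' = hull3 a b c"
  by (intro equalityI hull3_least hull3_props assms)

text \<open>The form on \<open>hull3 a b r\<close> has a radical vector \<open>r\<close> of value 1,
  and adding \<open>r\<close> changes the value of \<open>a\<close> or \<open>b\<close>. All such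
  forms are equivalent to that of a complement of a claw; the four cases write down the
  basis.\<close>

lemma exists_coclaw_basis:
  assumes "a \<in> H" "b \<in> H" "r \<in> H" "polar a b" "\<not> polar a r" "\<not> polar b r" "r \<in> E"
  obtains a' b' c' where "a' \<in> H" "b' \<in> H" "c' \<in> H" "coclaw a' b' c'" "hull3 a' b' c' = hull3 a b r"
proof -
  have ab: "a + b \<in> E \<longleftrightarrow> \<not> ((a \<in> E) \<noteq> (b \<in> E))" "a + r \<in> E \<longleftrightarrow> a \<notin> E" "b + r \<in> E \<longleftrightarrow> b \<notin> E"
    using assms by (auto simp: E_sum)
  have abr: "a + b + r \<in> E \<longleftrightarrow> a + b \<notin> E"
    using assms E_sum [of "a + b" r] by (simp add: polar_add)
  consider "a \<notin> E" "b \<notin> E" | "a \<in> E" "b \<notin> E" | "a \<notin> E" "b \<in> E" | "a \<in> E" "b \<in> E" by blast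
  then show thesis
  proof cases
    case 1
    show ?thesis
    proof (rule that [of a b "a + b + r"])
      show "coclaw a b (a + b + r)" using 1 ab abr assms by (simp add: coclaw_def f2_simps)
      show "hull3 a b (a + b + r) = hull3 a b r" by (rule hull3_eqI; simp add: hull3_iff f2_simps)
    qed (use assms in auto)
  next
    case 2
    show ?thesis
    proof (rule that [of "a + b" b "a + r"])
      show "coclaw (a + b) b (a + r)" using 2 ab abr assms by (simp add: coclaw_def f2_simps)
      show "hull3 (a + b) b (a + r) = hull3 a b r" by (rule hull3_eqI; simp add: hull3_iff f2_simps)
    qed (use assms in auto)
  next
    case 3
    show ?thesis
    proof (rule that [of a "a + b" "b + r"])
      show "coclaw a (a + b) (b + r)" using 3 ab abr assms by (simp add: coclaw_def f2_simps)
      show "hull3 a (a + b) (b + r) = hull3 a b r" by (rule hull3_eqI; simp add: hull3_iff f2_simps)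
    qed (use assms in auto)
  next
    case 4
    show ?thesis
    proof (rule that [of "a + r" "b + r" "a + b + r"])
      show "coclaw (a + r) (b + r) (a + b + r)" using 4 ab abr assms by (simp add: coclaw_def f2_simps)
      show "hull3 (a + r) (b + r) (a + b + r) = hull3 a b r" by (rule hull3_eqI; simp add: hull3_iff f2_simps)
    qed (use assms in auto)
  qed
qed

text \<open>A clone inside \<open>E\<close>. A clone outside \<open>E\<close> would extend the
  quadratic form on \<open>K\<close>, so only the value at \<open>p\<close> itself is wrong.\<close>

definition special :: "'a \<Rightarrow> 'a set \<Rightarrow> bool" where
  "special p K \<longleftrightarrow> p \<in> U \<and> p \<notin> H \<and> p \<in> E \<and> (\<forall>u\<in>K. u \<noteq> 0 \<longrightarrow> (p + u \<in> E \<longleftrightarrow> u \<in> E))"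

text \<open>The odd triple makes the extension by \<open>w\<close> nonquadratic, so by
  \<open>no_exit\<close> it decomposes and \<open>clone_or_constant\<close> applies. A clone outside
  \<open>E\<close> would make the extension quadratic after all.\<close>

lemma constant_or_special:
  assumes T: "a \<in> H" "b \<in> H" "r \<in> H" "polar a b" "\<not> polar a r" "\<not> polar b r" "r \<in> E"
    and w: "w \<in> U" "w \<notin> H" and o: "c \<in> hull3 a b r" "d \<in> hull3 a b r" "odd_coset w c d"
  shows "(\<forall>u\<in>hull3 a b r. w + u \<in> E \<longleftrightarrow> w \<in> E) \<or> (\<exists>k\<in>hull3 a b r. special (w + k) (hull3 a b r))"
proof -
  let ?K = "hull3 a b r"
  have sK: "subspace ?K" by (rule hull3_props)
  have KH: "?K \<subseteq> H" using T by (intro hull3_subset)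
  have qK: "quadratic ?K" using H(2) KH by (rule quadratic_subset)
  obtain a' b' c' where abc: "a' \<in> H" "b' \<in> H" "c' \<in> H" "coclaw a' b' c'" "hull3 a' b' c' = ?K"
    by (rule exists_coclaw_basis [OF T])
  have K: "indecomposable ?K" using coclaw_hull3 [OF abc(4)] abc(5) by simp
  have nq: "\<not> quadratic (adjoin w ?K)"
  proof
    assume "quadratic (adjoin w ?K)"
    moreover have "w \<in> adjoin w ?K" "c \<in> adjoin w ?K" "d \<in> adjoin w ?K"
      using mem_adjoin [OF sK] o subset_adjoin by blast+
    ultimately show False using o(3) by (auto simp: odd_coset_iff quadratic_def)
  qed
  then have "\<not> indecomposable (adjoin w ?K)" using no_exit [OF abc(1-3) w abc(4)] abc(5) by auto
  moreover have "w \<notin> ?K" using w KH by auto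
  ultimately have "(\<forall>u\<in>?K. w + u \<in> E \<longleftrightarrow> w \<in> E) \<or> (\<exists>k\<in>?K. clone ?K (w + k))"
    by (intro clone_or_constant [OF K])
  then show ?thesis
  proof
    assume "\<exists>k\<in>?K. clone ?K (w + k)"
    then obtain k where k: "k \<in> ?K" "clone ?K (w + k)" by blast
    have "w + k \<in> E"
    proof (rule ccontr)
      assume n: "w + k \<notin> E"
      have "quadratic (adjoin (w + k) ?K)"
      proof (rule quadratic_adjoin_clone [OF sK qK])
        show "w + k + u \<in> E \<longleftrightarrow> u \<in> E" if "u \<in> ?K" for u
          using cloneD [OF k(2) that] n by (cases "u = 0") auto
      qed
      then show False using nq adjoin_translate [OF sK k(1)] by simp
    qed
    then have "special (w + k) ?K"
      using k cloneD [OF k(2)] outside_shift [OF w, of k] KH by (auto simp: special_def)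
    then show ?thesis using k by blast
  qed blast
qed

text \<open>Replacing \<open>r\<close> by \<open>a + r\<close> if necessary makes it perpendicular
  to \<open>b\<close> without changing the span, so the dichotomy applies. The known values at
  \<open>a\<close>, \<open>r\<close> and \<open>a + r\<close> exclude a constant coset and force the
  clone to be \<open>p\<close> itself (\<open>k = 0\<close>).\<close>

lemma special_spread:
  assumes p: "p \<in> U" "p \<notin> H" "p \<in> E" and ar: "a \<in> H" "r \<in> H" "a \<notin> E" "r \<in> E" "\<not> polar a r"
    and v: "p + a \<notin> E" "p + r \<in> E" "p + (a + r) \<in> E" and b: "b \<in> H" "polar a b"
  shows "special p (hull3 a b r)"
proof -
  define s where "s = (if polar b r then a + r else r)"
  have s: "s \<in> H" "\<not> polar a s" "\<not> polar b s" "s \<in> E"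
    using ar b polar_sym [of b a] by (auto simp: s_def polar_add E_sum)
  have K: "hull3 a b s = hull3 a b r"
    by (rule hull3_eqI) (auto simp: hull3_iff s_def f2_simps)
  have "odd_coset p a r" using p ar v by (simp add: odd_coset_def add.assoc)
  then have "(\<forall>u\<in>hull3 a b r. p + u \<in> E \<longleftrightarrow> p \<in> E) \<or> (\<exists>k\<in>hull3 a b r. special (p + k) (hull3 a b r))"
    using constant_or_special [OF ar(1) b(1) s(1) b(2) s(2-4) p(1,2), of a r] unfolding K
    by (auto simp: hull3_props)
  moreover have "a \<in> hull3 a b r" by (rule hull3_props)
  ultimately obtain k where k: "k \<in> hull3 a b r" "special (p + k) (hull3 a b r)" using p v by blast
  have kH: "k \<in> H" using k hull3_subset ar b by blast
  have val: "p + u \<in> E \<longleftrightarrow> k + u \<in> E" if "u \<in> hull3 a b r" "u \<noteq> k" for u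
  proof -
    have "k + u \<in> hull3 a b r" "k + u \<noteq> 0"
      using k that subspaceD(2) [OF hull3_props(1)] by (auto simp: sum_zero_iff)
    then have "p + k + (k + u) \<in> E \<longleftrightarrow> k + u \<in> E" using k(2) by (simp add: special_def)
    then show ?thesis by (simp add: add.assoc)
  qed
  have "k = 0"
  proof (rule ccontr)
    assume "k \<noteq> 0"
    then have kE: "k \<in> E" using val [of 0] p by (simp add: hull3_props)
    have "k + a \<notin> E" using val [of a] v kE ar by (auto simp: hull3_props)
    then have ka: "polar k a" using kE ar by (simp add: E_sum)
    then have ne: "k \<noteq> r" "k \<noteq> a + r" using ar polar_sym [of a r] by (auto simp: polar_add)
    have "a + r \<in> hull3 a b r" by (simp add: hull3_iff)
    then have "k + r \<in> E" "k + (a + r) \<in> E" using val [of r] val [of "a + r"] ne v by (auto simp: hull3_props)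
    then show False using kE ka ar kH E_sum [of a r] by (simp add: E_sum polar_add)
  qed
  then show ?thesis using k by simp
qed

text \<open>In the span of \<open>a, b, c\<close> the vector \<open>r = a + b + c\<close> is
  radical, so \<open>special_spread\<close> reaches every \<open>v\<close> not perpendicular to all
  of \<open>a, b, c\<close>. Any other nonradical \<open>v\<close> is reached in two stages, through
  a point \<open>u\<close> perpendicular to neither \<open>a\<close> nor \<open>v\<close>.\<close>

lemma special_spread_nonradical:
  assumes abc: "a \<in> H" "b \<in> H" "c \<in> H" "coclaw a b c" and p: "special p (hull3 a b c)"
    and v: "v \<in> H" "\<not> radical v"
  shows "p + v \<in> E \<longleftrightarrow> v \<in> E"
proof -
  have pU: "p \<in> U" "p \<notin> H" "p \<in> E" using p by (auto simp: special_def)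
  have v0: "v \<noteq> 0" using v by (auto simp: radical_def)
  have out: "a \<notin> E" "b \<notin> E" "c \<notin> E" and pol: "polar a b" "polar a c" "polar b c"
    using abc(4) by (auto simp: coclaw_def polar_def)
  define r where "r = a + b + c"
  have r: "r \<in> H" "r \<in> E" using abc by (auto simp: r_def coclaw_def)
  have rp: "\<not> polar a r" "\<not> polar b r" "\<not> polar c r"
    using pol abc polar_sym [of b a] polar_sym [of c] by (auto simp: r_def polar_add)
  have rE: "a + r \<in> E" "b + r \<in> E" "c + r \<in> E" using rp r out by (auto simp: E_sum)
  have rh: "r \<in> hull3 a b c" "a + r \<in> hull3 a b c" "b + r \<in> hull3 a b c" "c + r \<in> hull3 a b c"
    by (auto simp: hull3_iff r_def f2_simps)
  have val: "p + u \<in> E \<longleftrightarrow> u \<in> E" if "u \<in> hull3 a b c" "u \<noteq> 0" for u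
    using p that by (simp add: special_def)
  have pt: "special p (hull3 d h r)" if "d = a \<or> d = b \<or> d = c" "h \<in> H" "polar d h" for d h
  proof (rule special_spread [OF pU _ r(1) _ r(2)])
    have "d \<noteq> 0" using that by auto
    moreover have "r \<noteq> 0" "d + r \<noteq> 0" using r rE that by auto
    moreover have "d \<in> hull3 a b c" using that hull3_props by auto
    ultimately show "p + d \<notin> E" "p + r \<in> E" "p + (d + r) \<in> E"
      using that rh rE out r val [of d] val [of r] val [of "d + r"] by auto
  qed (use that abc out rp in auto)
  show ?thesis
  proof (cases "polar a v \<or> polar b v \<or> polar c v")
    case True
    then obtain d where d: "d = a \<or> d = b \<or> d = c" "polar d v" by blast
    from pt [OF d(1) v(1) d(2)] v0 show ?thesis by (simp add: special_def hull3_props)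
  next
    case False
    then have va: "\<not> polar v a" "\<not> polar v b" by (auto simp: polar_sym [of v])
    obtain t where t: "t \<in> H" "polar v t" using v by (auto simp: radical_def)
    define s where "s = (if polar a t then t else t + b)"
    have s: "s \<in> H" "polar a s" "polar v s" using t pol va abc v by (auto simp: s_def polar_add)
    define u where "u = (if s \<in> E then s + a else s)"
    have u: "u \<in> H" "polar a u" "polar v u" "u \<notin> E"
      using s va abc v out polar_sym [of s a] by (auto simp: u_def polar_add E_sum)
    define q where "q = (if polar u r then r + a else r)"
    have ua: "polar u a" using u polar_sym by blast
    have q: "q \<in> H" "\<not> polar u q" "q \<in> E"
      using u ua r rp abc out polar_sym [of r a] by (auto simp: q_def polar_add E_sum)
    have sp: "p + y \<in> E \<longleftrightarrow> y \<in> E" if "y \<in> hull3 a u r" "y \<noteq> 0" for y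
      using pt [of a u] u that by (simp add: special_def)
    have uq: "u + q \<in> E" using u q by (simp add: E_sum)
    have "u \<in> hull3 a u r" "q \<in> hull3 a u r" "u + q \<in> hull3 a u r"
      by (auto simp: hull3_iff q_def f2_simps)
    moreover have "u \<noteq> 0" "q \<noteq> 0" "u + q \<noteq> 0" using ua q uq by auto
    ultimately have "special p (hull3 u v q)"
      using sp u q uq v by (intro special_spread [OF pU]) (auto simp: polar_sym [of u v])
    then show ?thesis using v0 by (simp add: special_def hull3_props)
  qed
qed

text \<open>Only a radical \<open>v\<close> is left, and it lies in \<open>E\<close>. If
  \<open>p + v\<close> did not, then over a span avoiding \<open>v\<close> the nonzero values on the
  coset of \<open>p + v\<close> would be the complements of those on the span, since
  \<open>u\<close> and \<open>v + u\<close> have opposite values. Such a coset is odd but neither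
  constant nor special.\<close>

lemma special_is_clone:
  assumes abc: "a \<in> H" "b \<in> H" "c \<in> H" "coclaw a b c" and p: "special p (hull3 a b c)"
    and v: "v \<in> H" "v \<noteq> 0"
  shows "p + v \<in> E \<longleftrightarrow> v \<in> E"
proof (cases "radical v")
  case False then show ?thesis using special_spread_nonradical [OF abc p v(1)] by blast
next
  case rad: True
  have vE: "v \<in> E" using v rad by (intro radical_in_E)
  have vp: "\<not> polar v t" if "t \<in> H" for t using rad that by (simp add: radical_def)
  have pU: "p \<in> U" "p \<notin> H" "p \<in> E" using p by (auto simp: special_def)
  have ab: "polar a b" using abc(4) by (auto simp: coclaw_def polar_def)
  have "p + v \<in> E"
  proof (rule ccontr)
    assume pv: "p + v \<notin> E"
    obtain m where m: "m \<in> H" "\<not> polar a m" "\<not> polar b m" "m \<noteq> 0" "m \<noteq> v"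
      by (rule exists_perp_avoiding [OF abc(1,2) ab])
    define r where "r = (if m \<in> E then m else v + m)"
    have r: "r \<in> H" "\<not> polar a r" "\<not> polar b r" "r \<in> E" "r \<noteq> 0" "r \<noteq> v"
      using m v vE vp [of m] abc vp [of a] vp [of b] polar_sym [of v]
      by (auto simp: r_def polar_add E_sum sum_zero_iff)
    let ?K = "hull3 a b r"
    have KH: "?K \<subseteq> H" using abc r by (intro hull3_subset)
    have Kr: "\<not> polar k r" if "k \<in> ?K" for k
      using that r abc by (auto simp: hull3_iff polar_add)
    have val: "p + v + u \<in> E \<longleftrightarrow> u \<notin> E" if u: "u \<in> ?K" "u \<noteq> 0" for u
    proof -
      have "\<not> radical (v + u)"
      proof
        assume "radical (v + u)"
        then have "radical u" using u KH v vp by (auto simp: radical_def polar_add)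
        then have "u = v" using radical_unique rad u v KH by blast
        then have "v \<in> ?K" using u by simp
        then have "v \<in> {r, 0}" using vp [of a] vp [of b] abc ab r polar_sym [of b a] polar_sym [of r a] polar_sym [of r b]
          by (auto simp: hull3_iff polar_add)
        then show False using v r by auto
      qed
      then have "p + (v + u) \<in> E \<longleftrightarrow> v + u \<in> E"
        using special_spread_nonradical [OF abc p] u KH v by auto
      also have "v + u \<in> E \<longleftrightarrow> u \<notin> E" using vE vp [of u] u KH by (auto simp: E_sum)
      finally show ?thesis by (simp add: add.assoc)
    qed
    have K: "a \<in> ?K" "b \<in> ?K" "a + b \<in> ?K" by (auto simp: hull3_iff)
    have ne: "a \<noteq> 0" "b \<noteq> 0" "a + b \<noteq> 0" using ab by (auto simp: sum_zero_iff)
    have out: "a \<notin> E" "b \<notin> E" "a + b \<in> E" using abc(4) by (auto simp: coclaw_def)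
    have "odd_coset (p + v) a b"
      using val [OF K(1) ne(1)] val [OF K(2) ne(2)] val [OF K(3) ne(3)] pv ab out
      by (simp add: odd_coset_def add.assoc)
    then have "(\<forall>u\<in>?K. p + v + u \<in> E \<longleftrightarrow> p + v \<in> E) \<or> (\<exists>k\<in>?K. special (p + v + k) ?K)"
      using constant_or_special [OF abc(1,2) r(1) ab r(2-4) outside_shift [OF pU(1,2) v(1)] K(1,2)] by blast
    then show False
    proof
      assume "\<forall>u\<in>?K. p + v + u \<in> E \<longleftrightarrow> p + v \<in> E"
      then show False using val [OF K(1) ne(1)] out pv K(1) by blast
    next
      assume "\<exists>k\<in>?K. special (p + v + k) ?K"
      then obtain k where k: "k \<in> ?K" "p + v + k \<in> E" "\<And>u. u \<in> ?K \<Longrightarrow> u \<noteq> 0 \<Longrightarrow> p + v + k + u \<in> E \<longleftrightarrow> u \<in> E"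
        by (auto simp: special_def)
      have k0: "k \<noteq> 0" using k pv by auto
      then have kE: "k \<notin> E" using k(3) [OF k(1)] pv by (simp add: add.assoc)
      have rK: "r \<in> ?K" by (rule hull3_props)
      have "k + r \<in> ?K" "k + r \<noteq> 0"
        using k(1) rK kE r subspaceD(2) [OF hull3_props(1)] by (auto simp: sum_zero_iff)
      then have "p + v + (k + r) \<in> E \<longleftrightarrow> k + r \<notin> E" by (rule val)
      moreover have "p + v + k + r \<in> E" using k(3) [OF rK] r by simp
      ultimately have "k + r \<notin> E" by (simp add: add.assoc)
      then show False using Kr [OF k(1)] kE r by (simp add: E_sum)
    qed
  qed
  then show ?thesis using vE by simp
qed

lemma summand_if_special:
  assumes T: "a \<in> H" "b \<in> H" "r \<in> H" "polar a b" "\<not> polar a r" "\<not> polar b r" "r \<in> E"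
    and p: "special p (hull3 a b r)"
  shows "summand U {0, p}"
proof -
  obtain a' b' c' where abc: "a' \<in> H" "b' \<in> H" "c' \<in> H" "coclaw a' b' c'" "hull3 a' b' c' = hull3 a b r"
    by (rule exists_coclaw_basis [OF T])
  have val: "p + v \<in> E \<longleftrightarrow> v \<in> E" if "v \<in> H" "v \<noteq> 0" for v
    using special_is_clone [OF abc(1-4) _ that] p abc(5) by simp
  have pU: "p \<in> U" "p \<notin> H" using p by (auto simp: special_def)
  have p0: "p \<noteq> 0" using pU by auto
  have "v + p \<in> E \<longleftrightarrow> v \<in> E" if v: "v \<in> U" "v \<noteq> 0" "v \<noteq> p" for v
  proof (cases "v \<in> H")
    case True then show ?thesis using val [OF _ v(2)] by (simp add: add.commute [of v])
  next
    case False
    then have "p + v \<in> H" "p + v \<noteq> 0" using outside_sum pU v by (auto simp: sum_zero_iff)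
    from val [OF this] show ?thesis by (simp add: add.commute [of v])
  qed
  moreover have "{0, p} \<noteq> U" using T H_subset pU by auto
  moreover have "0 \<in> U" using U by (rule subspaceD)
  ultimately show ?thesis unfolding summand_def using pU p0 subspace_pair by auto
qed

lemma constant_spread:
  assumes ns: "\<And>p. \<not> summand U {0, p}" and w: "w \<in> U" "w \<notin> H" and ab: "a \<in> H" "b \<in> H" "polar a b"
    and c: "w + a \<in> E \<longleftrightarrow> w \<in> E" "w + b \<in> E \<longleftrightarrow> w \<in> E" "w + (a + b) \<in> E \<longleftrightarrow> w \<in> E"
    and r: "r \<in> H" "\<not> polar a r" "\<not> polar b r" "r \<in> E" and u: "u \<in> hull3 a b r"
  shows "w + u \<in> E \<longleftrightarrow> w \<in> E"
proof -
  have "odd_coset w a b" using ab c by (simp add: odd_coset_def add.assoc)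
  then show ?thesis
    using constant_or_special [OF ab(1,2) r(1) ab(3) r(2-4) w, of a b] u
      summand_if_special [OF ab(1,2) r(1) ab(3) r(2-4)] ns by (auto simp: hull3_props)
qed

text \<open>Without summands there are no special points, so the coset is constant over
  \<open>hull3 a b r\<close>. To reach \<open>h \<in> H\<close>, write \<open>h = l + m\<close> with
  \<open>l\<close> in the span of \<open>a, b\<close> and \<open>m\<close> perpendicular to both. If
  \<open>m \<in> E\<close>, it can play the role of \<open>r\<close>. Otherwise take
  \<open>s \<in> E\<close> with \<open>polar m s\<close> and replace \<open>a, b, r\<close> by
  \<open>d + s\<close>, \<open>e\<close>, \<open>m + e\<close>, where \<open>d, e\<close> come from
  the span of \<open>a, b\<close> and \<open>e \<in> E\<close>; their span contains
  \<open>m\<close>. So \<open>w + H\<close> is constant and \<open>H\<close> is a summand.\<close>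

lemma summand_if_odd:
  assumes w: "w \<in> U" "w \<notin> H" and ab: "a \<in> H" "b \<in> H" "polar a b" "odd_coset w a b"
  shows "\<exists>D. summand U D"
proof (rule ccontr)
  assume ns: "\<nexists>D. summand U D"
  have spread: "w + u \<in> E \<longleftrightarrow> w \<in> E"
    if "w \<in> U" "w \<notin> H" "a \<in> H" "b \<in> H" "polar a b" "w + a \<in> E \<longleftrightarrow> w \<in> E" "w + b \<in> E \<longleftrightarrow> w \<in> E"
      "w + (a + b) \<in> E \<longleftrightarrow> w \<in> E" "r \<in> H" "\<not> polar a r" "\<not> polar b r" "r \<in> E" "u \<in> hull3 a b r" for w a b r u
    using constant_spread [OF _ that] ns by blast
  obtain r where r: "r \<in> H" "\<not> polar a r" "\<not> polar b r" "r \<in> E" by (rule exists_E_perp_pair [OF ab(1-3)])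
  have "(\<forall>u\<in>hull3 a b r. w + u \<in> E \<longleftrightarrow> w \<in> E) \<or> (\<exists>k\<in>hull3 a b r. special (w + k) (hull3 a b r))"
    by (rule constant_or_special [OF ab(1,2) r(1) ab(3) r(2-4) w _ _ ab(4)]) (rule hull3_props)+
  then have const: "w + u \<in> E \<longleftrightarrow> w \<in> E" if "u \<in> hull3 a b r" for u
    using summand_if_special [OF ab(1,2) r(1) ab(3) r(2-4)] ns that by blast
  have all: "w + h \<in> E \<longleftrightarrow> w \<in> E" if h: "h \<in> H" for h
  proof -
    define m where "m = proj a b h"
    define l where "l = h + m"
    have m: "m \<in> H" "\<not> polar a m" "\<not> polar b m" and l: "l \<in> {0, a, b, a + b}"
      using proj [OF ab(1,2) h ab(3)] by (auto simp: m_def l_def)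
    have lH: "l \<in> H" using l ab by auto
    have wl: "w + l \<in> U" "w + l \<notin> H" using outside_shift [OF w lH] by auto
    have L: "w + l + v \<in> E \<longleftrightarrow> w + l \<in> E" if v: "v \<in> {0, a, b, a + b}" for v
    proof -
      have "l \<in> hull3 a b r" "l + v \<in> hull3 a b r"
        using l v by (auto simp: hull3_iff f2_simps)
      from const [OF this(1)] const [OF this(2)] show ?thesis by (simp add: add.assoc)
    qed
    have wh: "w + h = w + l + m" by (simp add: l_def f2_simps)
    have "w + l + m \<in> E \<longleftrightarrow> w + l \<in> E"
    proof (cases "m = 0 \<or> m \<in> E")
      case True
      then show ?thesis
      proof
        assume mE: "m \<in> E"
        show ?thesis
          by (rule spread [OF wl ab(1-3) _ _ _ m mE]) (simp_all add: L hull3_props)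
      qed simp
    next
      case False
      then obtain s where s: "s \<in> H" "\<not> polar a s" "\<not> polar b s" "s \<in> E" "polar m s"
        using exists_E_perp [OF ab(1-3) m(1) _ _ m(2,3)] by blast
      have c: "w + l + u \<in> E \<longleftrightarrow> w + l \<in> E" if "u \<in> hull3 a b s" for u
        by (rule spread [OF wl ab(1-3) _ _ _ s(1-4) that]) (simp_all add: L)
      obtain d e where de: "d \<in> {a, b}" "e \<in> {a, b, a + b}" "polar d e" "e \<in> E"
      proof (cases "a \<in> E \<or> b \<in> E")
        case True then show thesis using that ab polar_sym [of a b] by blast
      next
        case False
        then have "a + b \<in> E" using ab by (simp add: E_sum)
        moreover have "polar a (a + b)" using ab by (simp add: polar_add)
        ultimately show thesis using that by blast
      qed
      have deH: "d \<in> H" "e \<in> H" using de ab by auto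
      have dm: "\<not> polar d m" "\<not> polar e m" "\<not> polar m e" "\<not> polar d s" "\<not> polar s e"
        using de ab m s polar_sym [of _ e] polar_sym [of s] by (auto simp: polar_add)
      have sm: "polar s m" using s polar_sym by blast
      have "d + s \<in> hull3 a b s" "e \<in> hull3 a b s" "d + s + e \<in> hull3 a b s"
        using de by (auto simp: hull3_iff f2_simps)
      note c3 = this [THEN c]
      have "w + l + m \<in> E \<longleftrightarrow> w + l \<in> E"
      proof (rule spread [OF wl _ deH(2) _ c3, of "m + e"])
        show "d + s \<in> H" "m + e \<in> H" using deH s m by auto
        show "polar (d + s) e" "\<not> polar (d + s) (m + e)" "\<not> polar e (m + e)"
          using de dm sm deH s m by (auto simp: polar_add)
        show "m + e \<in> E" using False dm de by (simp add: E_sum)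
        show "m \<in> hull3 (d + s) e (m + e)" by (simp add: hull3_iff f2_simps)
      qed
      then show ?thesis .
    qed
    moreover have "w + l \<in> E \<longleftrightarrow> w \<in> E"
      by (rule const) (use l in \<open>auto simp: hull3_iff\<close>)
    ultimately show ?thesis by (simp add: wh)
  qed
  have out: "v \<in> E \<longleftrightarrow> w \<in> E" if v: "v \<in> U" "v \<notin> H" for v
    using all [OF outside_sum [OF w(1) v(1) w(2) v(2)]] by simp
  have "v + u \<in> E \<longleftrightarrow> v \<in> E" if "v \<in> U - H" "u \<in> H" for v u
    using out [of v] out [of "v + u"] outside_shift [of v u] that by auto
  moreover have "H \<noteq> {0}" "H \<noteq> U" using H(1) w by (auto simp: indecomposable_def)
  ultimately have "summand U H" unfolding summand_def using sH H_subset by blast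
  then show False using ns by blast
qed

text \<open>The symmetries of \<open>odd_coset\<close> move an odd triple until only
  \<open>w\<close> is off \<open>H\<close>. If \<open>a\<close> is not radical, translating
  \<open>w\<close> by some \<open>c\<close> with \<open>polar a c\<close> yields an odd triple with
  nonperpendicular \<open>a, b\<close> (\<open>split\<close>). If both are radical, they would be
  distinct nonzero radical vectors.\<close>

lemma summand_if_not_quadratic:
  assumes "\<not> quadratic U"
  shows "\<exists>D. summand U D"
proof -
  have inner: "\<not> odd_coset a b c" if "a \<in> H" "b \<in> H" "c \<in> H" for a b c
    using H(2) that by (simp add: odd_coset_iff quadratic_def)
  obtain p q s where pqs: "p \<in> U" "q \<in> U" "s \<in> U" "odd_coset p q s"
    using assms unfolding quadratic_def odd_coset_iff by blast
  have "\<exists>w\<in>U. \<exists>a\<in>U. \<exists>b\<in>U. w \<notin> H \<and> odd_coset w a b"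
    using pqs inner [of p q s] odd_coset_perm by metis
  then obtain w a b where w: "w \<in> U" "w \<notin> H" and ab: "a \<in> U" "b \<in> U" "odd_coset w a b" by blast
  have "\<exists>a\<in>H. odd_coset w a b"
    using outside_sum [OF w(1) ab(1) w(2)] ab(3) odd_coset_perm(3) by blast
  then obtain a where a: "a \<in> H" "odd_coset w a b" by blast
  have "\<exists>b\<in>H. odd_coset w a b"
    using outside_sum [OF w(1) ab(2) w(2)] a(2) odd_coset_perm by metis
  then obtain b where b: "b \<in> H" "odd_coset w a b" by blast
  have split: "odd_coset (w + c) a (b + c) \<or> odd_coset (w + c) a c"
    if "odd_coset w a b" "a \<in> H" "b \<in> H" "c \<in> H" for w a b c
  proof -
    have e: "w + c + (b + c) = w + b" "w + c + a + (b + c) = w + a + b" "w + c + c = w" "w + c + a + c = w + a"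
      by (simp_all add: f2_simps)
    show ?thesis using that unfolding odd_coset_def e polar_add(1) [OF that(2-4)] by blast
  qed
  have fin: "\<exists>D. summand U D" if o: "odd_coset w a b" and w: "w \<in> U" "w \<notin> H" and ab: "a \<in> H" "b \<in> H" and n: "\<not> radical a" for w a b
  proof (cases "polar a b")
    case True then show ?thesis using summand_if_odd [OF w ab] o by blast
  next
    case False
    obtain c where c: "c \<in> H" "polar a c" using n by (auto simp: radical_def)
    have "polar a (b + c)" "b + c \<in> H" using False c ab by (simp_all add: polar_add)
    then show ?thesis
      using split [OF o ab c(1)] c summand_if_odd [OF outside_shift [OF w c(1)] ab(1)] by blast
  qed
  show ?thesis
  proof (cases "radical a \<and> radical b")
    case False
    then show ?thesis
      using fin [OF b(2) w a(1) b(1)] fin [OF _ w b(1) a(1)] b(2) odd_coset_perm(1) [of w a b] by blast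
  next
    case True
    have "a \<noteq> 0" "b \<noteq> 0" "a \<noteq> b" using b(2) by (auto simp: odd_coset_def add.assoc)
    then show ?thesis using radical_unique a b True by blast
  qed
qed

end

context f2_points
begin

lemma quadratic_hyperplane_exit:
  assumes U: "indecomposable U" "\<not> quadratic U"
    and H: "indecomposable H" "quadratic H" "finite H" "8 < card H" and x: "x \<notin> H" "U = adjoin x H"
  shows "\<exists>a\<in>H. \<exists>b\<in>H. \<exists>c\<in>H. \<exists>w\<in>U - H. coclaw a b c \<and> indecomposable (adjoin w (hull3 a b c)) \<and>
    \<not> quadratic (adjoin w (hull3 a b c))"
proof (rule ccontr)
  assume n: "\<not> ?thesis"
  note ind = indecomposableD(3) [OF U(1)] and nq = U(2)
  interpret quadratic_hyperplane scale E U H x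
    using indecomposableD(1) [OF U(1)] H x n by unfold_locales blast+
  show False using summand_if_not_quadratic [OF nq] ind by blast
qed

section \<open>Extensions of PG-sums\<close>

text \<open>Translation by the sum of two points with \<open>P\<close> sends points without
  \<open>P\<close> to points with it; translation by the sum of two points without \<open>P\<close>
  does the reverse. Two points of each kind would give a contradiction by combining both
  translations, so one kind has at most one point.\<close>

lemma isolated_value_if_rigid:
  fixes P :: "'a \<Rightarrow> bool"
  assumes A: "subspace A"
    and rigid: "\<And>p z q y. \<lbrakk>p \<in> A; z \<in> A; q \<in> A; y \<in> A; P p; \<not> P z; P q; \<not> P y; p + z = q + y\<rbrakk> \<Longrightarrow> p = q"
  shows "\<exists>z\<in>A. \<forall>u\<in>A - {z}. \<forall>v\<in>A - {z}. P u \<longleftrightarrow> P v"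
proof (rule ccontr)
  assume n: "\<not> ?thesis"
  have A0: "0 \<in> A" and cl: "u \<in> A \<Longrightarrow> v \<in> A \<Longrightarrow> u + v \<in> A" for u v using A by (auto simp: subspaceD)
  obtain p z where pz: "p \<in> A" "z \<in> A" "P p" "\<not> P z" using n A0 by blast
  obtain q where q: "q \<in> A" "q \<noteq> p" "P q"
    using n pz(1,3,4) by (metis (no_types, lifting) Diff_iff singletonI singletonD)
  obtain y where y: "y \<in> A" "y \<noteq> z" "\<not> P y"
    using n pz by (metis (no_types, lifting) Diff_iff singletonI singletonD)
  have 1: "P (p + q + v)" if "v \<in> A" "\<not> P v" for v
  proof (rule ccontr)
    assume c: "\<not> P (p + q + v)"
    have "p = q"
      by (rule rigid [of p v q "p + q + v"]) (use pz q that c cl in \<open>auto simp: f2_simps\<close>)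
    then show False using q by simp
  qed
  have 2: "\<not> P (z + y + v)" if "v \<in> A" "P v" for v
  proof
    assume c: "P (z + y + v)"
    have "v = z + y + v"
      by (rule rigid [of v z "z + y + v" y]) (use pz y that c cl in \<open>auto simp: f2_simps\<close>)
    then have "z + y = 0" by simp
    then show False using y by (simp add: sum_zero_iff)
  qed
  have "P (p + q + (z + y + p))" using 1 2 pz y q cl by auto
  moreover have "p + q + (z + y + p) = z + y + q" by (simp add: f2_simps)
  ultimately have "P (z + y + q)" by metis
  then show False using 2 q by blast
qed

text \<open>If \<open>Q\<close> were neither \<open>P\<close> nor its negation, it would separate
  some \<open>q, y\<close> that \<open>P\<close> does not. Then \<open>cross\<close> makes
  \<open>P\<close> invariant under \<open>q + y\<close> and forces \<open>Q\<close> to be constant.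
  So \<open>Q\<close> is \<open>P\<close> or its negation, and \<open>cross\<close> turns into the
  rigidity condition for \<open>P\<close> alone.\<close>

lemma isolated_value_if_cross_rigid:
  fixes P Q :: "'a \<Rightarrow> bool"
  assumes A: "subspace A"
    and nP: "p0 \<in> A" "z0 \<in> A" "P p0" "\<not> P z0" and nQ: "q0 \<in> A" "y0 \<in> A" "Q q0" "\<not> Q y0"
    and cross: "\<And>p z q y. \<lbrakk>p \<in> A; z \<in> A; q \<in> A; y \<in> A; P p; \<not> P z; Q q; \<not> Q y; p + z = q + y\<rbrakk>
      \<Longrightarrow> p = q \<or> p = y"
  shows "\<exists>z\<in>A. \<forall>u\<in>A - {z}. \<forall>v\<in>A - {z}. (P u \<longleftrightarrow> P v) \<and> (Q u \<longleftrightarrow> Q v)"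
proof -
  have cl: "u \<in> A \<Longrightarrow> v \<in> A \<Longrightarrow> u + v \<in> A" for u v using A by (rule subspaceD)
  have PQ: "(\<forall>u\<in>A. P u \<longleftrightarrow> Q u) \<or> (\<forall>u\<in>A. P u \<longleftrightarrow> \<not> Q u)"
  proof (rule ccontr)
    assume "\<not> ?thesis"
    then obtain q y where qy: "q \<in> A" "y \<in> A" "Q q" "\<not> Q y" "P q \<longleftrightarrow> P y" using nQ by metis
    define a where "a = q + y"
    have aA: "a \<in> A" "a \<noteq> 0" using qy cl by (auto simp: a_def sum_zero_iff)
    have inv: "P (u + a)" if u: "u \<in> A" "P u" for u
    proof (rule ccontr)
      assume c: "\<not> P (u + a)"
      have "u = q \<or> u = y"
        by (rule cross [of u "u + a" q y]) (use u aA qy c cl in \<open>auto simp: a_def f2_simps\<close>)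
      moreover have "q + a = y" "y + a = q" by (simp_all add: a_def f2_simps)
      ultimately show False using qy u c by metis
    qed
    have inv': "\<not> P (u + a)" if u: "u \<in> A" "\<not> P u" for u
    proof
      assume "P (u + a)"
      then have "P (u + a + a)" using inv u aA cl by blast
      then show False using u by (simp add: add.assoc)
    qed
    have per: "Q p \<longleftrightarrow> Q z" if pz: "p \<in> A" "z \<in> A" "P p" "\<not> P z" for p z
    proof -
      have *: False if uv: "u \<in> A" "v \<in> A" "Q u" "\<not> Q v" "u + v = p + z" for u v
      proof -
        have 1: "p = u \<or> p = v" by (rule cross [of p z u v]) (use pz uv in auto)
        have 2: "p + a = u \<or> p + a = v"
          by (rule cross [of "p + a" "z + a" u v]) (use pz uv inv [OF pz(1,3)] inv' [OF pz(2,4)] aA cl in \<open>simp_all add: f2_simps\<close>)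
        have "p + a \<noteq> p" using aA by simp
        moreover have "p + a \<noteq> z" using inv [OF pz(1,3)] pz by auto
        moreover have "u = p \<Longrightarrow> v = z" "v = p \<Longrightarrow> u = z" using uv(5) by (auto simp: add.commute)
        ultimately show False using 1 2 by metis
      qed
      show ?thesis using * [of p z] * [of z p] pz by (auto simp: add.commute)
    qed
    have "Q u \<longleftrightarrow> Q z0" if "u \<in> A" for u
      using per [of u z0] per [of p0 u] per [of p0 z0] nP that by (cases "P u") auto
    then show False using nQ by blast
  qed
  have "\<exists>z\<in>A. \<forall>u\<in>A - {z}. \<forall>v\<in>A - {z}. P u \<longleftrightarrow> P v"
  proof (rule isolated_value_if_rigid [OF A])
    fix p z q y assume *: "p \<in> A" "z \<in> A" "q \<in> A" "y \<in> A" "P p" "\<not> P z" "P q" "\<not> P y" "p + z = q + y"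
    show "p = q"
      using PQ cross [of p z q y] cross [of p z y q] * by (auto simp: add.commute)
  qed
  then show ?thesis using PQ by (metis Diff_iff)
qed

end

text \<open>The hyperplane is the PG-sum of \<open>A\<close> and \<open>B\<close>. Its coset is
  viewed as a grid over \<open>A \<times> B\<close> with columns \<open>a\<close> and rows
  \<open>b\<close>. The representative \<open>x\<close> can be moved and \<open>A, B\<close>
  exchanged, so an exceptional row or column may be normalised to 0.\<close>

locale PG_hyperplane = f2_points +
  fixes U A B :: "'a set" and x :: 'a
  assumes U: "subspace U" "clawless U" and A: "subspace A" "A \<subseteq> U" and B: "subspace B" "B \<subseteq> U"
    and AB: "A \<inter> B = {0}"
    and E_AB: "\<And>a b. a \<in> A \<Longrightarrow> b \<in> B \<Longrightarrow> a + b \<in> E \<longleftrightarrow> (a = 0) \<noteq> (b = 0)"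
    and x: "x \<in> U" "\<And>a b. a \<in> A \<Longrightarrow> b \<in> B \<Longrightarrow> x \<noteq> a + b"
    and U_cases: "\<And>u. u \<in> U \<Longrightarrow> \<exists>a\<in>A. \<exists>b\<in>B. u = a + b \<or> u = x + (a + b)"
begin

lemma closed [simp]: "0 \<in> A" "0 \<in> B" "a \<in> A \<Longrightarrow> a' \<in> A \<Longrightarrow> a + a' \<in> A" "b \<in> B \<Longrightarrow> b' \<in> B \<Longrightarrow> b + b' \<in> B"
  "u \<in> U \<Longrightarrow> v \<in> U \<Longrightarrow> u + v \<in> U" "a \<in> A \<Longrightarrow> a \<in> U" "b \<in> B \<Longrightarrow> b \<in> U" "x \<in> U"
  using A B U x by (auto simp: subspaceD)

lemma sum_eq_0: "a \<in> A \<Longrightarrow> b \<in> B \<Longrightarrow> a + b = 0 \<longleftrightarrow> a = 0 \<and> b = 0"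
  using AB by (auto simp: sum_zero_iff)

lemma outside_nonzero: "a \<in> A \<Longrightarrow> b \<in> B \<Longrightarrow> x + (a + b) \<noteq> 0"
  using x by (auto simp: sum_zero_iff)

lemma shift:
  assumes "c \<in> A" "d \<in> B"
  shows "PG_hyperplane scale E U A B (x + (c + d))"
proof
  show "x + (c + d) \<noteq> a + b" if "a \<in> A" "b \<in> B" for a b
  proof
    assume "x + (c + d) = a + b"
    then have "x = (c + a) + (d + b)" by (metis add.assoc add.commute add_self_left)
    then show False using x(2) [of "c + a" "d + b"] assms that by simp
  qed
  show "\<exists>a\<in>A. \<exists>b\<in>B. u = a + b \<or> u = x + (c + d) + (a + b)" if "u \<in> U" for u
  proof -
    obtain a b where ab: "a \<in> A" "b \<in> B" "u = a + b \<or> u = x + (a + b)" using U_cases \<open>u \<in> U\<close> by metis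
    have "x + (a + b) = x + (c + d) + ((c + a) + (d + b))" by (simp add: f2_simps)
    moreover have "c + a \<in> A" "d + b \<in> B" using ab assms by auto
    ultimately show ?thesis using ab by metis
  qed
qed (use U A B AB E_AB assms in auto)

lemma swap: "PG_hyperplane scale E U B A x"
proof
  show "a + b \<in> E \<longleftrightarrow> (a = 0) \<noteq> (b = 0)" if "a \<in> B" "b \<in> A" for a b
    using E_AB [OF that(2,1)] by (auto simp: add.commute)
  show "x \<noteq> a + b" if "a \<in> B" "b \<in> A" for a b
    using x(2) [OF that(2,1)] by (simp add: add.commute)
  show "\<exists>a\<in>B. \<exists>b\<in>A. u = a + b \<or> u = x + (a + b)" if "u \<in> U" for u
    using U_cases [OF that] by (metis add.commute)
qed (use U A B AB in auto)

text \<open>Membership in \<open>E\<close> on the coset of the hyperplane, as a function of the two coordinates.\<close>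

definition f :: "'a \<Rightarrow> 'a \<Rightarrow> bool" where "f a b \<longleftrightarrow> x + (a + b) \<in> E"

text \<open>The claw is \<open>a + a'\<close>, \<open>b + b'\<close> and the corner
  \<open>x + (a + b)\<close>; its four sums are a vector with both components nonzero and the other
  three corners.\<close>

lemma rectangle:
  assumes "a \<in> A" "a' \<in> A" "b \<in> B" "b' \<in> B" "a \<noteq> a'" "b \<noteq> b'" "f a b"
  shows "f a' b \<or> f a b' \<or> f a' b'"
proof (rule ccontr)
  assume c: "\<not> ?thesis"
  have nz: "a + a' \<noteq> 0" "b + b' \<noteq> 0" using assms by (auto simp: sum_zero_iff)
  then have "a + a' + (b + b') \<noteq> 0" using assms by (simp add: sum_eq_0)
  then show False
    using assms c nz E_AB [of "a + a'" 0] E_AB [of 0 "b + b'"] E_AB [of "a + a'" "b + b'"] outside_nonzero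
    by (intro claw_contra [OF U(2), of "a + a'" "b + b'" "x + (a + b)" "a + a' + (b + b')"
          "x + (a' + b)" "x + (a + b')" "x + (a' + b')"])
      (simp_all add: f_def, (simp_all add: f2_simps)?)
qed

text \<open>Adding \<open>p + z\<close>, a point of \<open>A\<close>, exchanges \<open>p\<close>
  with \<open>z\<close> and \<open>q\<close> with \<open>y\<close>, so both chosen entries leave
  \<open>E\<close>; the other two sums of the claw have both components nonzero.\<close>

lemma two_rows:
  assumes a: "p \<in> A" "z \<in> A" "q \<in> A" "y \<in> A" and b: "b \<in> B" "b' \<in> B" "b \<noteq> b'"
    and f: "f p b" "\<not> f z b" "f q b'" "\<not> f y b'" and s: "p + z = q + y"
  shows "p = q \<or> p = y"
proof (rule ccontr)
  assume c: "\<not> ?thesis"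
  have y: "y = p + z + q" using s by (simp add: f2_simps)
  then have zq: "z + q = p + y" by (simp add: f2_simps)
  have nz: "p + z \<noteq> 0" "b + b' \<noteq> 0" "p + q \<noteq> 0" "z + q \<noteq> 0"
    using c f b unfolding zq by (auto simp: sum_zero_iff)
  then have "p + q + (b + b') \<noteq> 0" using a b by (simp add: sum_eq_0)
  then show False
    using a b f nz E_AB [of "p + z" 0] E_AB [of "p + q" "b + b'"] E_AB [of "z + q" "b + b'"] outside_nonzero
    by (intro claw_contra [OF U(2), of "p + z" "x + (p + b)" "x + (q + b')" "x + (z + b)"
          "x + (y + b')" "p + q + (b + b')" "z + q + (b + b')"])
      (simp_all add: f_def, (simp_all add: y f2_simps)?)
qed

text \<open>The pairwise sums have both components nonzero and so lie outside \<open>E\<close>; only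
  the total can prevent a claw.\<close>

lemma transversal:
  assumes a: "a \<in> A" "a' \<in> A" "a'' \<in> A" "a \<noteq> a'" "a \<noteq> a''" "a' \<noteq> a''"
    and b: "b \<in> B" "b' \<in> B" "b'' \<in> B" "b \<noteq> b'" "b \<noteq> b''" "b' \<noteq> b''"
    and f: "f a b" "f a' b'" "f a'' b''"
  shows "f (a + a' + a'') (b + b' + b'')"
proof (rule ccontr)
  assume c: "\<not> ?thesis"
  have nz: "a + a' \<noteq> 0" "a + a'' \<noteq> 0" "a' + a'' \<noteq> 0" "b + b' \<noteq> 0" "b + b'' \<noteq> 0" "b' + b'' \<noteq> 0"
    using a b by (auto simp: sum_zero_iff)
  then have "a + a' + (b + b') \<noteq> 0" "a + a'' + (b + b'') \<noteq> 0" "a' + a'' + (b' + b'') \<noteq> 0"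
    using a b by (simp_all add: sum_eq_0)
  then show False
    using a b f c nz E_AB [of "a + a'" "b + b'"] E_AB [of "a + a''" "b + b''"] E_AB [of "a' + a''" "b' + b''"]
    by (intro claw_contra [OF U(2), of "x + (a + b)" "x + (a' + b')" "x + (a'' + b'')" "a + a' + (b + b')"
          "a + a'' + (b + b'')" "a' + a'' + (b' + b'')" "x + (a + a' + a'' + (b + b' + b''))"])
      (simp_all add: f_def, (simp_all add: f2_simps)?)
qed

text \<open>By \<open>two_rows\<close> and cross rigidity, two nonconstant rows are constant off a
  common column. With at least three columns, the exceptional column of a nonconstant row is unique,
  so it serves all rows as soon as two of them are nonconstant.\<close>

lemma row_dichotomy:
  assumes big: "\<And>u v. \<exists>w\<in>A. w \<noteq> u \<and> w \<noteq> v"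
  shows "(\<exists>z\<in>A. \<forall>b\<in>B. \<forall>u\<in>A - {z}. \<forall>v\<in>A - {z}. f u b \<longleftrightarrow> f v b) \<or>
    (\<exists>b0\<in>B. (\<exists>u\<in>A. \<exists>v\<in>A. f u b0 \<and> \<not> f v b0) \<and> (\<forall>b\<in>B - {b0}. \<forall>u\<in>A. \<forall>v\<in>A. f u b \<longleftrightarrow> f v b))"
proof (rule disjCI)
  assume n: "\<not> (\<exists>b0\<in>B. (\<exists>u\<in>A. \<exists>v\<in>A. f u b0 \<and> \<not> f v b0) \<and> (\<forall>b\<in>B - {b0}. \<forall>u\<in>A. \<forall>v\<in>A. f u b \<longleftrightarrow> f v b))"
  have pair: "\<exists>z\<in>A. \<forall>u\<in>A - {z}. \<forall>v\<in>A - {z}. (f u b \<longleftrightarrow> f v b) \<and> (f u c \<longleftrightarrow> f v c)"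
    if b: "b \<in> B" "c \<in> B" "b \<noteq> c" and u: "u \<in> A" "v \<in> A" "f u b" "\<not> f v b"
      and w: "w \<in> A" "y \<in> A" "f w c" "\<not> f y c" for b c u v w y
    by (rule isolated_value_if_cross_rigid [where P = "\<lambda>u. f u b" and Q = "\<lambda>u. f u c", OF A(1) u w])
      (rule two_rows [OF _ _ _ _ b])
  show "\<exists>z\<in>A. \<forall>b\<in>B. \<forall>u\<in>A - {z}. \<forall>v\<in>A - {z}. f u b \<longleftrightarrow> f v b"
  proof (cases "\<exists>b\<in>B. \<exists>u\<in>A. \<exists>v\<in>A. f u b \<and> \<not> f v b")
    case True
    then obtain b u v where b: "b \<in> B" and u: "u \<in> A" "v \<in> A" "f u b" "\<not> f v b" by blast
    then obtain c w y where c: "c \<in> B" "b \<noteq> c" and w: "w \<in> A" "y \<in> A" "f w c" "\<not> f y c"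
      using n by blast
    obtain z where z: "z \<in> A" "\<And>s t. s \<in> A - {z} \<Longrightarrow> t \<in> A - {z} \<Longrightarrow> f s b \<longleftrightarrow> f t b"
      using pair [OF b c u w] by metis
    have "f s d \<longleftrightarrow> f t d" if d: "d \<in> B" and s: "s \<in> A - {z}" "t \<in> A - {z}" for d s t
    proof (rule ccontr)
      assume st: "\<not> ?thesis"
      then have "b \<noteq> d" using z(2) [OF s] by auto
      moreover obtain s' t' where st': "s' \<in> A" "t' \<in> A" "f s' d" "\<not> f t' d" using s st by blast
      ultimately obtain z' where z': "z' \<in> A" "\<And>s t. s \<in> A - {z'} \<Longrightarrow> t \<in> A - {z'} \<Longrightarrow> f s b \<longleftrightarrow> f t b"
        "\<And>s t. s \<in> A - {z'} \<Longrightarrow> t \<in> A - {z'} \<Longrightarrow> f s d \<longleftrightarrow> f t d"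
        using pair [OF b d _ u st'] by metis
      have "z \<noteq> z'" using z'(3) s st by blast
      obtain w where w: "w \<in> A" "w \<noteq> z" "w \<noteq> z'" using big by blast
      have "f a b \<longleftrightarrow> f w b" if "a \<in> A" for a
        using z(2) [of a w] z'(2) [of a w] w that \<open>z \<noteq> z'\<close> by (cases "a = z") auto
      then show False using u by blast
    qed
    then show ?thesis using z(1) by blast
  next
    case False
    then show ?thesis using closed(1) by blast
  qed
qed

text \<open>In the hyperplane the nonzero points outside \<open>E\<close> are the
  \<open>a + d\<close> with \<open>a \<noteq> 0\<close>. The first condition treats the sum of such
  a point and a coset point, the second the sum of two coset points.\<close>

lemma cotriangle_freeI:
  assumes B2: "B = {0, d}" "d \<noteq> 0"
    and 1: "\<And>a b c. \<lbrakk>a \<in> A; b \<in> B; c \<in> A; c \<noteq> 0; \<not> f a b\<rbrakk> \<Longrightarrow> f (a + c) (b + d)"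
    and 2: "\<And>a b a' b'. \<lbrakk>a \<in> A; b \<in> B; a' \<in> A; b' \<in> B; \<not> f a b; \<not> f a' b'\<rbrakk> \<Longrightarrow> a = a' \<or> b = b'"
  shows "cotriangle_free U"
proof -
  have zero: "(\<exists>a\<in>A. a \<noteq> 0 \<and> u = a + d) \<or> (\<exists>a\<in>A. \<exists>b\<in>B. u = x + (a + b) \<and> \<not> f a b)"
    if u: "u \<in> U" "u \<noteq> 0" "u \<notin> E" for u
  proof -
    obtain a b where ab: "a \<in> A" "b \<in> B" "u = a + b \<or> u = x + (a + b)" using U_cases u(1) by metis
    from ab(3) show ?thesis
    proof
      assume "u = a + b"
      then show ?thesis using E_AB [OF ab(1,2)] ab B2 u by auto
    next
      assume "u = x + (a + b)"
      then show ?thesis using ab u by (auto simp: f_def)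
    qed
  qed
  have dB: "d \<in> B" using B2 by simp
  have mixed: "a + d + (x + (a' + b)) \<in> E" if "a \<in> A" "a \<noteq> 0" "a' \<in> A" "b \<in> B" "\<not> f a' b" for a a' b
  proof -
    have "x + (a' + a + (b + d)) \<in> E" using 1 that by (simp add: f_def)
    then show ?thesis by (simp add: f2_simps)
  qed
  show ?thesis
    unfolding cotriangle_free_def
  proof (intro ballI impI, rule ccontr)
    fix u v assume uv: "u \<in> U" "v \<in> U" "u \<noteq> 0" "v \<noteq> 0" "u \<noteq> v" and n: "\<not> (u \<in> E \<or> v \<in> E \<or> u + v \<in> E)"
    consider a a' where "a \<in> A" "a' \<in> A" "u = a + d" "v = a' + d"
      | a a' b where "a \<in> A" "a \<noteq> 0" "u = a + d" "a' \<in> A" "b \<in> B" "v = x + (a' + b)" "\<not> f a' b"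
      | a a' b where "a \<in> A" "a \<noteq> 0" "v = a + d" "a' \<in> A" "b \<in> B" "u = x + (a' + b)" "\<not> f a' b"
      | a b a' b' where "a \<in> A" "b \<in> B" "u = x + (a + b)" "\<not> f a b" "a' \<in> A" "b' \<in> B" "v = x + (a' + b')" "\<not> f a' b'"
      using zero [of u] zero [of v] uv n by metis
    then show False
    proof cases
      case 1
      then have e: "u + v = a + a'" and nz: "a + a' \<noteq> 0" using uv by (auto simp: f2_simps sum_zero_iff)
      have "a + a' \<notin> E" using n e by metis
      then show False using E_AB [of "a + a'" 0] 1(1,2) nz by simp
    next
      case 2 then show False using mixed n by metis
    next
      case 3 then show False using mixed [of a a' b] n by (simp add: add.commute)
    next
      case 4
      have e: "u + v = a + a' + (b + b')" using 4 by (simp add: f2_simps)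
      have "(a + a' = 0) \<noteq> (b + b' = 0)" using 2 [OF 4(1,2,5,6,4,8)] 4 uv by (auto simp: sum_zero_iff)
      moreover have "a + a' + (b + b') \<notin> E" using n e by metis
      ultimately show False using E_AB [of "a + a'" "b + b'"] 4(1,2,5,6) by simp
    qed
  qed
qed

lemma summand_if_constant:
  assumes "\<And>a b. a \<in> A \<Longrightarrow> b \<in> B \<Longrightarrow> f a b \<longleftrightarrow> c" "A \<noteq> {0}"
  shows "\<exists>D. summand U D"
proof -
  let ?H = "{a + b | a b. a \<in> A \<and> b \<in> B}"
  have H: "subspace ?H"
    unfolding subspace_iff
  proof (intro conjI ballI)
    have "0 + 0 \<in> ?H" using closed(1,2) by blast
    then show "0 \<in> ?H" by simp
    fix u v assume "u \<in> ?H" "v \<in> ?H"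
    then obtain a b a' b' where ab: "a \<in> A" "b \<in> B" "u = a + b" "a' \<in> A" "b' \<in> B" "v = a' + b'" by auto
    then have "u + v = (a + a') + (b + b')" by (simp add: f2_simps)
    then show "u + v \<in> ?H" using ab closed by blast
  qed
  have "u \<in> E \<longleftrightarrow> c" if "u \<in> U - ?H" for u
    using that U_cases [of u] assms(1) by (auto simp: f_def)
  moreover have "u + v \<in> U - ?H" if "u \<in> U - ?H" "v \<in> ?H" for u v
    using that subspaceD(4) [OF H that(2)] by auto
  ultimately have "\<forall>u\<in>U - ?H. \<forall>v\<in>?H. u + v \<in> E \<longleftrightarrow> u \<in> E" by blast
  moreover have "x \<notin> ?H" using x by auto
  then have "?H \<noteq> U" using closed(8) by blast
  moreover have "?H \<noteq> {0}"
  proof -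
    obtain a where a: "a \<in> A" "a \<noteq> 0" using assms(2) closed(1) by blast
    then have "a + 0 \<in> ?H" using closed(2) by blast
    then show ?thesis using a by auto
  qed
  moreover have "?H \<subseteq> U" by auto
  ultimately show ?thesis using H unfolding summand_def by blast
qed

lemma summand_if_clone:
  assumes "\<And>a b. a \<in> A \<Longrightarrow> b \<in> B \<Longrightarrow> a \<noteq> 0 \<or> b \<noteq> 0 \<Longrightarrow> f a b \<longleftrightarrow> (a = 0) \<noteq> (b = 0)" "A \<noteq> {0}"
  shows "\<exists>D. summand U D"
proof -
  have "u + x \<in> E \<longleftrightarrow> u \<in> E" if u: "u \<in> U" "u \<noteq> 0" "u \<noteq> x" for u
  proof -
    obtain a b where ab: "a \<in> A" "b \<in> B" "u = a + b \<or> u = x + (a + b)" using U_cases u(1) by metis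
    have "a \<noteq> 0 \<or> b \<noteq> 0" using ab(3) u by auto
    then have "x + (a + b) \<in> E \<longleftrightarrow> a + b \<in> E" using assms(1) E_AB ab by (simp add: f_def)
    moreover have "x + (a + b) + x = a + b" by (simp add: f2_simps)
    ultimately show ?thesis using ab(3) by (metis add.commute)
  qed
  moreover have "{0, x} \<noteq> U"
  proof -
    obtain a where "a \<in> A" "a \<noteq> 0" using assms(2) closed(1) by blast
    then show ?thesis using x(2) [of a 0] by auto
  qed
  moreover have "x \<noteq> 0" using x(2) [of 0 0] by simp
  moreover have "0 \<in> U" using U by (simp add: subspaceD)
  ultimately have "summand U {0, x}" unfolding summand_def using subspace_pair by auto
  then show ?thesis by blast
qed

text \<open>The coset meets \<open>E\<close> exactly in \<open>x + A\<close>, so \<open>x\<close>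
  joins \<open>A\<close>.\<close>

lemma PG_sum_extend:
  assumes f: "\<And>a b. a \<in> A \<Longrightarrow> b \<in> B \<Longrightarrow> f a b \<longleftrightarrow> b = 0" and "B \<noteq> {0}"
  shows "PG_sum U"
  unfolding PG_sum_def
proof (intro exI conjI)
  let ?A = "adjoin x A"
  show "subspace ?A" "subspace B" "B \<noteq> {0}" using A B assms by (auto intro: subspace_adjoin)
  have x0: "x \<noteq> 0" using x(2) [of 0 0] by simp
  show "?A \<noteq> {0}" using mem_adjoin [OF A(1), of x] x0 by auto
  have xB: "x + b \<notin> A" if "b \<in> B" for b
  proof
    assume "x + b \<in> A"
    then show False using x(2) [of "x + b" b] that by (simp add: add.assoc)
  qed
  show "?A \<inter> B = {0}" using AB xB by (auto simp: adjoin_iff)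
  have A_cases: "\<exists>a'\<in>A. a = a' \<or> a = x + a'" if "a \<in> ?A" for a
    using that by (cases rule: adjoinE) auto
  show "U = {a + b |a b. a \<in> ?A \<and> b \<in> B}"
  proof
    show "U \<subseteq> {a + b |a b. a \<in> ?A \<and> b \<in> B}"
    proof
      fix u assume "u \<in> U"
      then obtain a b where ab: "a \<in> A" "b \<in> B" "u = a + b \<or> u = x + (a + b)" using U_cases by metis
      have "a \<in> ?A" "x + a \<in> ?A" using ab by (auto simp: adjoin_iff)
      moreover have "x + (a + b) = x + a + b" by (simp add: add.assoc)
      ultimately show "u \<in> {a + b |a b. a \<in> ?A \<and> b \<in> B}" using ab by blast
    qed
    show "{a + b |a b. a \<in> ?A \<and> b \<in> B} \<subseteq> U"
      using A_cases by fastforce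
  qed
  show "E \<inter> U = ?A \<union> B - {0}"
  proof
    show "E \<inter> U \<subseteq> ?A \<union> B - {0}"
    proof
      fix u assume u: "u \<in> E \<inter> U"
      then obtain a b where ab: "a \<in> A" "b \<in> B" "u = a + b \<or> u = x + (a + b)" using U_cases by blast
      from ab(3) have "u \<in> A \<or> u \<in> B \<or> x + u \<in> A"
      proof
        assume "u = a + b"
        then show ?thesis using u ab E_AB [OF ab(1,2)] by (cases "a = 0") auto
      next
        assume "u = x + (a + b)"
        then show ?thesis using u ab f [OF ab(1,2)] by (auto simp: f_def)
      qed
      then show "u \<in> ?A \<union> B - {0}" using u by (auto simp: adjoin_iff)
    qed
    show "?A \<union> B - {0} \<subseteq> E \<inter> U"
    proof
      fix u assume u: "u \<in> ?A \<union> B - {0}"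
      then consider "u \<in> A" | "u \<in> B" | a where "a \<in> A" "u = x + a" using A_cases by blast
      then show "u \<in> E \<inter> U"
      proof cases
        case 1 then show ?thesis using E_AB [of u 0] u by auto
      next
        case 2 then show ?thesis using E_AB [of 0 u] u by auto
      next
        case 3 then show ?thesis using f [of a 0] by (auto simp: f_def)
      qed
    qed
  qed
qed

text \<open>By \<open>rectangle\<close> the entries of column 0 off row 0 all agree. If they lie in
  \<open>E\<close>, the coset copies the hyperplane and \<open>{0, x}\<close> is a summand;
  otherwise column 0 looks like the others and \<open>x\<close> extends the PG-sum.\<close>

lemma cross_shape:
  assumes g: "\<And>a b. a \<in> A \<Longrightarrow> b \<in> B \<Longrightarrow> a \<noteq> 0 \<Longrightarrow> f a b \<longleftrightarrow> b = 0" and nt: "A \<noteq> {0}" "B \<noteq> {0}"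
  shows "PG_sum U \<or> (\<exists>D. summand U D)"
proof -
  obtain a b where ab: "a \<in> A" "a \<noteq> 0" "b \<in> B" "b \<noteq> 0" using nt closed(1,2) by blast
  have h: "f 0 c" if "f 0 b'" "b' \<in> B" "b' \<noteq> 0" "c \<in> B" "c \<noteq> 0" for b' c
    using rectangle [of 0 a b' c] that g ab by (cases "b' = c") auto
  have h0: "f 0 0 \<or> f 0 b" using rectangle [of a 0 0 b] g ab by auto
  show ?thesis
  proof (cases "f 0 b")
    case True
    have "f a' b' \<longleftrightarrow> (a' = 0) \<noteq> (b' = 0)" if "a' \<in> A" "b' \<in> B" "a' \<noteq> 0 \<or> b' \<noteq> 0" for a' b'
      using that g [of a' b'] h [OF True ab(3,4), of b'] by (cases "a' = 0") auto
    then show ?thesis using summand_if_clone nt by blast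
  next
    case False
    have "f a' b' \<longleftrightarrow> b' = 0" if "a' \<in> A" "b' \<in> B" for a' b'
      using that g [of a' b'] h [of b' b] h0 False ab by (cases "a' = 0"; cases "b' = 0") auto
    then show ?thesis using PG_sum_extend nt by blast
  qed
qed

text \<open>Off column 0 only two values occur, \<open>g0\<close> in row 0 and \<open>g1\<close>
  elsewhere. If neither is in \<open>E\<close>, column 0 is constant by \<open>rectangle\<close>. If
  \<open>g1\<close> is in \<open>E\<close> and \<open>B\<close> has two distinct nonzero vectors,
  \<open>transversal\<close> fills an entry that should be empty; for \<open>B\<close> of size 2 the
  complement is triangle-free or a shift leads to \<open>cross_shape\<close>. The extra column
  \<open>c\<close> keeps \<open>c + a\<close>, \<open>c + a'\<close>, \<open>c + (a + a')\<close>,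
  whose sum is \<open>c\<close>, off column 0.\<close>

lemma product_shape:
  assumes g: "\<And>a b. a \<in> A \<Longrightarrow> b \<in> B \<Longrightarrow> a \<noteq> 0 \<Longrightarrow> f a b \<longleftrightarrow> (if b = 0 then g0 else g1)"
    and nt: "B \<noteq> {0}" and a: "a \<in> A" "a' \<in> A" "c \<in> A" "a \<noteq> 0" "a' \<noteq> 0" "a \<noteq> a'" "c \<notin> {0, a, a', a + a'}"
  shows "cotriangle_free U \<or> PG_sum U \<or> (\<exists>D. summand U D)"
proof -
  have ntA: "A \<noteq> {0}" using a by auto
  have anz: "a + a' \<noteq> 0" "c + a \<noteq> 0" "c + a' \<noteq> 0" "c + (a + a') \<noteq> 0" using a by (auto simp: sum_zero_iff)
  obtain b where b: "b \<in> B" "b \<noteq> 0" using nt closed(2) by blast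
  have B_cases: "B = {0, b} \<or> (\<exists>b'\<in>B. b' \<noteq> 0 \<and> b' \<noteq> b)" using b closed(2) by blast
  consider "\<not> g0" "\<not> g1" | "g0" "g1" | "g0" "\<not> g1" | "\<not> g0" "g1" by blast
  then show ?thesis
  proof cases
    case 1
    have h: "f 0 d" if "f 0 b'" "b' \<in> B" "d \<in> B" for b' d
      using rectangle [of 0 a b' d] that g a 1 by (cases "b' = d") (auto split: if_splits)
    show ?thesis
    proof (cases "f 0 0")
      case True
      interpret s: PG_hyperplane scale E U B A x by (rule swap)
      have "s.f b' a' \<longleftrightarrow> a' = 0" if "a' \<in> A" "b' \<in> B" for a' b'
      proof -
        have "s.f b' a' \<longleftrightarrow> f a' b'" unfolding f_def s.f_def by (simp add: add.commute)
        then show ?thesis using g [of a' b'] h [OF True _ that(2)] 1 that by (cases "a' = 0") auto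
      qed
      then show ?thesis using s.PG_sum_extend ntA by blast
    next
      case False
      have "\<not> f a' b'" if "a' \<in> A" "b' \<in> B" for a' b'
        using g [of a' b'] h [of b' 0] False 1 that by (cases "a' = 0") auto
      then show ?thesis using summand_if_constant [of False] ntA by blast
    qed
  next
    case 2
    show ?thesis
    proof (cases "\<exists>d\<in>B. \<not> f 0 d")
      case False
      have "f a' b'" if "a' \<in> A" "b' \<in> B" for a' b'
        using g [of a' b'] False 2 that by (cases "a' = 0") auto
      then show ?thesis using summand_if_constant [of True] ntA by blast
    next
      case True
      then obtain d where d: "d \<in> B" "\<not> f 0 d" by blast
      from B_cases show ?thesis
      proof
        assume "\<exists>b'\<in>B. b' \<noteq> 0 \<and> b' \<noteq> b"
        then obtain b' where b': "b' \<in> B" "b' \<noteq> 0" "b' \<noteq> b" by blast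
        have "f (a + a' + (a + a')) (d + b + (d + b') + (d + (b + b')))"
          by (rule transversal) (use a anz b b' d g 2 in \<open>auto simp: sum_zero_iff\<close>)
        moreover have "a + a' + (a + a') = 0" "d + b + (d + b') + (d + (b + b')) = d" by (simp_all add: f2_simps)
        ultimately show ?thesis using d by metis
      next
        assume B2: "B = {0, b}"
        have f1: "f a' b'" if "a' \<in> A" "a' \<noteq> 0" "b' \<in> B" for a' b' using g that 2 by simp
        have "cotriangle_free U"
        proof (rule cotriangle_freeI [OF B2 b(2)])
          fix p q r assume *: "p \<in> A" "q \<in> B" "r \<in> A" "r \<noteq> 0" "\<not> f p q"
          then have "p = 0" using f1 by blast
          then show "f (p + r) (q + b)" using f1 * b by simp
        next
          fix p q p' q' assume "p \<in> A" "q \<in> B" "p' \<in> A" "q' \<in> B" "\<not> f p q" "\<not> f p' q'"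
          then show "p = p' \<or> q = q'" using f1 by blast
        qed
        then show ?thesis by blast
      qed
    qed
  next
    case 3
    then have "PG_sum U \<or> (\<exists>D. summand U D)" using g nt ntA by (intro cross_shape) auto
    then show ?thesis by blast
  next
    case 4
    from B_cases show ?thesis
    proof
      assume "\<exists>b'\<in>B. b' \<noteq> 0 \<and> b' \<noteq> b"
      then obtain b' where b': "b' \<in> B" "b' \<noteq> 0" "b' \<noteq> b" by blast
      have "f (c + a + (c + a') + (c + (a + a'))) (b + b' + (b + b'))"
        by (rule transversal) (use a anz b b' g 4 in \<open>auto simp: sum_zero_iff\<close>)
      moreover have "c + a + (c + a') + (c + (a + a')) = c" "b + b' + (b + b') = 0" by (simp_all add: f2_simps)
      ultimately have "f c 0" by metis
      then show ?thesis using g [of c 0] 4 a by simp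
    next
      assume B2: "B = {0, b}"
      interpret s: PG_hyperplane scale E U A B "x + (0 + b)" using b by (intro shift) auto
      have "s.f p q \<longleftrightarrow> q = 0" if "p \<in> A" "q \<in> B" "p \<noteq> 0" for p q
      proof -
        have "s.f p q \<longleftrightarrow> f p (b + q)" unfolding f_def s.f_def by (simp add: f2_simps)
        then show ?thesis using g [of p "b + q"] that b B2 4 by (auto simp: sum_zero_iff)
      qed
      then have "PG_sum U \<or> (\<exists>D. summand U D)" using nt ntA by (intro s.cross_shape) auto
      then show ?thesis by blast
    qed
  qed
qed

text \<open>By \<open>rectangle\<close> all rows but row 0 lie in \<open>E\<close>. Three other rows
  would let \<open>transversal\<close> fill the empty entry at \<open>v\<close>, so \<open>B\<close>
  has only two elements.\<close>

lemma single_row: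
  assumes uv: "u \<in> A" "v \<in> A" "f u 0" "\<not> f v 0" and const: "\<And>b u v. \<lbrakk>b \<in> B; b \<noteq> 0; u \<in> A; v \<in> A\<rbrakk> \<Longrightarrow> f u b \<longleftrightarrow> f v b"
    and nt: "B \<noteq> {0}" and a: "a \<in> A" "a' \<in> A" "a \<noteq> 0" "a' \<noteq> 0" "a \<noteq> a'"
  shows "cotriangle_free U"
proof -
  have one: "f p b" if "p \<in> A" "b \<in> B" "b \<noteq> 0" for p b
  proof -
    have "u \<noteq> v" using uv by auto
    then have "f u b \<or> f v b" using rectangle [of u v 0 b] uv that by auto
    then show ?thesis using const that uv by blast
  qed
  obtain b where b: "b \<in> B" "b \<noteq> 0" using nt closed(2) by blast
  have B2: "B = {0, b}"
  proof (rule ccontr)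
    assume "B \<noteq> {0, b}"
    then obtain b' where b': "b' \<in> B" "b' \<noteq> 0" "b' \<noteq> b" using b closed(2) by blast
    have "a + a' \<noteq> 0" using a by (simp add: sum_zero_iff)
    then have "f (v + a + (v + a') + (v + (a + a'))) (b + b' + (b + b'))"
      by (intro transversal) (use a uv b b' one in \<open>auto simp: sum_zero_iff\<close>)
    moreover have "v + a + (v + a') + (v + (a + a')) = v" "b + b' + (b + b') = 0" by (simp_all add: f2_simps)
    ultimately show False using uv by metis
  qed
  show ?thesis
  proof (rule cotriangle_freeI [OF B2 b(2)])
    fix p q r assume *: "p \<in> A" "q \<in> B" "r \<in> A" "r \<noteq> 0" "\<not> f p q"
    then have "q = 0" using one by blast
    then show "f (p + r) (q + b)" using one * b by simp
  next
    fix p q p' q' assume "p \<in> A" "q \<in> B" "p' \<in> A" "q' \<in> B" "\<not> f p q" "\<not> f p' q'"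
    then show "p = p' \<or> q = q'" using one by metis
  qed
qed

text \<open>Eight elements of \<open>A\<close> supply independent \<open>a, a', e\<close>. If the
  exceptional column is common to all rows, a shift moves it to 0 and the nonzero columns coincide;
  comparing columns \<open>a\<close> and \<open>a'\<close> in the exchanged grid then isolates one
  row, which a second shift moves to 0. Otherwise a single row is nonconstant.\<close>

lemma extension_shape:
  assumes cA: "finite A" "8 \<le> card A" and nt: "B \<noteq> {0}"
  shows "cotriangle_free U \<or> PG_sum U \<or> (\<exists>D. summand U D)"
proof -
  have avoid: "\<exists>w\<in>A. w \<notin> S" if "finite S" "card S < 8" for S
    using card_mono [OF that(1), of A] that(2) cA(2) by (meson linorder_not_less order_trans subsetI)
  have c: "card {p, q, r, s} < 8" for p q r s :: 'a by (simp add: card_insert_if)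
  obtain a where a: "a \<in> A" "a \<noteq> 0" using avoid [of "{0}"] by auto
  obtain a' where a': "a' \<in> A" "a' \<noteq> 0" "a \<noteq> a'" using avoid [OF _ c [of 0 a a a]] by auto
  obtain e where e: "e \<in> A" "e \<notin> {0, a, a', a + a'}" using avoid [OF _ c [of 0 a a' "a + a'"]] by auto
  have big: "\<exists>w\<in>A. w \<noteq> u \<and> w \<noteq> v" for u v using avoid [OF _ c [of u v v v]] by auto
  from row_dichotomy [OF big] show ?thesis
  proof
    assume "\<exists>z\<in>A. \<forall>b\<in>B. \<forall>u\<in>A - {z}. \<forall>v\<in>A - {z}. f u b \<longleftrightarrow> f v b"
    then obtain z where z: "z \<in> A" "\<And>b u v. \<lbrakk>b \<in> B; u \<in> A - {z}; v \<in> A - {z}\<rbrakk> \<Longrightarrow> f u b \<longleftrightarrow> f v b" by blast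
    interpret s: PG_hyperplane scale E U A B "x + (z + 0)" using z by (intro shift) auto
    have s: "s.f u b \<longleftrightarrow> f (z + u) b" for u b unfolding f_def s.f_def by (simp add: f2_simps)
    have row: "s.f u b \<longleftrightarrow> s.f v b" if "b \<in> B" "u \<in> A" "v \<in> A" "u \<noteq> 0" "v \<noteq> 0" for b u v
      unfolding s using z that by (intro z(2)) auto
    interpret t: PG_hyperplane scale E U B A "x + (z + 0)" by (rule s.swap)
    have t: "t.f b u \<longleftrightarrow> s.f u b" for u b unfolding s.f_def t.f_def by (simp add: add.commute)
    have "\<exists>w\<in>B. \<forall>u\<in>B - {w}. \<forall>v\<in>B - {w}. s.f a u \<longleftrightarrow> s.f a v"
    proof (rule isolated_value_if_rigid [OF B(1)])
      fix p z q y
      assume *: "p \<in> B" "z \<in> B" "q \<in> B" "y \<in> B" "s.f a p" "\<not> s.f a z" "s.f a q" "\<not> s.f a y" "p + z = q + y"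
      have tf: "t.f p a" "\<not> t.f z a" "t.f q a'" "\<not> t.f y a'"
        using t [of p a] t [of z a] t [of q a'] t [of y a'] * row [OF *(3) a(1) a'(1) a(2) a'(2)] row [OF *(4) a(1) a'(1) a(2) a'(2)] by blast+
      have "p = q \<or> p = y" by (rule t.two_rows [OF *(1-4) a(1) a'(1,3) tf *(9)])
      then show "p = q" using * by blast
    qed
    then obtain w where w: "w \<in> B" "\<And>u v. u \<in> B - {w} \<Longrightarrow> v \<in> B - {w} \<Longrightarrow> s.f a u \<longleftrightarrow> s.f a v" by blast
    obtain b where b: "b \<in> B" "b \<noteq> 0" using nt closed(2) by blast
    interpret r: PG_hyperplane scale E U A B "x + (z + 0) + (0 + w)" using w by (intro s.shift) auto
    have r: "r.f u v \<longleftrightarrow> s.f u (w + v)" for u v unfolding r.f_def s.f_def by (simp add: f2_simps)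
    have "r.f u v \<longleftrightarrow> (if v = 0 then r.f a 0 else r.f a b)" if "u \<in> A" "v \<in> B" "u \<noteq> 0" for u v
    proof -
      have "r.f u v \<longleftrightarrow> r.f a v" unfolding r using row [of "w + v" u a] that a w by simp
      moreover have "r.f a v \<longleftrightarrow> r.f a b" if "v \<noteq> 0"
        unfolding r using w that \<open>v \<in> B\<close> b by (intro w(2)) auto
      ultimately show ?thesis by auto
    qed
    then show ?thesis by (rule r.product_shape [OF _ nt a(1) a'(1) e(1) a(2) a'(2,3) e(2)])
  next
    assume "\<exists>b0\<in>B. (\<exists>u\<in>A. \<exists>v\<in>A. f u b0 \<and> \<not> f v b0) \<and> (\<forall>b\<in>B - {b0}. \<forall>u\<in>A. \<forall>v\<in>A. f u b \<longleftrightarrow> f v b)"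
    then obtain d u v where d: "d \<in> B" "u \<in> A" "v \<in> A" "f u d" "\<not> f v d"
      and const: "\<And>b u v. \<lbrakk>b \<in> B; b \<noteq> d; u \<in> A; v \<in> A\<rbrakk> \<Longrightarrow> f u b \<longleftrightarrow> f v b" by blast
    interpret s: PG_hyperplane scale E U A B "x + (0 + d)" using d by (intro shift) auto
    have s: "s.f u b \<longleftrightarrow> f u (d + b)" for u b unfolding f_def s.f_def by (simp add: f2_simps)
    have "cotriangle_free U"
    proof (rule s.single_row [OF d(2,3) _ _ _ nt a(1) a'(1) a(2) a'(2,3)])
      show "s.f u 0" "\<not> s.f v 0" using d s [of u 0] s [of v 0] by simp_all
      show "s.f u b \<longleftrightarrow> s.f v b" if "b \<in> B" "b \<noteq> 0" "u \<in> A" "v \<in> A" for b u v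
        unfolding s using that d by (intro const) auto
    qed
    then show ?thesis by blast
  qed
qed

end

context f2_points
begin

lemma PG_hyperplane_exit:
  assumes U: "indecomposable U" "clawless U" and H: "subspace H" "finite H" "64 \<le> card H" "PG_sum H"
    and x: "x \<notin> H" "U = adjoin x H"
  shows "cotriangle_free U \<or> PG_sum U"
proof -
  obtain A B where A: "subspace A" and B: "subspace B" and nt: "A \<noteq> {0}" "B \<noteq> {0}" and AB: "A \<inter> B = {0}"
    and H_eq: "H = {a + b | a b. a \<in> A \<and> b \<in> B}" and EH: "E \<inter> H = A \<union> B - {0}"
    using H(4) by (auto simp: PG_sum_def)
  have sU: "subspace U" using U(1) by (rule indecomposableD)
  have HU: "H \<subseteq> U" unfolding x by (rule subset_adjoin)
  have z: "0 \<in> A" "0 \<in> B" using A B by (auto simp: subspaceD)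
  have AH: "a \<in> H" if "a \<in> A" for a
    using that z unfolding H_eq by (metis (mono_tags, lifting) add.right_neutral mem_Collect_eq)
  have BH: "b \<in> H" if "b \<in> B" for b
    using that z unfolding H_eq by (metis (mono_tags, lifting) add.left_neutral mem_Collect_eq)
  have E_AB: "a + b \<in> E \<longleftrightarrow> (a = 0) \<noteq> (b = 0)" if "a \<in> A" "b \<in> B" for a b
  proof -
    have "a + b \<in> H" using that H_eq by blast
    then have "a + b \<in> E \<longleftrightarrow> a + b \<in> A \<union> B - {0}" using EH by blast
    also have "\<dots> \<longleftrightarrow> (a = 0) \<noteq> (b = 0)"
      using that AB subspaceD(3) [OF A that(1), of b] subspaceD(4) [OF B that(2), of a]
      by (auto simp: sum_zero_iff)
    finally show ?thesis .
  qed
  have fin: "finite A" "finite B" using AH BH H(2) by (meson finite_subset subsetI)+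
  interpret P: PG_hyperplane scale E U A B x
  proof
    show "\<exists>a\<in>A. \<exists>b\<in>B. u = a + b \<or> u = x + (a + b)" if u: "u \<in> U" for u
      using u unfolding x(2)
    proof (cases rule: adjoinE)
      case 1 then show ?thesis unfolding H_eq by blast
    next
      case (2 h) then show ?thesis unfolding H_eq by blast
    qed
    show "x \<in> U" unfolding x(2) using H(1) by (rule mem_adjoin)
    show "x \<noteq> a + b" if "a \<in> A" "b \<in> B" for a b using x(1) that H_eq by blast
  qed (use sU U A B AB E_AB AH BH HU in auto)
  interpret S: PG_hyperplane scale E U B A x by (rule P.swap)
  have "H = (\<lambda>(a, b). a + b) ` (A \<times> B)" unfolding H_eq by auto
  then have "card H \<le> card (A \<times> B)" using fin by (metis card_image_le finite_SigmaI)
  \<comment> \<open>As \<open>7 * 7 < 64\<close>, one of \<open>A\<close>, \<open>B\<close> has at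
    least eight elements, as \<open>extension_shape\<close> requires.\<close>
  then have "64 \<le> card A * card B" using H(3) by (simp add: card_cartesian_product)
  moreover have "card A * card B \<le> 7 * 7" if "card A \<le> 7" "card B \<le> 7" using that by (rule mult_le_mono)
  ultimately have "8 \<le> card A \<or> 8 \<le> card B" by linarith
  then show ?thesis
    using P.extension_shape [OF fin(1) _ nt(2)] S.extension_shape [OF fin(2) _ nt(1)] U(1) indecomposableD(3) by blast
qed

section \<open>The induction\<close>

lemma card_le_if_index2:
  assumes "finite W" "subspace W'" "W' \<subseteq> W" "\<And>u v. u \<in> W \<Longrightarrow> v \<in> W \<Longrightarrow> u \<notin> W' \<Longrightarrow> v \<notin> W' \<Longrightarrow> u + v \<in> W'"
  shows "card W \<le> 2 * card W'"
proof (cases "W = W'")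
  case False
  then obtain t where t: "t \<in> W" "t \<notin> W'" using assms by blast
  have f: "finite W'" using assms by (meson finite_subset)
  have "W \<subseteq> adjoin t W'" using assms(4) t unfolding adjoin_def by blast
  then have "card W \<le> card (adjoin t W')" using finite_adjoin [OF f] by (intro card_mono)
  also have "\<dots> \<le> 2 * card W'" using f by (rule card_adjoin_le)
  finally show ?thesis .
qed simp

text \<open>Passing to perpendicular vectors at most halves a subspace, so 32 points leave room for
  three independent, mutually perpendicular vectors. On their span the indicator of \<open>E\<close>
  is additive and has a kernel of dimension at least 2, which contains a triangle avoiding
  \<open>E\<close>.\<close>

lemma quadratic_cotriangle_free_bound:
  assumes R: "subspace R" "finite R" "quadratic R" "cotriangle_free R"
  shows "card R < 32"
proof (rule ccontr)
  assume "\<not> ?thesis"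
  then have c0: "32 \<le> card R" by simp
  have add: "polar a (b + c) \<longleftrightarrow> polar a b \<noteq> polar a c" if "a \<in> R" "b \<in> R" "c \<in> R" for a b c
    using R(3) that by (simp add: quadratic_def)
  define perp where "perp a W = {v \<in> W. \<not> polar a v}" for a W
  have perp: "subspace (perp a W) \<and> card W \<le> 2 * card (perp a W)"
    if a: "a \<in> R" and W: "subspace W" "W \<subseteq> R" for a W
  proof
    have cl: "u + v \<in> W" if "u \<in> W" "v \<in> W" for u v using W(1) that by (rule subspaceD)
    show s: "subspace (perp a W)"
      using W a cl add subspaceD(1) [OF W(1)] by (auto simp: perp_def subspace_iff subset_iff)
    have "finite W" using R W by (meson finite_subset)
    then show "card W \<le> 2 * card (perp a W)"
      using s by (rule card_le_if_index2) (use W a cl add in \<open>auto simp: perp_def subset_iff\<close>)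
  qed
  have pick: "\<exists>w\<in>W. w \<notin> S" if "finite S" "card S < card W" for S and W :: "'a set"
    using card_mono [OF that(1), of W] that(2) by (meson linorder_not_less subsetI)
  obtain a where a: "a \<in> R" "a \<noteq> 0" using pick [of "{0}" R] c0 by auto
  define W where "W = perp a R"
  have W: "subspace W" "16 \<le> card W" "W \<subseteq> R" using perp [OF a(1) R(1)] c0 by (auto simp: W_def perp_def)
  obtain b where b: "b \<in> W" "b \<notin> {0, a}" using pick [of "{0, a}" W] W a by auto
  define W' where "W' = perp b W"
  have W': "subspace W'" "8 \<le> card W'" "W' \<subseteq> W"
    using perp [of b, OF _ W(1,3)] b W by (auto simp: W'_def perp_def)
  have "card {0, a, b, a + b} < card W'" using W' by (auto simp: card_insert_if)
  from pick [OF _ this] obtain c where c: "c \<in> W'" "c \<notin> {0, a, b, a + b}" by auto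
  have pol: "\<not> polar a b" "\<not> polar a c" "\<not> polar b c" and abc: "b \<in> R" "c \<in> R"
    using b c W W' by (auto simp: W_def W'_def perp_def)
  have cl: "u + v \<in> R" if "u \<in> R" "v \<in> R" for u v using R(1) that by (rule subspaceD)
  have nz: "a + b \<noteq> 0" "a + c \<noteq> 0" "b + c \<noteq> 0" "a + b + c \<noteq> 0" "b \<noteq> 0" "c \<noteq> 0"
    using a b c by (auto simp: sum_zero_iff)
  have val: "a + b \<in> E \<longleftrightarrow> (a \<in> E) \<noteq> (b \<in> E)" "a + c \<in> E \<longleftrightarrow> (a \<in> E) \<noteq> (c \<in> E)"
    "b + c \<in> E \<longleftrightarrow> (b \<in> E) \<noteq> (c \<in> E)" "a + b + c \<in> E \<longleftrightarrow> (a \<in> E) \<noteq> ((b \<in> E) \<noteq> (c \<in> E))"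
    using pol E_sum [of a "b + c"] add [OF a(1) abc] by (auto simp: E_sum add.assoc)
  have T: "u \<in> E \<or> v \<in> E \<or> w \<in> E"
    if "u \<in> R" "v \<in> R" "u \<noteq> 0" "v \<noteq> 0" "w \<noteq> 0" "u + v = w" for u v w
    using R(4) that unfolding cotriangle_free_def by (metis add_self)
  have "a \<in> E \<or> b \<in> E \<or> a + b \<in> E" "a \<in> E \<or> c \<in> E \<or> a + c \<in> E" "b \<in> E \<or> c \<in> E \<or> b + c \<in> E"
    "a \<in> E \<or> b + c \<in> E \<or> a + b + c \<in> E" "b \<in> E \<or> a + c \<in> E \<or> a + b + c \<in> E"
    "c \<in> E \<or> a + b \<in> E \<or> a + b + c \<in> E" "a + b \<in> E \<or> a + c \<in> E \<or> b + c \<in> E"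
    by (rule T; use a abc nz cl in \<open>simp add: f2_simps\<close>)+
  then show False using val by blast
qed

text \<open>Cardinalities below \<open>512 = 2 ^ 9\<close> mean dimension at most 8. A larger
  \<open>U\<close> has hyperplanes of at least 256 elements, and two of them share at least 128,
  which \<open>clash\<close> compares with the bound of
  \<open>quadratic_cotriangle_free_bound\<close>.\<close>

lemma structure_induction:
  assumes base: "\<And>U. \<lbrakk>subspace U; finite U; card U < 512; clawless U\<rbrakk> \<Longrightarrow>
      quadratic U \<or> cotriangle_free U \<or> PG_sum U \<or> (\<exists>D. summand U D)"
    and U: "subspace U" "finite U" "clawless U"
  shows "quadratic U \<or> cotriangle_free U \<or> PG_sum U \<or> (\<exists>D. summand U D)"
  using U
proof (induction "card U" arbitrary: U rule: less_induct)
  case less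
  show ?case
  proof (rule ccontr)
    assume "\<not> ?case"
    then have no: "\<not> quadratic U" "\<not> cotriangle_free U" "\<not> PG_sum U" "\<nexists>D. summand U D" by auto
    have big: "512 \<le> card U" using base [OF less.prems(1,2) _ less.prems(3)] no by (meson not_less)
    have "\<exists>w\<in>U. w \<notin> {0, v}" for v
    proof -
      have "card {0, v} < card U" using big by (auto simp: card_insert_if)
      then show ?thesis using card_mono [of "{0, v}" U] by (meson finite.intros linorder_not_less subsetI)
    qed
    then have "\<exists>a\<in>U. \<exists>b\<in>U. a \<noteq> 0 \<and> b \<noteq> 0 \<and> a \<noteq> b" by (metis insert_iff)
    then have ind: "indecomposable U" using no less.prems by (simp add: indecomposable_def)
    \<comment> \<open>The bound 16 admits both the span of a complement of a claw and its extension
      by one further point.\<close>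
    have hyper: "\<exists>H x. K \<subseteq> H \<and> indecomposable H \<and> x \<in> U \<and> x \<notin> H \<and> U = adjoin x H \<and> finite H \<and> 256 \<le> card H
        \<and> (quadratic H \<or> cotriangle_free H)"
      if K: "indecomposable K" "K \<subseteq> U" "card K \<le> 16" for K
    proof -
      have "K \<subset> U" using K big by auto
      then obtain H x where H: "K \<subseteq> H" "indecomposable H" "x \<in> U" "x \<notin> H" "U = adjoin x H"
        using exists_indecomposable_hyperplane [OF ind less.prems(3,2) no(2,1) K(1)] by blast
      have HU: "H \<subset> U" using H subset_adjoin by blast
      then have f: "finite H" "card H < card U" using less.prems(2) by (auto intro: finite_subset psubset_card_mono)
      have c: "256 \<le> card H" using card_adjoin_le [OF f(1), of x] big H(5) by simp
      have sH: "subspace H" using H(2) by (rule indecomposableD)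
      have "quadratic H \<or> cotriangle_free H \<or> PG_sum H \<or> (\<exists>D. summand H D)"
        using less.hyps [OF f(2) sH f(1)] clawless_subset [OF less.prems(3)] HU by blast
      moreover have "\<not> PG_sum H"
        using PG_hyperplane_exit [OF ind less.prems(3) sH f(1) _ _ H(4,5)] c no by fastforce
      moreover have "\<nexists>D. summand H D" using H(2) indecomposableD(3) by blast
      ultimately show ?thesis using H f c by blast
    qed
    have clash: False if H: "U = adjoin x H" "subspace H" "finite H" "256 \<le> card H" "quadratic H"
      and H': "U = adjoin x' H'" "subspace H'" "cotriangle_free H'" for H x H' x'
    proof -
      let ?V = "H \<inter> H'"
      have s: "subspace ?V" using H(2) H'(2) by (rule subspace_inter)
      have HU: "H \<subseteq> U" using H(1) subset_adjoin by blast
      have out: "u + v \<in> H'" if uv: "u \<in> U" "v \<in> U" "u \<notin> H'" "v \<notin> H'" for u v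
      proof -
        have "x' + u \<in> H'" "x' + v \<in> H'" using uv H'(1) by (auto simp: adjoin_iff)
        then have "x' + u + (x' + v) \<in> H'" by (rule subspaceD(2) [OF H'(2)])
        then show ?thesis by (simp add: f2_simps)
      qed
      have "card H \<le> 2 * card ?V"
        using H(3) s by (rule card_le_if_index2) (use HU out H(2) in \<open>auto simp: subspaceD\<close>)
      moreover have "quadratic ?V" using H(5) by (rule quadratic_subset) simp
      moreover have "cotriangle_free ?V" using H'(3) by (auto simp: cotriangle_free_def)
      ultimately show False using quadratic_cotriangle_free_bound [OF s] H by fastforce
    qed
    have small: "adjoin w (hull3 a b c) \<subseteq> U \<and> card (adjoin w (hull3 a b c)) \<le> 16"
      if "a \<in> U" "b \<in> U" "c \<in> U" "w \<in> U" for a b c w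
      using card_adjoin_le [OF card_hull3(1), of w a b c] card_hull3(2) [of a b c] that
        adjoin_subset [OF less.prems(1) hull3_least [OF less.prems(1) that(1-3)] that(4)] by linarith
    obtain a b c where abc: "a \<in> U" "b \<in> U" "c \<in> U" "coclaw a b c"
      using exists_coclaw [OF ind less.prems(3,2)] by blast
    have "hull3 a b c \<subseteq> U" using abc less.prems(1) by (intro hull3_least)
    then obtain H x where H: "indecomposable H" "x \<notin> H" "U = adjoin x H" "finite H" "256 \<le> card H"
      and HQT: "quadratic H \<or> cotriangle_free H"
      using hyper [OF coclaw_hull3 [OF abc(4)]] card_hull3(2) [of a b c] by fastforce
    have sH: "subspace H" and HU: "H \<subseteq> U" using H(1,3) indecomposableD(1) subset_adjoin by auto
    from HQT show False
    proof
      assume Q: "quadratic H"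
      have "8 < card H" using H(5) by simp
      then obtain a b c w where e: "a \<in> H" "b \<in> H" "c \<in> H" "w \<in> U - H"
        "indecomposable (adjoin w (hull3 a b c))" "\<not> quadratic (adjoin w (hull3 a b c))"
        using quadratic_hyperplane_exit [OF ind no(1) H(1) Q H(4) _ H(2,3)] by blast
      then obtain H' x' where H': "adjoin w (hull3 a b c) \<subseteq> H'" "indecomposable H'" "U = adjoin x' H'"
        "quadratic H' \<or> cotriangle_free H'"
        using hyper [OF e(5)] small [of a b c w] HU by blast
      then have "cotriangle_free H'" using e(6) quadratic_subset by blast
      then show False using clash [OF H(3) sH H(4,5) Q H'(3)] H'(2) indecomposableD(1) by blast
    next
      assume T: "cotriangle_free H"
      obtain a b c w where e: "a \<in> H" "b \<in> H" "c \<in> H" "w \<in> U - H"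
        "indecomposable (adjoin w (hull3 a b c))" "\<not> cotriangle_free (adjoin w (hull3 a b c))"
        using cotriangle_free_hyperplane_exit [OF less.prems(3) ind no(2) H(1) T H(2,3)] by blast
      then obtain H' x' where H': "adjoin w (hull3 a b c) \<subseteq> H'" "indecomposable H'" "U = adjoin x' H'"
        "finite H'" "256 \<le> card H'" "quadratic H' \<or> cotriangle_free H'"
        using hyper [OF e(5)] small [of a b c w] HU by blast
      then have "quadratic H'" using e(6) unfolding cotriangle_free_def by blast
      then show False using clash [OF H'(3) indecomposableD(1) [OF H'(2)] H'(4,5) _ H(3) sH T] by blast
    qed
  qed
qed

section \<open>Translation to matroids\<close>

lemma finite_span: "finite B \<Longrightarrow> finite (span B)"
  by (induction B rule: finite_induct) (simp_all add: span_insert_adjoin finite_adjoin)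

lemma card_span_independent: "finite B \<Longrightarrow> independent B \<Longrightarrow> card (span B) = 2 ^ card B"
proof (induction B rule: finite_induct)
  case (insert b B)
  then have B: "independent B" "b \<notin> span B" by (auto simp: independent_insert)
  have "adjoin b (span B) = span B \<union> (+) b ` span B"
    by (auto simp: adjoin_iff image_iff) (metis add_self_left)
  moreover have "span B \<inter> (+) b ` span B = {}"
    using B(2) subspaceD(4) [OF subspace_span] by blast
  ultimately show ?case
    using insert B finite_span [of B] by (simp add: span_insert_adjoin card_Un_disjoint card_image)
qed simp

lemma span_pair: "span {b, a} = {0, a, b, a + b}"
proof -
  have "span {a} = {0, a}"
    by (auto simp: span_insert_adjoin [of a "{}"] adjoin_iff sum_zero_iff)
  then have "span {b, a} = adjoin b {0, a}" by (simp add: span_insert_adjoin)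
  also have "\<dots> = {0, a, b, a + b}"
    by (auto simp: adjoin_iff sum_zero_iff)
  finally show ?thesis .
qed

lemma span_triple: "span {c, b, a} = hull3 a b c"
proof -
  have "span {a} = {0, a}"
    by (auto simp: span_insert_adjoin [of a "{}"] adjoin_iff sum_zero_iff)
  then show ?thesis by (simp add: span_insert_adjoin hull3_def)
qed

lemma independent_pair_iff: "independent {b, a} \<and> b \<noteq> a \<longleftrightarrow> a \<noteq> 0 \<and> b \<noteq> 0 \<and> b \<noteq> a"
  using span_insert_adjoin [of a "{}"]
  by (auto simp: independent_insert adjoin_iff sum_zero_iff)

text \<open>The cardinality excludes coinciding vectors, which the set would merge silently.\<close>

lemma independent_triple_iff:
  "independent {c, b, a} \<and> card {c, b, a} = 3 \<longleftrightarrow> a \<noteq> 0 \<and> b \<notin> {0, a} \<and> c \<notin> {0, a, b, a + b}"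
proof
  assume i: "independent {c, b, a} \<and> card {c, b, a} = 3"
  then have d: "c \<noteq> b" "c \<noteq> a" "b \<noteq> a" by (auto simp: card_insert_if split: if_splits)
  then have "independent {b, a}" "c \<notin> span {b, a}" using i by (auto simp: independent_insert [of c])
  then show "a \<noteq> 0 \<and> b \<notin> {0, a} \<and> c \<notin> {0, a, b, a + b}"
    using d independent_pair_iff [of b a] by (simp add: span_pair)
next
  assume n: "a \<noteq> 0 \<and> b \<notin> {0, a} \<and> c \<notin> {0, a, b, a + b}"
  then have "independent {b, a}" "c \<notin> span {b, a}" using independent_pair_iff [of b a] by (auto simp: span_pair)
  then show "independent {c, b, a} \<and> card {c, b, a} = 3" using n by (auto simp: independent_insert [of c])
qed

lemma subspace_dim_2:
  assumes "subspace S" "dim S = 2"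
  obtains a b where "a \<noteq> 0" "b \<noteq> 0" "b \<noteq> a" "S = {0, a, b, a + b}"
proof -
  obtain B where B: "B \<subseteq> S" "independent B" "S \<subseteq> span B" "card B = 2" using basis_exists [of S] assms(2) by metis
  then obtain b a where ab: "B = {b, a}" "b \<noteq> a" by (meson card_2_iff)
  have "S = span B" using B assms(1) span_minimal by blast
  then show thesis using that [of a b] ab B(2) independent_pair_iff [of b a] by (simp add: span_pair)
qed

lemma subspace_dim_3:
  assumes "subspace S" "dim S = 3"
  obtains a b c where "a \<noteq> 0" "b \<notin> {0, a}" "c \<notin> {0, a, b, a + b}" "S = hull3 a b c"
proof -
  obtain B where B: "B \<subseteq> S" "independent B" "S \<subseteq> span B" "card B = 3" using basis_exists [of S] assms(2) by metis
  then obtain c b a where abc: "B = {c, b, a}" by (meson card_3_iff)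
  have "S = span B" using B assms(1) span_minimal by blast
  then show thesis using that [of a b c] abc B(2,4) independent_triple_iff [of c b a] by (simp add: span_triple)
qed

lemma dim_hull3:
  assumes "a \<noteq> 0" "b \<notin> {0, a}" "c \<notin> {0, a, b, a + b}"
  shows "dim (hull3 a b c) = 3"
  using assms independent_triple_iff [of c b a] dim_span_eq_card_independent [of "{c, b, a}"]
  by (simp add: span_triple)

lemma even_card_hull3:
  assumes "a \<noteq> 0" "b \<notin> {0, a}" "c \<notin> {0, a, b, a + b}"
  shows "even (card (E \<inter> (hull3 a b c - {0}))) \<longleftrightarrow> \<not> odd_coset a b c"
proof -
  let ?S = "{a, b, c, a + b, a + c, b + c, a + b + c}"
  have nz: "a \<noteq> 0" "b \<noteq> 0" "c \<noteq> 0" "a \<noteq> b" "a \<noteq> c" "b \<noteq> c" "a + b \<noteq> c" "a + b \<noteq> 0" "a + c \<noteq> 0" "b + c \<noteq> 0"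
    using assms by (auto simp: sum_zero_iff)
  have ne: "a + c \<noteq> b" "b + c \<noteq> a" "a + b + c \<noteq> 0"
    using nz by (metis add.commute add.left_commute add_self_left sum_zero_iff)+
  have "hull3 a b c - {0} = ?S" using nz ne by (auto simp: hull3_iff)
  moreover have "card (E \<inter> ?S) = (\<Sum>v\<in>?S. if v \<in> E then 1 else 0)"
    by (simp add: sum.If_cases Int_commute)
  \<comment> \<open>A list without repetitions turns the cardinality into seven explicit indicators,
    whose parity is the formula \<open>odd_coset\<close>.\<close>
  moreover have "distinct [a, b, c, a + b, a + c, b + c, a + b + c]"
    using nz ne by (auto simp: add.assoc f2_simps)
  then have "(\<Sum>v\<in>?S. if v \<in> E then 1 else 0 :: nat) = (\<Sum>v\<leftarrow>[a, b, c, a + b, a + c, b + c, a + b + c]. if v \<in> E then 1 else 0)"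
    using sum_list_distinct_conv_sum_set [of _ "\<lambda>v. if v \<in> E then 1 else 0 :: nat"] by simp
  ultimately show ?thesis
    unfolding odd_coset_def polar_def by simp
qed

context
  fixes U :: "'a set" and M :: "'a bmatroid"
  assumes U: "subspace U" "finite U" and M: "M = (E \<inter> U, U - {0})"
begin

lemma V_Diff: "subspace D \<Longrightarrow> V (D - {0}) = D"
  by (auto simp: subspaceD)

lemma flat_iff: "flat (snd M) F \<longleftrightarrow> (\<exists>D. subspace D \<and> D \<subseteq> U \<and> F = D - {0})"
proof
  assume "flat (snd M) F"
  then have "subspace (V F)" "V F \<subseteq> U" "F = V F - {0}" using U by (auto simp: flat_def M subspaceD)
  then show "\<exists>D. subspace D \<and> D \<subseteq> U \<and> F = D - {0}" by blast
next
  assume "\<exists>D. subspace D \<and> D \<subseteq> U \<and> F = D - {0}"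
  then obtain D where D: "subspace D" "D \<subseteq> U" "F = D - {0}" by blast
  then show "flat (snd M) F" using V_Diff [OF D(1)] by (auto simp: flat_def M)
qed

lemma geometry_Diff:
  assumes "subspace D" "D \<subseteq> U"
  shows "geometry (D - {0})"
proof -
  have "finite D" using U(2) assms(2) by (rule rev_finite_subset)
  moreover have "span D = D" using assms(1) by simp
  ultimately show ?thesis
    unfolding geometry_def V_Diff [OF assms(1)] using assms(1) by blast
qed

lemma matroid_M: "matroid M"
  using geometry_Diff [OF U(1) order_refl] by (auto simp: matroid_def M)

lemma gdim_le_8:
  assumes "card U < 512"
  shows "gdim (snd M) \<le> 8"
proof -
  obtain B where B: "B \<subseteq> U" "independent B" "U \<subseteq> span B" "card B = dim U" using basis_exists by metis
  have "U = span B" using B U(1) span_minimal by blast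
  moreover have "finite B" using B(1) U(2) by (rule finite_subset)
  ultimately have "2 ^ dim U < (2 :: nat) ^ 9" using card_span_independent [of B] B assms by simp
  then have "dim U < 9" by (simp only: power_strict_increasing_iff) 
  then show ?thesis unfolding gdim_def M snd_conv V_Diff [OF U(1)] by simp
qed

text \<open>A violating triple spans a restriction that is itself a claw, so the identity is the
  isomorphism. Conversely, the basis of an abstract claw is pulled back along \<open>f\<close>; sums
  of the preimages avoid \<open>E\<close> because \<open>f\<close> sends them off the basis.\<close>

lemma claw_free_iff: "claw_free M \<longleftrightarrow> clawless U"
proof
  assume cf: "claw_free M"
  show "clawless U"
    unfolding clawless_def
  proof (intro ballI impI, rule ccontr)
    fix p q r assume p: "p \<in> E \<inter> U" "q \<in> E \<inter> U" "r \<in> E \<inter> U" "p \<noteq> q" "p \<noteq> r" "q \<noteq> r"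
      and n: "\<not> (p + q \<in> E \<or> p + r \<in> E \<or> q + r \<in> E \<or> p + q + r \<in> E)"
    let ?H = "hull3 p q r"
    let ?C = "restriction M (?H - {0})"
    have H: "subspace ?H" "?H \<subseteq> U" using p hull3_props hull3_least [OF U(1), of p q r] by auto
    have g: "p \<noteq> 0" "q \<notin> {0, p}" "r \<notin> {0, p, q, p + q}" using p n by auto
    have E: "fst ?C = {r, q, p}"
      using p n H(2) by (auto simp: restriction_def M hull3_iff)
    have s: "snd ?C = ?H - {0}" by (simp add: restriction_def)
    have "matroid ?C" using geometry_Diff [OF H] by (auto simp: matroid_def restriction_def)
    moreover have "gdim (snd ?C) = 3" using dim_hull3 [OF g] unfolding s gdim_def V_Diff [OF H(1)] .
    moreover have "independent (fst ?C)" unfolding E using independent_triple_iff [of r q p] g by blast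
    moreover have "span (fst ?C) = V (snd ?C)" unfolding E s V_Diff [OF H(1)] by (rule span_triple)
    ultimately have "claw ?C" by (simp add: claw_def)
    moreover have "isomorphic ?C ?C" unfolding isomorphic_def by (rule exI [of _ id]) auto
    moreover have "flat (snd M) (?H - {0})" using H flat_iff by blast
    ultimately show False using cf unfolding claw_free_def by blast
  qed
next
  assume cl: "clawless U"
  show "claw_free M"
    unfolding claw_free_def
  proof
    assume "\<exists>F C. flat (snd M) F \<and> claw C \<and> isomorphic (restriction M F) C"
    then obtain F C where F: "flat (snd M) F" and C: "claw C" and iso: "isomorphic (restriction M F) C" by blast
    obtain D where D: "subspace D" "D \<subseteq> U" "F = D - {0}" using F flat_iff by blast
    have "V F = D" using V_Diff [OF D(1)] D(3) by simp
    then obtain f where f: "bij_betw f D (V (snd C))" "\<And>x y. x \<in> D \<Longrightarrow> y \<in> D \<Longrightarrow> f (x + y) = f x + f y"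
      "f ` (E \<inter> U \<inter> F) = fst C"
      using iso unfolding isomorphic_def by (auto simp: restriction_def M)
    have ind: "independent (fst C)" and card: "card (fst C) = 3"
      using C dim_span_eq_card_independent [of "fst C"] by (auto simp: claw_def gdim_def)
    then obtain c b a where abc: "fst C = {c, b, a}" by (meson card_3_iff)
    then have g: "a \<noteq> 0" "b \<notin> {0, a}" "c \<notin> {0, a, b, a + b}"
      using independent_triple_iff [of c b a] ind card by auto
    then have ab: "a \<noteq> b" "a \<noteq> c" "b \<noteq> c" by auto
    have "a \<in> f ` (E \<inter> U \<inter> F)" "b \<in> f ` (E \<inter> U \<inter> F)" "c \<in> f ` (E \<inter> U \<inter> F)" using f(3) abc by auto
    then obtain p q r where p: "p \<in> E \<inter> U \<inter> F" "q \<in> E \<inter> U \<inter> F" "r \<in> E \<inter> U \<inter> F"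
      and fp: "f p = a" "f q = b" "f r = c" by auto
    have pD: "p \<in> D" "q \<in> D" "r \<in> D" using p D(3) by auto
    have val: "f v \<in> {c, b, a}" if "v \<in> E" "v \<in> D" for v
    proof -
      have "v \<in> E \<inter> U \<inter> F" using that D by auto
      then show ?thesis using f(3) abc by blast
    qed
    have pq: "p + q \<in> D" "p + r \<in> D" "q + r \<in> D" "p + q + r \<in> D" using pD D(1) by (auto simp: subspaceD)
    have fs: "f (p + q) = a + b" "f (p + r) = a + c" "f (q + r) = b + c" "f (p + q + r) = a + b + c"
      using f(2) pD pq fp by auto
    have 1: "a + b \<notin> {c, b, a}" "a + c \<notin> {c, b, a}" "b + c \<notin> {c, b, a}" "a + b + c \<notin> {c, b, a}"
    proof -
      have "c = a + b" if "a + c = b" using that by (metis add.commute add_self_left)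
      moreover have "c = a + b" if "b + c = a" using that by (metis add.commute add_self_left)
      moreover have "b = a" if "a + b + c = c" using that by (simp add: sum_zero_iff)
      moreover have "c = a" if "a + b + c = b" using that by (metis add.assoc add.commute add_left_cancel add.right_neutral sum_zero_iff)
      moreover have "c = b" if "a + b + c = a" using that by (simp add: add.assoc sum_zero_iff)
      ultimately show "a + b \<notin> {c, b, a}" "a + c \<notin> {c, b, a}" "b + c \<notin> {c, b, a}" "a + b + c \<notin> {c, b, a}"
        using g by auto
    qed
    have "p + q \<notin> E" "p + r \<notin> E" "q + r \<notin> E" "p + q + r \<notin> E"
      using val [of "p + q"] val [of "p + r"] val [of "q + r"] val [of "p + q + r"] pq 1 unfolding fs by blast+
    moreover have "p \<noteq> q" "p \<noteq> r" "q \<noteq> r" using fp ab by auto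
    ultimately show False using cl p unfolding clawless_def by blast
  qed
qed

text \<open>Dependent triples never satisfy \<open>odd_coset\<close>, so only triples spanning a
  plane matter, and for these \<open>even_card_hull3\<close> does the counting.\<close>

lemma even_plane_iff: "even_plane M \<longleftrightarrow> quadratic U"
proof
  assume ev: "even_plane M"
  show "quadratic U"
    unfolding quadratic_def odd_coset_iff [symmetric]
  proof (intro ballI)
    fix a b c assume abc: "a \<in> U" "b \<in> U" "c \<in> U"
    have "\<not> odd_coset a b c"
    proof (cases "a \<noteq> 0 \<and> b \<notin> {0, a} \<and> c \<notin> {0, a, b, a + b}")
      case True
      let ?H = "hull3 a b c"
      have H: "subspace ?H" "?H \<subseteq> U" using hull3_props hull3_least [OF U(1) abc] by auto
      have "flat (snd M) (?H - {0})" using H flat_iff by blast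
      moreover have "gdim (?H - {0}) = 3" unfolding gdim_def V_Diff [OF H(1)] using True by (intro dim_hull3) auto
      ultimately have "even (card (fst M \<inter> (?H - {0})))" using ev by (auto simp: even_plane_def plane_def)
      moreover have "fst M \<inter> (?H - {0}) = E \<inter> (?H - {0})" using H by (auto simp: M)
      ultimately show ?thesis using even_card_hull3 [of a b c] True by simp
    next
      case False
      then consider "a = 0" | "b = 0" | "b = a" | "c = 0" | "c = a" | "c = b" | "c = a + b" by blast
      then show ?thesis
        by cases (auto simp: odd_coset_def polar_def f2_simps)
    qed
    then show "polar a (b + c) = (polar a b \<noteq> polar a c)" by (simp add: odd_coset_iff)
  qed
next
  assume q: "quadratic U"
  show "even_plane M"
    unfolding even_plane_def
  proof (intro allI impI)
    fix P assume P: "plane (snd M) P"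
    then obtain D where D: "subspace D" "D \<subseteq> U" "P = D - {0}" using flat_iff by (auto simp: plane_def)
    then have "dim D = 3" using P V_Diff [OF D(1)] by (simp add: plane_def gdim_def)
    then obtain a b c where abc: "a \<noteq> 0" "b \<notin> {0, a}" "c \<notin> {0, a, b, a + b}" "D = hull3 a b c"
      by (rule subspace_dim_3 [OF D(1)])
    have "a \<in> U" "b \<in> U" "c \<in> U" using D(2) hull3_props abc(4) by auto
    then have "\<not> odd_coset a b c" using q by (simp add: odd_coset_iff quadratic_def)
    then have "even (card (E \<inter> (hull3 a b c - {0})))" using even_card_hull3 [OF abc(1-3)] by blast
    moreover have "fst M \<inter> P = E \<inter> (hull3 a b c - {0})" using D abc by (auto simp: M)
    ultimately show "even (card (fst M \<inter> P))" by simp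
  qed
qed

lemma triangle_free_iff: "triangle_free (matroid_complement M) \<longleftrightarrow> cotriangle_free U"
proof
  assume tf: "triangle_free (matroid_complement M)"
  show "cotriangle_free U"
    unfolding cotriangle_free_def
  proof (intro ballI impI, rule ccontr)
    fix a b assume ab: "a \<in> U" "b \<in> U" "a \<noteq> 0" "b \<noteq> 0" "a \<noteq> b" and n: "\<not> (a \<in> E \<or> b \<in> E \<or> a + b \<in> E)"
    let ?D = "{0, a, b, a + b}"
    have D: "subspace ?D" "?D \<subseteq> U"
      using span_pair [of b a] subspace_span [of "{b, a}"] ab U(1) by (auto simp: subspaceD)
    have "dim ?D = 2"
      using span_pair [of b a] dim_span_eq_card_independent [of "{b, a}"] independent_pair_iff [of b a] ab by auto
    then have "triangle (snd M) (?D - {0})"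
      unfolding triangle_def gdim_def V_Diff [OF D(1)] using D flat_iff by blast
    moreover have "?D - {0} \<subseteq> snd M - fst M" using D(2) n by (auto simp: M)
    ultimately show False using tf by (auto simp: triangle_free_def matroid_complement_def)
  qed
next
  assume cf: "cotriangle_free U"
  show "triangle_free (matroid_complement M)"
    unfolding triangle_free_def
  proof
    assume "\<exists>T. triangle (snd (matroid_complement M)) T \<and> T \<subseteq> fst (matroid_complement M)"
    then obtain T where T: "triangle (snd M) T" "T \<subseteq> snd M - fst M" by (auto simp: matroid_complement_def)
    then obtain D where D: "subspace D" "D \<subseteq> U" "T = D - {0}" using flat_iff by (auto simp: triangle_def)
    then have "dim D = 2" using T V_Diff [OF D(1)] by (simp add: triangle_def gdim_def)
    then obtain a b where ab: "a \<noteq> 0" "b \<noteq> 0" "b \<noteq> a" "D = {0, a, b, a + b}"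
      by (rule subspace_dim_2 [OF D(1)])
    have "a + b \<noteq> 0" using ab by (simp add: sum_zero_iff)
    then have "a \<in> T" "b \<in> T" "a + b \<in> T" using ab D(3) by auto
    then have "a \<in> U" "b \<in> U" "a \<notin> E" "b \<notin> E" "a + b \<notin> E" using T(2) D(2,3) by (auto simp: M)
    then show False using cf ab unfolding cotriangle_free_def by metis
  qed
qed

lemma strict_PG_sum_iff: "strict_PG_sum M \<longleftrightarrow> PG_sum U"
proof
  assume s: "strict_PG_sum M"
  then obtain F1 F2 where F: "flat (snd M) F1" "flat (snd M) F2" "F1 \<noteq> {}" "F2 \<noteq> {}" "F1 \<inter> F2 = {}"
    "fst M = F1 \<union> F2" and sp: "span (fst M) = V (snd M)" unfolding strict_PG_sum_def by blast
  obtain A where A: "subspace A" "A \<subseteq> U" "F1 = A - {0}" using F(1) flat_iff by blast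
  obtain B where B: "subspace B" "B \<subseteq> U" "F2 = B - {0}" using F(2) flat_iff by blast
  have z: "0 \<in> A" "0 \<in> B" using A B by (auto simp: subspaceD)
  have "span (fst M) = {a + b | a b. a \<in> A \<and> b \<in> B}"
    unfolding F(6) span_Un A(3) B(3) span_delete_0 span_eq_iff [THEN iffD2, OF A(1)]
      span_eq_iff [THEN iffD2, OF B(1)] ..
  moreover have "V (snd M) = U" using V_Diff [OF U(1)] by (simp add: M)
  ultimately have "U = {a + b | a b. a \<in> A \<and> b \<in> B}" using sp by simp
  moreover have "E \<inter> U = A \<union> B - {0}" using F(6) A B by (auto simp: M)
  moreover have "A \<inter> B = {0}" using F(5) A(3) B(3) z by auto
  moreover have "A \<noteq> {0}" "B \<noteq> {0}" using F A B by auto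
  ultimately show "PG_sum U" using A(1) B(1) unfolding PG_sum_def by blast
next
  assume "PG_sum U"
  then obtain A B where A: "subspace A" and B: "subspace B" and nt: "A \<noteq> {0}" "B \<noteq> {0}" and AB: "A \<inter> B = {0}"
    and U_eq: "U = {a + b | a b. a \<in> A \<and> b \<in> B}" and EU: "E \<inter> U = A \<union> B - {0}"
    by (auto simp: PG_sum_def)
  have z: "0 \<in> A" "0 \<in> B" using A B by (auto simp: subspaceD)
  have E: "fst M = (A - {0}) \<union> (B - {0})" using EU by (auto simp: M)
  have "A \<union> B - {0} \<subseteq> U" using EU by blast
  then have sub: "A \<subseteq> U" "B \<subseteq> U" using subspaceD(1) [OF U(1)] by blast+
  have "span (fst M) = {a + b | a b. a \<in> A \<and> b \<in> B}"
    unfolding E span_Un span_delete_0 span_eq_iff [THEN iffD2, OF A] span_eq_iff [THEN iffD2, OF B] ..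
  also have "\<dots> = V (snd M)" unfolding M snd_conv V_Diff [OF U(1)] using U_eq by simp
  finally have "span (fst M) = V (snd M)" .
  moreover have "flat (snd M) (A - {0})" "flat (snd M) (B - {0})" using A B sub flat_iff by blast+
  moreover have "A - {0} \<noteq> {}" "B - {0} \<noteq> {}" "(A - {0}) \<inter> (B - {0}) = {}" using nt z AB by auto
  ultimately show "strict_PG_sum M" using E unfolding strict_PG_sum_def by blast
qed

lemma decomposer_iff: "(\<exists>F. decomposer M F) \<longleftrightarrow> (\<exists>D. summand U D)"
proof
  assume "\<exists>F. decomposer M F"
  then obtain F where F: "flat (snd M) F" "F \<noteq> {}" "F \<noteq> snd M"
    and un: "\<And>A. flat_coset (snd M) F A \<Longrightarrow> \<not> mixed M A" unfolding decomposer_def by blast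
  obtain D where D: "subspace D" "D \<subseteq> U" "F = D - {0}" using F(1) flat_iff by blast
  have VF: "V F = D" using V_Diff [OF D(1)] D(3) by simp
  have "x + y \<in> E \<longleftrightarrow> x \<in> E" if x: "x \<in> U - D" and y: "y \<in> D" for x y
  proof -
    let ?A = "{x + y | y. y \<in> V F}"
    have "x \<noteq> 0" using x D(1) by (auto simp: subspaceD)
    then have "flat_coset (snd M) F ?A" unfolding flat_coset_def using x D(3) by (auto simp: M)
    then have "\<not> mixed M ?A" by (rule un)
    moreover have "x + 0 \<in> ?A" "x + y \<in> ?A" using y VF D(1) by (blast dest: subspaceD(1))+
    moreover have "x + y \<in> U" "x + y \<notin> D"
      using x y D U(1) subspaceD(4) [OF D(1) y] by (auto simp: subspaceD)
    then have "x + y \<in> U - {0}" "x \<in> U - {0}" using x \<open>x \<noteq> 0\<close> D(1) by (auto simp: subspaceD)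
    ultimately show ?thesis unfolding mixed_def M by auto
  qed
  moreover have "D \<noteq> {0}" "D \<noteq> U" using F D(3) by (auto simp: M)
  ultimately show "\<exists>D. summand U D" using D unfolding summand_def by blast
next
  assume "\<exists>D. summand U D"
  then obtain D where D: "subspace D" "D \<subseteq> U" "D \<noteq> {0}" "D \<noteq> U"
    and un: "\<And>x y. x \<in> U - D \<Longrightarrow> y \<in> D \<Longrightarrow> x + y \<in> E \<longleftrightarrow> x \<in> E" unfolding summand_def by blast
  have z: "0 \<in> D" "0 \<in> U" using D U by (auto simp: subspaceD)
  have "\<not> mixed M A" if A: "flat_coset (snd M) (D - {0}) A" for A
  proof -
    obtain x where x: "x \<in> snd M - (D - {0})" "A = {x + y | y. y \<in> D}"
      using A unfolding flat_coset_def V_Diff [OF D(1)] by blast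
    then have "x \<in> U - D" using z by (auto simp: M)
    then have "v \<in> E \<longleftrightarrow> x \<in> E" if "v \<in> A" for v using that un x(2) by blast
    then show ?thesis unfolding mixed_def M by auto
  qed
  moreover have "flat (snd M) (D - {0})" using D flat_iff by blast
  moreover have "D - {0} \<noteq> {}" "D - {0} \<noteq> snd M" using D z by (auto simp: M)
  ultimately have "decomposer M (D - {0})" unfolding decomposer_def by blast
  then show "\<exists>F. decomposer M F" by blast
qed

end

end

theorem theorem5p2:
  fixes scale :: "bit \<Rightarrow> 'v::ab_group_add \<Rightarrow> 'v"
  assumes "f2_space scale"
    and "\<forall>M. f2_space.matroid scale M \<and> f2_space.gdim scale (snd M) \<le> 8 \<and>
           f2_space.claw_free scale M \<longrightarrow>
             f2_space.even_plane scale M \<or>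
             f2_space.triangle_free scale (matroid_complement M) \<or>
             f2_space.strict_PG_sum scale M \<or>
             (\<exists>F. f2_space.decomposer scale M F)"
  shows "\<forall>M. f2_space.matroid scale M \<and> f2_space.claw_free scale M \<longrightarrow>
             f2_space.even_plane scale M \<or>
             f2_space.triangle_free scale (matroid_complement M) \<or>
             f2_space.strict_PG_sum scale M \<or>
             (\<exists>F. f2_space.decomposer scale M F)"
proof (intro allI impI, elim conjE)
  fix M :: "'v bmatroid"
  interpret f2_space scale by fact
  assume M: "matroid M" and cf: "claw_free M"
  define U where "U = V (snd M)"
  have g: "0 \<notin> snd M" "subspace U" "\<exists>B. finite B \<and> span B = U" "fst M \<subseteq> snd M"
    using M by (auto simp: matroid_def geometry_def U_def)
  interpret f2_points scale "fst M" using g by unfold_locales auto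
  \<comment> \<open>A finitely generated space over a finite field is finite, so cardinality can
    take the place of dimension.\<close>
  have fin: "finite U" using g(3) finite_span by auto
  have M_eq: "M = (fst M \<inter> U, U - {0})" using g by (auto simp: U_def prod_eq_iff)
  have "clawless U" using claw_free_iff [OF g(2) fin M_eq] cf by blast
  have "quadratic U \<or> cotriangle_free U \<or> PG_sum U \<or> (\<exists>D. summand U D)"
  proof (rule structure_induction [OF _ g(2) fin \<open>clawless U\<close>])
    fix W assume W: "subspace W" "finite W" "card W < 512" "clawless W"
    \<comment> \<open>The assumption is applied to the restriction of \<open>M\<close> to
      \<open>W\<close>, whose dimension is at most 8 because \<open>card W < 2 ^ 9\<close>.\<close>
    let ?N = "(fst M \<inter> W, W - {0})"
    have "matroid ?N" "gdim (snd ?N) \<le> 8" "claw_free ?N"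
      using matroid_M [OF W(1,2) refl] gdim_le_8 [OF W(1,2) refl W(3)] claw_free_iff [OF W(1,2) refl] W(4) by auto
    then have "even_plane ?N \<or> triangle_free (matroid_complement ?N) \<or> strict_PG_sum ?N \<or> (\<exists>F. decomposer ?N F)"
      using assms(2) by blast
    then show "quadratic W \<or> cotriangle_free W \<or> PG_sum W \<or> (\<exists>D. summand W D)"
      using even_plane_iff [OF W(1,2) refl] triangle_free_iff [OF W(1,2) refl]
        strict_PG_sum_iff [OF W(1,2) refl] decomposer_iff [OF W(1,2) refl] by blast
  qed
  then show "even_plane M \<or> triangle_free (matroid_complement M) \<or> strict_PG_sum M \<or> (\<exists>F. decomposer M F)"
    using even_plane_iff [OF g(2) fin M_eq] triangle_free_iff [OF g(2) fin M_eq]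
      strict_PG_sum_iff [OF g(2) fin M_eq] decomposer_iff [OF g(2) fin M_eq] by blast
qed

end
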